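(* Let $\mathcal{H}$ be the curve over the rational function field $\mathbb{Q}(t)$ defined by $$S^2=t^8(1+t^4)^2p^4+4t^5(1+2t^4+2t^8+t^{12})p^3q-2t^4(4+3t^2+9t^4+4t^6+9t^8+3t^{10}+4t^{12})p^2q^2+4t^3(1-t^2+t^4)(1+t^2+t^4)^2pq^3+t^4(1+t^2+t^4)^2q^4 .$$ Then $\mathcal{H}$ is an elliptic curve over $\mathbb{Q}(t)$, and $\operatorname{rank}\mathcal{H}(\mathbb{Q}(t))\ge 1$.
   Context: Here $t$ is an indeterminate. The points of $\mathcal{H}$ are written $(p:q:S)$; the equation is homogeneous with $p,q$ of weight $1$ and $S$ of weight $2$, so $(p:q:S)=(\lambda p:\lambda q:\lambda^2 S)$ for $\lambda\neq 0$, with $(p,q)\ne(0,0)$. Being an elliptic curve means being a smooth curve of genus one with a $\mathbb{Q}(t)$-rational point, and the rank is the rank of the group of $\mathbb{Q}(t)$-rational points (with respect to a rational point chosen as origin; equivalently, of the group of $\mathbb{Q}(t)$-points of its Jacobian). *)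

theory Defs
  imports
    "HOL-Computational_Algebra.Computational_Algebra"
    "HOL-Library.Extended_Nat"
    "HOL-Algebra.Algebraic_Closure_Type"
begin

section \<open>Double covers of the projective line given by binary quartics\<close>

text \<open>
  \<open>Quartic a b c d e\<close> stands for the binary quartic form
  \<open>F(p, q) = a p^4 + b p^3 q + c p^2 q^2 + d p q^3 + e q^4\<close> and, at the same time, for the
  projective curve \<open>S^2 = F(p, q)\<close> in the weighted projective plane with weights 1, 1, 2.
\<close>

datatype 'a quartic = Quartic 'a 'a 'a 'a 'a

fun quartic_form :: "'a::comm_semiring_1 quartic \<Rightarrow> 'a \<Rightarrow> 'a \<Rightarrow> 'a" where
  "quartic_form (Quartic a b c d e) p q =
     a * p^4 + b * p^3 * q + c * p^2 * q^2 + d * p * q^3 + e * q^4"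

text \<open>
  The curve is covered by two affine plane curves: \<open>y^2 = F(x, 1)\<close> on the chart \<open>q \<noteq> 0\<close>,
  where \<open>x = p/q\<close> and \<open>y = S/q^2\<close>, and \<open>v^2 = F(1, u)\<close> on the chart \<open>p \<noteq> 0\<close>, where
  \<open>u = q/p\<close> and \<open>v = S/p^2\<close>.  (The point \<open>(0:0:1)\<close>, the only singular point of the ambient
  plane, is not on the curve.)  On the overlap \<open>u = 1/x\<close> and \<open>v = y/x^2\<close>.
\<close>

fun dehom_q :: "'a::zero quartic \<Rightarrow> 'a poly" where
  "dehom_q (Quartic a b c d e) = [:e, d, c, b, a:]"

fun dehom_p :: "'a::zero quartic \<Rightarrow> 'a poly" where
  "dehom_p (Quartic a b c d e) = [:a, b, c, d, e:]"

type_synonym 'a wpt = "('a \<times> 'a \<times> 'a) set"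

text \<open>\<open>wpoint (p, q, S)\<close> is the point \<open>(p:q:S)\<close>, as the set of its coordinate triples.\<close>

definition wpoint :: "'a::field \<times> 'a \<times> 'a \<Rightarrow> 'a wpt" where
  "wpoint = (\<lambda>(p, q, S). {(l * p, l * q, l^2 * S) | l. l \<noteq> 0})"

definition curve_points :: "'a::alg_closed_field quartic \<Rightarrow> 'a wpt set" where
  "curve_points C =
     {wpoint (p, q, S) | p q S. (p, q) \<noteq> (0, 0) \<and> S^2 = quartic_form C p q}"

text \<open>Over an arbitrary field, rational points are viewed inside the geometric points.\<close>

definition rational_points ::
    "'k::field quartic \<Rightarrow> 'k alg_closure wpt set" where
  "rational_points C =
     {wpoint (to_ac p, to_ac q, to_ac S) | p q S. (p, q) \<noteq> (0, 0) \<and> S^2 = quartic_form C p q}"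


section \<open>Smoothness and irreducibility over an algebraically closed field\<close>

text \<open>The Jacobian criterion for the affine plane curve \<open>y^2 = f(x)\<close>.\<close>

definition smooth_affine :: "'a::alg_closed_field poly \<Rightarrow> bool" where
  "smooth_affine f \<longleftrightarrow>
     (\<forall>x y. y^2 = poly f x \<longrightarrow> 2 * y \<noteq> 0 \<or> poly (pderiv f) x \<noteq> 0)"

definition smooth_curve :: "'a::alg_closed_field quartic \<Rightarrow> bool" where
  "smooth_curve C \<longleftrightarrow> smooth_affine (dehom_q C) \<and> smooth_affine (dehom_p C)"

text \<open>Irreducibility of \<open>y^2 - F(x, 1)\<close>, as a polynomial in \<open>y\<close> over the polynomials in \<open>x\<close>.\<close>

definition irreducible_curve :: "'a::alg_closed_field quartic \<Rightarrow> bool" where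
  "irreducible_curve C \<longleftrightarrow> Factorial_Ring.irreducible [:- dehom_q C, 0, 1:]"


section \<open>Function field and orders of vanishing\<close>

text \<open>
  For an irreducible curve over the algebraically closed field \<open>k\<close>, the function field is
  realised as the subfield \<open>k(x)(y)\<close> of an algebraic closure of \<open>k(x)\<close>, where \<open>y\<close> is a fixed
  square root of \<open>F(x, 1)\<close>.  The triple \<open>(x:1:y)\<close> is thus the generic point of the curve.
\<close>

definition const_fn :: "'a::alg_closed_field \<Rightarrow> 'a poly fract alg_closure" where
  "const_fn c = to_ac (Fract [:c:] 1)"

definition gen_x :: "'a::alg_closed_field poly fract alg_closure" where
  "gen_x = to_ac (Fract [:0, 1:] 1)"

definition gen_y :: "'a::alg_closed_field quartic \<Rightarrow> 'a poly fract alg_closure" where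
  "gen_y C = (SOME y. y^2 = to_ac (Fract (dehom_q C) 1))"

definition function_field :: "'a::alg_closed_field quartic \<Rightarrow> 'a poly fract alg_closure set" where
  "function_field C = {to_ac a + to_ac b * gen_y C | a b. True}"

text \<open>
  \<open>eval2 \<phi> G u v\<close> is the value at \<open>(u, v)\<close> of the bivariate polynomial \<open>G\<close>, whose inner
  variable is the first one; \<open>\<phi>\<close> is applied to the coefficients.
\<close>

definition eval2 :: "('a::comm_ring_1 \<Rightarrow> 'b::comm_ring_1) \<Rightarrow> 'a poly poly \<Rightarrow> 'b \<Rightarrow> 'b \<Rightarrow> 'b" where
  "eval2 \<phi> G u v = poly (map_poly (\<lambda>g. poly (map_poly \<phi> g) u) G) v"

text \<open>
  The local ring at a point: quotients of polynomials in the coordinates of an affine chart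
  around the point, the denominator not vanishing at the point.
\<close>

definition local_ring ::
    "'a::alg_closed_field quartic \<Rightarrow> 'a wpt \<Rightarrow> 'a poly fract alg_closure set" where
  "local_ring C P = {h. \<exists>p q S G H. (p, q, S) \<in> P \<and>
     (if q \<noteq> 0
      then eval2 id H (p / q) (S / q^2) \<noteq> 0 \<and>
           h = eval2 const_fn G gen_x (gen_y C) / eval2 const_fn H gen_x (gen_y C)
      else eval2 id H (q / p) (S / p^2) \<noteq> 0 \<and>
           h = eval2 const_fn G (1 / gen_x) (gen_y C / gen_x^2) /
               eval2 const_fn H (1 / gen_x) (gen_y C / gen_x^2))}"

definition local_units ::
    "'a::alg_closed_field quartic \<Rightarrow> 'a wpt \<Rightarrow> 'a poly fract alg_closure set" where
  "local_units C P = {h \<in> local_ring C P. h \<noteq> 0 \<and> inverse h \<in> local_ring C P}"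

text \<open>A uniformizer is a generator of the maximal ideal, which consists of the nonunits.\<close>

definition uniformizer ::
    "'a::alg_closed_field quartic \<Rightarrow> 'a wpt \<Rightarrow> 'a poly fract alg_closure \<Rightarrow> bool" where
  "uniformizer C P w \<longleftrightarrow> local_ring C P - local_units C P = {w * h | h. h \<in> local_ring C P}"

text \<open>Meaningful for nonzero elements of the function field of a smooth irreducible curve.\<close>

definition vanishing_order ::
    "'a::alg_closed_field quartic \<Rightarrow> 'a wpt \<Rightarrow> 'a poly fract alg_closure \<Rightarrow> int" where
  "vanishing_order C P h =
     (THE n. \<exists>w e. uniformizer C P w \<and> e \<in> local_units C P \<and> h = w powi n * e)"


section \<open>Divisors and genus\<close>

definition divisors :: "'a::alg_closed_field quartic \<Rightarrow> ('a wpt \<Rightarrow> int) set" where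
  "divisors C = {D. finite {P. D P \<noteq> 0} \<and> {P. D P \<noteq> 0} \<subseteq> curve_points C}"

definition divisor_degree :: "('p \<Rightarrow> int) \<Rightarrow> int" where
  "divisor_degree D = (\<Sum>P | D P \<noteq> 0. D P)"

definition principal :: "'a::alg_closed_field quartic \<Rightarrow> ('a wpt \<Rightarrow> int) \<Rightarrow> bool" where
  "principal C D \<longleftrightarrow>
     (\<exists>h \<in> function_field C. h \<noteq> 0 \<and> (\<forall>P \<in> curve_points C. vanishing_order C P h = D P))"

definition riemann_roch_space ::
    "'a::alg_closed_field quartic \<Rightarrow> ('a wpt \<Rightarrow> int)
       \<Rightarrow> 'a poly fract alg_closure set" where
  "riemann_roch_space C D = {h \<in> function_field C.
     h = 0 \<or> (\<forall>P \<in> curve_points C. vanishing_order C P h + D P \<ge> 0)}"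

definition riemann_roch_dim ::
    "'a::alg_closed_field quartic \<Rightarrow> ('a wpt \<Rightarrow> int) \<Rightarrow> int" where
  "riemann_roch_dim C D =
     int (vector_space.dim (\<lambda>c h. const_fn c * h) (riemann_roch_space C D))"

text \<open>The genus is the maximum of \<open>deg D + 1 - l(D)\<close> over all divisors \<open>D\<close>.\<close>

definition has_genus :: "'a::alg_closed_field quartic \<Rightarrow> int \<Rightarrow> bool" where
  "has_genus C g \<longleftrightarrow>
     (\<forall>D \<in> divisors C. divisor_degree D + 1 - riemann_roch_dim C D \<le> g) \<and>
     (\<exists>D \<in> divisors C. divisor_degree D + 1 - riemann_roch_dim C D = g)"


section \<open>Elliptic curves and the rank of the group of rational points\<close>

abbreviation geometric :: "'k::field quartic \<Rightarrow> 'k alg_closure quartic" where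
  "geometric C \<equiv> map_quartic to_ac C"

definition elliptic_curve :: "'k::field quartic \<Rightarrow> bool" where
  "elliptic_curve C \<longleftrightarrow>
     smooth_curve (geometric C) \<and> irreducible_curve (geometric C) \<and>
     has_genus (geometric C) 1 \<and> rational_points C \<noteq> {}"

text \<open>
  The group law on the rational points with origin \<open>Z\<close>: the sum of \<open>P\<close> and \<open>Q\<close> is the unique
  rational point \<open>R\<close> such that the divisors \<open>P + Q\<close> and \<open>R + Z\<close> are linearly equivalent, i.e.\
  \<open>P \<mapsto> [P] - [Z]\<close> is a homomorphism to the divisor class group.
\<close>

definition point_add ::
    "'k::field quartic \<Rightarrow> 'k alg_closure wpt \<Rightarrow> 'k alg_closure wpt \<Rightarrow> 'k alg_closure wpt
       \<Rightarrow> 'k alg_closure wpt" where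
  "point_add C Z P Q = (THE R. R \<in> rational_points C \<and>
     principal (geometric C)
       (\<lambda>Y. of_bool (Y = P) + of_bool (Y = Q) - of_bool (Y = R) - of_bool (Y = Z)))"

definition point_group ::
    "'k::field quartic \<Rightarrow> 'k alg_closure wpt \<Rightarrow> 'k alg_closure wpt monoid" where
  "point_group C Z = \<lparr>carrier = rational_points C, monoid.mult = point_add C Z, one = Z\<rparr>"

text \<open>The rank of an abelian group: the maximal number of \<open>\<int>\<close>-linearly independent elements.\<close>

definition int_independent :: "('g, 'm) monoid_scheme \<Rightarrow> 'g set \<Rightarrow> bool" where
  "int_independent G B \<longleftrightarrow> finite B \<and> B \<subseteq> carrier G \<and>
     (\<forall>c :: 'g \<Rightarrow> int. (\<Otimes>\<^bsub>G\<^esub>b\<in>B. b [^]\<^bsub>G\<^esub> c b) = \<one>\<^bsub>G\<^esub> \<longrightarrow> (\<forall>b \<in> B. c b = 0))"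

definition group_rank :: "('g, 'm) monoid_scheme \<Rightarrow> enat" where
  "group_rank G = Sup {enat (card B) | B. int_independent G B}"


section \<open>The curve\<close>

text \<open>The field \<open>\<rat>(t)\<close> is \<open>rat poly fract\<close>.\<close>

definition tvar :: "rat poly fract" where
  "tvar = Fract [:0, 1:] 1"

definition curve_H :: "rat poly fract quartic" where
  "curve_H = (let t = tvar in Quartic
     (t^8 * (1 + t^4)^2)
     (4 * t^5 * (1 + 2 * t^4 + 2 * t^8 + t^12))
     (- 2 * t^4 * (4 + 3 * t^2 + 9 * t^4 + 4 * t^6 + 9 * t^8 + 3 * t^10 + 4 * t^12))
     (4 * t^3 * (1 - t^2 + t^4) * (1 + t^2 + t^4)^2)
     (t^4 * (1 + t^2 + t^4)^2))"

end

theory Submission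
  imports Defs
begin

text \<open>
  Write \<open>F(p, q)\<close> for a binary quartic form over a field \<open>k0\<close> of characteristic zero, with nonzero
  discriminant and with leading coefficient a nonzero square \<open>\<sigma>^2\<close>, and \<open>k\<close> for the algebraic
  closure. Most of what follows holds for every such form; only smoothness and the infinite
  order of a point depend on the coefficients of \<open>\<H>\<close>.

  \<^emph>\<open>Orders of vanishing.\<close> Both affine charts have the shape \<open>\<eta>^2 = f(\<xi>)\<close> with \<open>f\<close> separable. At a
  point the uniformizer is \<open>\<xi> - x0\<close>, or \<open>\<eta>\<close> at a branch point, and every nonzero \<open>p(\<xi>) + q(\<xi>) \<eta>\<close>
  is a power of it times a unit: after removing common zeros of \<open>p\<close> and \<open>q\<close>, at an unramified point
  this function or its conjugate \<open>p - q \<eta>\<close> is a unit, and the norm \<open>p^2 - f q^2\<close> is a polynomial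
  in \<open>\<xi>\<close> (\<open>el_factor\<close>).

  \<^emph>\<open>Genus.\<close> Let \<open>D_inf\<close> be the sum of the two points at infinity. The functions with poles bounded by
  \<open>n D_inf\<close> are the \<open>p(x) + q(x) y\<close> with \<open>deg p \<le> n\<close> and \<open>deg q \<le> n - 2\<close>, so \<open>l(n D_inf) = 2 n\<close> for
  \<open>n \<ge> 2\<close>. The inequality \<open>l(D) \<ge> deg D\<close> passes from a divisor to every smaller one, since one more
  pole costs at most one dimension, and it is invariant under adding the divisor of \<open>x - x0\<close>; hence
  it holds for all \<open>D\<close> (\<open>riemann_inequality\<close>). Equality for \<open>D_inf\<close> shows that the genus is one.

  \<^emph>\<open>Group law.\<close> A point is determined by its divisor class because no function has a single simple
  pole (\<open>point_unique\<close>). For existence of the sum of rational points, a function \<open>p + q y\<close> with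
  \<open>deg p \<le> 2\<close> and constant \<open>q\<close> vanishes at three given rational points by the Riemann inequality,
  has a fourth zero, and this zero is rational (\<open>fourth_point\<close>). Descent from \<open>k\<close> to \<open>k0\<close> is
  elementary: vanishing to order \<open>m\<close> at a rational point is a system of linear conditions over \<open>k0\<close>
  on the coefficients of \<open>p\<close> and \<open>q\<close>, so it survives the application of a \<open>k0\<close>-linear functional
  \<open>k \<rightarrow> k0\<close> to the coefficients (\<open>vanishes_descent\<close>).

  \<^emph>\<open>Infinite order.\<close> Suppose \<open>n\<close> times the difference of the two points at infinity is principal,
  \<open>n > 0\<close>. In terms of \<open>u = 1/x\<close> this gives polynomials \<open>\<alpha>, \<beta>\<close>, not both zero, of degrees at most \<open>n\<close>
  and \<open>n - 2\<close>, with \<open>\<alpha> + \<beta> sqrt(F(1, u)) \<equiv> 0\<close> modulo \<open>u^(2n)\<close>. For \<open>\<H>\<close>, substitute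
  \<open>u = t^3 (1 + t^4)^2 u'\<close> and divide the square root by \<open>\<sigma> = t^4 (1 + t^4)\<close>; it becomes a power
  series over \<open>\<rat>[t]\<close> which specializes to \<open>sqrt(1 + 4 u')\<close> at \<open>t = 0\<close>. An approximation of this
  order to \<open>sqrt(1 + 4 u')\<close> does not exist, by the rational parametrization of the conic
  (\<open>no_approximation_conic\<close>), and clearing common factors \<open>t\<close> transports this to \<open>\<rat>(t)\<close>. In other
  words, the point lies in the kernel of reduction at \<open>t = 0\<close>, which has no torsion in
  characteristic zero. So for any origin, one of the two points at infinity has infinite order.
\<close>

section \<open>Discrete valuations\<close>

definition ring_units :: "'l::field set \<Rightarrow> 'l set" where
  "ring_units R = {h \<in> R. h \<noteq> 0 \<and> inverse h \<in> R}"

text \<open>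
  The order of vanishing refers to the curve only through the local ring. With the ring as a
  parameter, its rules can be proved once for affine points and points at infinity.
\<close>

definition ord_at :: "'l::field set \<Rightarrow> 'l \<Rightarrow> int" where
  "ord_at R h = (THE n. \<exists>w e. R - ring_units R = {w * g | g. g \<in> R} \<and> e \<in> ring_units R \<and>
     h = w powi n * e)"

text \<open>
  A discrete valuation ring \<open>R\<close> with uniformizer \<open>w\<close>, presented by what can be checked directly for
  the local rings below: every nonzero function is a power of \<open>w\<close> times a unit, and \<open>w\<close> is not
  invertible.
\<close>

locale dvr =
  fixes F R :: "'l::field set" and w :: 'l
  assumes R_F: "R \<subseteq> F"
    and R_0: "0 \<in> R" and R_1: "1 \<in> R"
    and R_add: "x \<in> R \<Longrightarrow> y \<in> R \<Longrightarrow> x + y \<in> R"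
    and R_mult: "x \<in> R \<Longrightarrow> y \<in> R \<Longrightarrow> x * y \<in> R"
    and w_R: "w \<in> R" and w_nz: "w \<noteq> 0" and inv_w: "inverse w \<notin> R"
    and factorization: "h \<in> F \<Longrightarrow> h \<noteq> 0 \<Longrightarrow> \<exists>n. \<exists>e \<in> ring_units R. h = w powi n * e"
begin

abbreviation U where "U \<equiv> ring_units R"

lemma U_R: "e \<in> U \<Longrightarrow> e \<in> R" and U_nz: "e \<in> U \<Longrightarrow> e \<noteq> 0"
  by (auto simp: ring_units_def)

lemma U_mult: "x \<in> U \<Longrightarrow> y \<in> U \<Longrightarrow> x * y \<in> U"
  by (auto simp: ring_units_def R_mult)

lemma U_inverse: "x \<in> U \<Longrightarrow> inverse x \<in> U"
  by (auto simp: ring_units_def)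

lemma U_1: "1 \<in> U"
  by (auto simp: ring_units_def R_1)

lemma U_power: "x \<in> U \<Longrightarrow> x ^ n \<in> U"
  by (induction n) (auto simp: U_1 U_mult)

lemma U_powi: "x \<in> U \<Longrightarrow> x powi n \<in> U"
  by (simp add: power_int_def U_power U_inverse)

lemma R_power: "x \<in> R \<Longrightarrow> x ^ n \<in> R"
  by (induction n) (auto simp: R_1 R_mult)

lemma w_powi_R: "n \<ge> 0 \<Longrightarrow> w powi n \<in> R"
  by (simp add: power_int_def R_power w_R)

lemma w_powi_U: "w powi n \<in> U \<longleftrightarrow> n = 0"
proof -
  have pos: False if "n > 0" "w powi n \<in> U" for n
  proof -
    have "w powi (n - 1) * inverse (w powi n) = inverse w"
      using w_nz by (simp add: power_int_diff inverse_eq_divide)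
    moreover have "w powi (n - 1) * inverse (w powi n) \<in> R"
      using that by (intro R_mult w_powi_R) (auto simp: ring_units_def)
    ultimately show False using inv_w by simp
  qed
  moreover have "w powi (- n) \<in> U" if "w powi n \<in> U"
    using U_inverse[OF that] by (simp add: power_int_minus)
  ultimately show ?thesis
    using pos[of n] pos[of "- n"] U_1 by (cases "n = 0"; cases "n > 0") auto
qed

lemma factorization_unique:
  assumes "w powi m * d = w powi n * e" "d \<in> U" "e \<in> U"
  shows "m = n"
proof -
  have "w powi (m - n) = e * inverse d"
    using assms w_nz U_nz[of d] by (simp add: power_int_diff field_simps)
  then have "w powi (m - n) \<in> U" using assms U_mult U_inverse by simp
  then show ?thesis by (simp add: w_powi_U)
qed

lemma powi_unit_in_R: "e \<in> U \<Longrightarrow> w powi n * e \<in> R \<longleftrightarrow> n \<ge> 0"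
proof (cases "n \<ge> 0")
  case False
  assume e: "e \<in> U"
  show ?thesis
  proof
    assume "w powi n * e \<in> R"
    then have "(w powi n * e) * inverse e \<in> R"
      using e by (rule_tac R_mult) (auto simp: ring_units_def)
    moreover have "(w powi n * e) * inverse e = w powi n" using U_nz[OF e] by (simp add: mult.assoc)
    ultimately have "w powi n \<in> R" by metis
    moreover have "inverse (w powi n) \<in> R"
      using w_powi_R[of "- n"] False by (simp add: power_int_minus)
    ultimately have "w powi n \<in> U" using w_nz by (simp add: ring_units_def)
    with False show "n \<ge> 0" by (simp add: w_powi_U)
  qed (use False in simp)
qed (simp add: R_mult w_powi_R U_R)

lemma powi_unit_in_U: "e \<in> U \<Longrightarrow> w powi n * e \<in> U \<longleftrightarrow> n = 0"
  using factorization_unique[of n e 0 "w powi n * e"] by auto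

lemma w_generates: "R - U = {w * g | g. g \<in> R}"
proof (intro Set.set_eqI iffI)
  fix h assume h: "h \<in> R - U"
  show "h \<in> {w * g | g. g \<in> R}"
  proof (cases "h = 0")
    case False
    then obtain n e where e: "e \<in> U" "h = w powi n * e" using factorization R_F h by blast
    with h have "n > 0" using powi_unit_in_R[of e n] powi_unit_in_U[of e n] by simp
    then have "h = w * (w powi (n - 1) * e)" using w_nz e by (simp add: power_int_diff)
    moreover have "w powi (n - 1) * e \<in> R" using e \<open>n > 0\<close> by (simp add: powi_unit_in_R)
    ultimately show ?thesis by blast
  qed (use R_0 in auto)
next
  fix h assume "h \<in> {w * g | g. g \<in> R}"
  then obtain g where g: "g \<in> R" "h = w * g" by blast
  have "h \<notin> U"
  proof
    assume h: "h \<in> U"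
    then have "g * inverse h \<in> R" using g by (auto simp: ring_units_def R_mult)
    moreover have "g * inverse h = inverse w" using g U_nz[OF h] by (simp add: field_simps)
    ultimately show False using inv_w by simp
  qed
  then show "h \<in> R - U" using g R_mult w_R by simp
qed

text \<open>
  Two generators of the maximal ideal divide each other, hence differ by a unit; this is why the
  order of vanishing is independent of the uniformizer.
\<close>

lemma generator_associated:
  assumes "R - U = {w' * g | g. g \<in> R}"
  obtains e where "e \<in> U" "w' = w * e"
proof -
  have "w' * 1 \<in> {w' * g | g. g \<in> R}" using R_1 by blast
  then have "w' \<in> {w * g | g. g \<in> R}" unfolding assms[symmetric] w_generates by simp
  then obtain g where g: "g \<in> R" "w' = w * g" by blast
  have "w * 1 \<in> {w * g | g. g \<in> R}" using R_1 by blast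
  then have "w \<in> {w' * g | g. g \<in> R}" unfolding assms[symmetric] w_generates by simp
  then obtain g' where g': "g' \<in> R" "w = w' * g'" by blast
  have "g * g' = 1" using g g' w_nz by (metis mult.assoc mult_cancel_left2)
  then have "g \<in> U" using g g' by (auto simp: ring_units_def inverse_unique)
  then show ?thesis using that g by blast
qed

lemma ord_at_powi: "e \<in> U \<Longrightarrow> ord_at R (w powi n * e) = n"
  unfolding ord_at_def
proof (rule the_equality)
  assume e: "e \<in> U"
  show "\<exists>w' e'. R - U = {w' * g | g. g \<in> R} \<and> e' \<in> U \<and> w powi n * e = w' powi n * e'"
    using w_generates e by blast
  fix m assume "\<exists>w' e'. R - U = {w' * g | g. g \<in> R} \<and> e' \<in> U \<and> w powi n * e = w' powi m * e'"
  then obtain w' e' where *: "R - U = {w' * g | g. g \<in> R}" "e' \<in> U"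
    "w powi n * e = w' powi m * e'" by blast
  obtain d where d: "d \<in> U" "w' = w * d" using generator_associated[OF *(1)] .
  have "w powi n * e = w powi m * (d powi m * e')"
    using * d by (simp add: power_int_mult_distrib mult.assoc)
  then show "m = n" using factorization_unique e d * U_mult U_powi by metis
qed

lemma ord_decomp:
  assumes "h \<in> F" "h \<noteq> 0"
  obtains e where "e \<in> U" "h = w powi (ord_at R h) * e"
  using factorization[OF assms] ord_at_powi by metis

lemma ord_unit: "e \<in> U \<Longrightarrow> ord_at R e = 0"
  using ord_at_powi[of e 0] by simp

lemma ord_mult:
  assumes "g \<in> F" "g \<noteq> 0" "h \<in> F" "h \<noteq> 0"
  shows "ord_at R (g * h) = ord_at R g + ord_at R h"
proof -
  obtain d where d: "d \<in> U" "g = w powi (ord_at R g) * d" using ord_decomp assms by metis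
  obtain e where e: "e \<in> U" "h = w powi (ord_at R h) * e" using ord_decomp assms by metis
  have "g * h = w powi (ord_at R g + ord_at R h) * (d * e)"
    using w_nz by (subst d, subst e) (simp add: power_int_add mult_ac)
  then show ?thesis using ord_at_powi U_mult d e by metis
qed

lemma ord_in_R: "h \<in> F \<Longrightarrow> h \<noteq> 0 \<Longrightarrow> h \<in> R \<longleftrightarrow> ord_at R h \<ge> 0"
  using ord_decomp[of h] powi_unit_in_R by metis

lemma ord_in_U: "h \<in> F \<Longrightarrow> h \<noteq> 0 \<Longrightarrow> h \<in> U \<longleftrightarrow> ord_at R h = 0"
  using ord_decomp[of h] powi_unit_in_U by metis

lemma ord_add:
  assumes "g \<in> F" "g \<noteq> 0" "h \<in> F" "h \<noteq> 0" "g + h \<noteq> 0"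
    and "m \<le> ord_at R g" "m \<le> ord_at R h"
  shows "m \<le> ord_at R (g + h)"
proof -
  obtain d where d: "d \<in> U" "g = w powi (ord_at R g) * d" using ord_decomp assms by metis
  obtain e where e: "e \<in> U" "h = w powi (ord_at R h) * e" using ord_decomp assms by metis
  define r where "r = w powi (ord_at R g - m) * d + w powi (ord_at R h - m) * e"
  have r: "r \<in> R" unfolding r_def using d e assms by (intro R_add) (auto simp: powi_unit_in_R)
  have gh: "g + h = w powi m * r"
    unfolding r_def using w_nz by (subst d, subst e) (simp add: power_int_diff algebra_simps)
  with assms have r0: "r \<noteq> 0" by auto
  have "ord_at R (g + h) = m + ord_at R r"
  proof -
    obtain u where u: "u \<in> U" "r = w powi (ord_at R r) * u" using ord_decomp r r0 R_F by blast
    have "g + h = w powi (m + ord_at R r) * u"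
      using w_nz by (subst gh, subst u) (simp add: power_int_add mult_ac)
    then show ?thesis using ord_at_powi u by metis
  qed
  then show ?thesis using ord_in_R[of r] r r0 R_F by auto
qed

end

section \<open>Local rings of an affine double cover\<close>

lemma const_fn_0 [simp]: "const_fn 0 = 0" and const_fn_1 [simp]: "const_fn 1 = 1"
  by (simp_all add: const_fn_def flip: Zero_fract_def One_fract_def one_pCons)

lemma const_fn_add [simp]: "const_fn (c + d) = const_fn c + const_fn d"
  by (simp add: const_fn_def flip: to_ac_add)

lemma const_fn_mult [simp]: "const_fn (c * d) = const_fn c * const_fn d"
  by (simp add: const_fn_def mult.commute flip: to_ac_mult)

lemma const_fn_minus [simp]: "const_fn (- c) = - const_fn c"
  by (metis add.right_inverse add_eq_0_iff const_fn_0 const_fn_add)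

lemma const_fn_diff [simp]: "const_fn (c - d) = const_fn c - const_fn d"
  by (metis const_fn_add const_fn_minus diff_conv_add_uminus)

lemma const_fn_eq_0 [simp]: "const_fn c = 0 \<longleftrightarrow> c = 0"
  by (simp add: const_fn_def Zero_fract_def eq_fract)

lemma const_fn_inverse: "const_fn (inverse c) = inverse (const_fn c)"
  by (cases "c = 0") (simp, metis const_fn_1 const_fn_mult inverse_unique right_inverse)

definition ev :: "'a::alg_closed_field poly fract alg_closure \<Rightarrow> 'a poly \<Rightarrow> 'a poly fract alg_closure"
  where "ev \<xi> p = poly (map_poly const_fn p) \<xi>"

lemma ev_pCons: "ev \<xi> (pCons c p) = const_fn c + \<xi> * ev \<xi> p"
  by (cases "c = 0 \<and> p = 0") (auto simp: ev_def map_poly_pCons)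

lemma ev_0 [simp]: "ev \<xi> 0 = 0"
  by (simp add: ev_def)

lemma ev_const [simp]: "ev \<xi> [:c:] = const_fn c"
  by (simp add: ev_pCons)

lemma ev_1 [simp]: "ev \<xi> 1 = 1"
  using ev_const[of \<xi> 1] by (simp flip: one_pCons)

lemma ev_add [simp]: "ev \<xi> (p + q) = ev \<xi> p + ev \<xi> q"
proof (induction p arbitrary: q)
  case (pCons c p)
  obtain d q' where q: "q = pCons d q'" by (cases q)
  show ?case
    unfolding q by (simp only: add_pCons ev_pCons pCons.IH const_fn_add distrib_left) (simp only: add_ac)
qed simp

lemma ev_minus [simp]: "ev \<xi> (- p) = - ev \<xi> p"
  by (metis add.right_inverse add_eq_0_iff ev_0 ev_add)

lemma ev_diff [simp]: "ev \<xi> (p - q) = ev \<xi> p - ev \<xi> q"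
  by (metis ev_add ev_minus diff_conv_add_uminus)

lemma ev_smult [simp]: "ev \<xi> (smult c p) = const_fn c * ev \<xi> p"
  by (induction p) (simp_all add: ev_pCons algebra_simps)

lemma ev_mult [simp]: "ev \<xi> (p * q) = ev \<xi> p * ev \<xi> q"
  by (induction p) (simp_all add: ev_pCons algebra_simps)

lemma ev_power [simp]: "ev \<xi> (p ^ n) = ev \<xi> p ^ n"
  by (induction n) auto

lemma separable_linear_factor:
  fixes f :: "'a::field poly"
  assumes "poly f r = 0" "poly (pderiv f) r \<noteq> 0"
  obtains g where "f = [:- r, 1:] * g" "poly g r \<noteq> 0"
proof -
  obtain g where g: "f = [:- r, 1:] * g" using assms(1) by (auto simp: poly_eq_0_iff_dvd)
  with assms(2) have "poly g r \<noteq> 0" by (auto simp: pderiv_mult pderiv_pCons simp del: mult_pCons_left)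
  with g show ?thesis by (rule that)
qed

text \<open>
  The order of vanishing at a simple root of \<open>f\<close> is odd on the right-hand side and even on the left,
  unless both sides vanish.
\<close>

lemma separable_not_square:
  fixes f :: "'a::alg_closed_field poly"
  assumes deg: "degree f > 0" and sep: "\<And>x. poly f x = 0 \<Longrightarrow> poly (pderiv f) x \<noteq> 0"
    and eq: "a^2 = f * b^2"
  shows "b = 0"
proof (rule ccontr)
  assume b: "b \<noteq> 0"
  have f0: "f \<noteq> 0" using deg by auto
  obtain r where r: "poly f r = 0" using alg_closed_imp_poly_has_root deg by blast
  obtain g where g: "f = [:- r, 1:] * g" "poly g r \<noteq> 0"
    using separable_linear_factor[OF r sep[OF r]] .
  have "order r f = order r [:- r, 1:] + order r g" using f0 g order_mult by metis
  also have "order r g = 0" using g by (simp add: order_0I)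
  also have "order r [:- r, 1:] = 1" using order_power_n_n[of r 1] by simp
  finally have of: "order r f = 1" by simp
  have a: "a \<noteq> 0" using eq b f0 by auto
  have "order r (a * a) = order r (f * (b * b))" using eq by (simp add: power2_eq_square)
  then have "2 * order r a = 1 + 2 * order r b"
    using a b f0 of by (simp add: order_mult)
  then show False by presburger
qed

text \<open>
  An affine chart of a double cover of the line, with generic point \<open>(\<xi>, \<eta>)\<close>. Both charts of the
  projective curve are of this kind, inside the same function field.
\<close>

locale chart =
  fixes f :: "'a::{alg_closed_field,field_char_0} poly" and \<xi> \<eta> :: "'a poly fract alg_closure"
  assumes transcendental: "ev \<xi> p = 0 \<Longrightarrow> p = 0"
    and eta_sq: "\<eta>^2 = ev \<xi> f"
    and deg_f: "degree f > 0"
    and separable: "poly f x = 0 \<Longrightarrow> poly (pderiv f) x \<noteq> 0"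
begin

definition el where "el p q = ev \<xi> p + ev \<xi> q * \<eta>"

definition FF where "FF = {el p q / ev \<xi> r | p q r. r \<noteq> 0}"

lemma ev_eq_0 [simp]: "ev \<xi> p = 0 \<longleftrightarrow> p = 0"
  using transcendental by auto

lemma el_mult: "el p q * el r s = el (p * r + f * (q * s)) (p * s + q * r)"
proof -
  have "el p q * el r s = ev \<xi> p * ev \<xi> r + ev \<xi> q * ev \<xi> s * \<eta>^2 + (ev \<xi> p * ev \<xi> s + ev \<xi> q * ev \<xi> r) * \<eta>"
    by (simp add: el_def algebra_simps power2_eq_square)
  then show ?thesis by (simp add: eta_sq el_def algebra_simps)
qed

lemma norm_eq_0: "p * p - f * (q * q) = 0 \<longleftrightarrow> p = 0 \<and> q = 0"
  using separable_not_square[OF deg_f separable, of p q] by (auto simp: power2_eq_square)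

lemma el_norm: "el p q * el p (- q) = ev \<xi> (p * p - f * (q * q))"
  by (simp only: el_mult) (simp add: el_def algebra_simps)

lemma el_eq_0 [simp]: "el p q = 0 \<longleftrightarrow> p = 0 \<and> q = 0"
proof
  assume "el p q = 0"
  then have "p * p - f * (q * q) = 0" using el_norm[of p q] ev_eq_0 by (metis mult_zero_left)
  then show "p = 0 \<and> q = 0" by (simp only: norm_eq_0)
qed (simp add: el_def)

lemma el_add: "el p q + el r s = el (p + r) (q + s)"
  and el_minus: "- el p q = el (- p) (- q)"
  and el_diff: "el p q - el r s = el (p - r) (q - s)"
  by (simp_all add: el_def algebra_simps)

lemma el_0_0 [simp]: "el 0 0 = 0"
  by simp

lemma el_eq_iff [simp]: "el p q = el r s \<longleftrightarrow> p = r \<and> q = s"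
  using el_eq_0[of "p - r" "q - s"] by (simp flip: el_diff)

lemma ev_el: "ev \<xi> p = el p 0"
  by (simp add: el_def)

lemma el_scale: "ev \<xi> c * el p q = el (c * p) (c * q)"
  by (simp add: el_def algebra_simps)

lemma el_0_1 [simp]: "el 0 1 = \<eta>" and el_1_0 [simp]: "el 1 0 = 1"
  by (simp_all add: el_def)

lemma eta_nz: "\<eta> \<noteq> 0"
  using el_eq_0[of 0 1] by simp

lemma el_FF: "el p q \<in> FF"
  unfolding FF_def by (rule CollectI, rule exI[of _ p], rule exI[of _ q], rule exI[of _ 1]) simp

lemma FF_mult: "g \<in> FF \<Longrightarrow> h \<in> FF \<Longrightarrow> g * h \<in> FF"
proof -
  assume "g \<in> FF" "h \<in> FF"
  then obtain p q r p' q' r' where "r \<noteq> 0" "g = el p q / ev \<xi> r" "r' \<noteq> 0" "h = el p' q' / ev \<xi> r'"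
    unfolding FF_def by blast
  then have "g * h = el (p * p' + f * (q * q')) (p * q' + q * p') / ev \<xi> (r * r')" "r * r' \<noteq> 0"
    by (auto simp flip: el_mult)
  then show ?thesis unfolding FF_def by blast
qed

lemma FF_add: "g \<in> FF \<Longrightarrow> h \<in> FF \<Longrightarrow> g + h \<in> FF"
proof -
  assume "g \<in> FF" "h \<in> FF"
  then obtain p q r p' q' r' where *: "r \<noteq> 0" "g = el p q / ev \<xi> r" "r' \<noteq> 0" "h = el p' q' / ev \<xi> r'"
    unfolding FF_def by blast
  then have "g + h = (ev \<xi> r' * el p q + ev \<xi> r * el p' q') / ev \<xi> (r * r')"
    by (simp add: add_frac_eq mult.commute)
  then have "g + h = el (r' * p + r * p') (r' * q + r * q') / ev \<xi> (r * r')" "r * r' \<noteq> 0"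
    using * by (simp_all add: el_scale el_add)
  then show ?thesis unfolding FF_def by blast
qed

lemma inverse_el: "inverse (el p q) = el p (- q) / ev \<xi> (p * p - f * (q * q))"
proof (cases "p = 0 \<and> q = 0")
  case False
  then have "el p q \<noteq> 0" "el p (- q) \<noteq> 0" by simp_all
  then show ?thesis unfolding el_norm[symmetric] by (simp add: field_simps)
qed simp

lemma inverse_el_FF: "inverse (el p q) \<in> FF"
proof (cases "p = 0 \<and> q = 0")
  case False
  then have "p * p - f * (q * q) \<noteq> 0" by (simp only: norm_eq_0 not_False_eq_True)
  then show ?thesis unfolding FF_def inverse_el by blast
qed (use el_FF[of 0 0] in simp)

definition val :: "'a \<Rightarrow> 'a \<Rightarrow> 'a poly \<Rightarrow> 'a poly \<Rightarrow> 'a" where "val x y p q = poly p x + poly q x * y"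

definition lring where
  "lring x y = {h. \<exists>p q r s. val x y r s \<noteq> 0 \<and> h = el p q / el r s}"

definition par where
  "par x y = (if y = 0 then \<eta> else \<xi> - const_fn x)"

lemma xi_minus: "\<xi> - const_fn x = ev \<xi> [:- x, 1:]"
  by (simp add: ev_pCons)

lemma val_minus: "val x (- y) p (- q) = val x y p q"
  by (simp add: val_def)

lemma lring_FF: "lring x y \<subseteq> FF"
  unfolding lring_def by (auto simp: divide_inverse intro!: FF_mult el_FF inverse_el_FF)

text \<open>
  Polynomials in both coordinates reduce to the form \<open>p + q \<eta>\<close>, compatibly with evaluation at
  the points of the curve.
\<close>

lemma eval2_reduce:
  "\<exists>p q. eval2 const_fn G \<xi> \<eta> = el p q \<and> (\<forall>x y. y^2 = poly f x \<longrightarrow> eval2 id G x y = val x y p q)"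
proof (induction G)
  case 0
  show ?case by (rule exI[of _ 0], rule exI[of _ 0]) (simp add: eval2_def val_def)
next
  case (pCons g G)
  then obtain p q where IH: "eval2 const_fn G \<xi> \<eta> = el p q"
    "\<And>x y. y^2 = poly f x \<Longrightarrow> eval2 id G x y = val x y p q" by blast
  have step: "eval2 \<phi> (pCons g G) u v = poly (map_poly \<phi> g) u + v * eval2 \<phi> G u v"
    for \<phi> :: "'a \<Rightarrow> 'b::comm_ring_1" and u v
    using pCons.hyps by (auto simp: eval2_def map_poly_pCons)
  have "eval2 const_fn (pCons g G) \<xi> \<eta> = ev \<xi> g + \<eta> * el p q"
    by (simp add: step IH ev_def)
  also have "\<dots> = el (g + f * q) p"
    using el_mult[of 0 1 p q] by (simp add: el_def)
  finally have "eval2 const_fn (pCons g G) \<xi> \<eta> = el (g + f * q) p" .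
  moreover have "eval2 id (pCons g G) x y = val x y (g + f * q) p" if "y^2 = poly f x" for x y
    using that by (simp add: step IH val_def algebra_simps power2_eq_square flip: that)
  ultimately show ?case by blast
qed

lemma eval2_pair:
  shows "eval2 const_fn [:p, q:] \<xi> \<eta> = el p q" "eval2 id [:p, q:] x y = val x y p q"
proof -
  have *: "eval2 \<phi> [:p, q:] u v = poly (map_poly \<phi> p) u + v * poly (map_poly \<phi> q) u"
    for \<phi> :: "'a \<Rightarrow> 'b::comm_ring_1" and u v
    by (cases "p = 0"; cases "q = 0") (simp_all add: eval2_def map_poly_pCons)
  show "eval2 const_fn [:p, q:] \<xi> \<eta> = el p q" "eval2 id [:p, q:] x y = val x y p q"
    by (simp_all add: * el_def val_def ev_def mult.commute)
qed

end

locale chart_point = chart +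
  fixes x0 y0 :: 'a
  assumes on_curve: "y0^2 = poly f x0"
begin

abbreviation "R \<equiv> lring x0 y0"
abbreviation "V \<equiv> val x0 y0"
abbreviation "w \<equiv> par x0 y0"

lemma lring_eval2:
  "R = {h. \<exists>G H. eval2 id H x0 y0 \<noteq> 0 \<and> h = eval2 const_fn G \<xi> \<eta> / eval2 const_fn H \<xi> \<eta>}"
proof (intro Set.set_eqI iffI)
  fix h assume "h \<in> R"
  then show "h \<in> {h. \<exists>G H. eval2 id H x0 y0 \<noteq> 0 \<and> h = eval2 const_fn G \<xi> \<eta> / eval2 const_fn H \<xi> \<eta>}"
    unfolding lring_def using eval2_pair by (smt (verit, best) mem_Collect_eq)
next
  fix h assume "h \<in> {h. \<exists>G H. eval2 id H x0 y0 \<noteq> 0 \<and> h = eval2 const_fn G \<xi> \<eta> / eval2 const_fn H \<xi> \<eta>}"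
  then obtain G H where *: "eval2 id H x0 y0 \<noteq> 0" "h = eval2 const_fn G \<xi> \<eta> / eval2 const_fn H \<xi> \<eta>"
    by blast
  obtain p q where "eval2 const_fn G \<xi> \<eta> = el p q" using eval2_reduce by blast
  moreover obtain r s where "eval2 const_fn H \<xi> \<eta> = el r s" "eval2 id H x0 y0 = V r s"
    using eval2_reduce on_curve by blast
  ultimately show "h \<in> R" unfolding lring_def using * by auto
qed

lemma val_mult: "V (p * r + f * (q * s)) (p * s + q * r) = V p q * V r s"
  by (simp add: val_def algebra_simps power2_eq_square flip: on_curve)

lemma val_nz: "V p q \<noteq> 0 \<Longrightarrow> el p q \<noteq> 0"
  by (auto simp: val_def)

text \<open>
  The value at a point is well defined on products of functions, because the representation
  \<open>p + q \<eta>\<close> is unique.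
\<close>

lemma val_cong: "el p q * el r s = el p' q' * el r' s' \<Longrightarrow> V p q * V r s = V p' q' * V r' s'"
  unfolding el_mult el_eq_iff by (simp only: flip: val_mult)

lemma lringI: "V r s \<noteq> 0 \<Longrightarrow> el p q / el r s \<in> R"
  unfolding lring_def by blast

lemma lringE:
  assumes "h \<in> R" obtains p q r s where "V r s \<noteq> 0" "h = el p q / el r s"
  using assms unfolding lring_def by blast

lemma el_R: "el p q \<in> R"
  using lringI[of 1 0 p q] by (simp add: val_def)

lemma R_mult: "g \<in> R \<Longrightarrow> h \<in> R \<Longrightarrow> g * h \<in> R"
proof (elim lringE)
  fix p q r s p' q' r' s'
  assume "V r s \<noteq> 0" "g = el p q / el r s" "V r' s' \<noteq> 0" "h = el p' q' / el r' s'"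
  then show "g * h \<in> R"
    using lringI[of "r * r' + f * (s * s')" "r * s' + s * r'"
        "p * p' + f * (q * q')" "p * q' + q * p'"]
    by (simp add: val_mult flip: el_mult)
qed

lemma R_add: "g \<in> R \<Longrightarrow> h \<in> R \<Longrightarrow> g + h \<in> R"
proof (elim lringE)
  fix p q r s p' q' r' s'
  assume *: "V r s \<noteq> 0" "g = el p q / el r s" "V r' s' \<noteq> 0" "h = el p' q' / el r' s'"
  have "el p q * el r' s' + el p' q' * el r s \<in> R" by (simp only: el_mult el_add el_R)
  moreover have "1 / (el r s * el r' s') \<in> R"
    using * lringI[of "r * r' + f * (s * s')" "r * s' + s * r'" 1 0]
    by (simp add: val_mult flip: el_mult)
  moreover have "g + h = (el p q * el r' s' + el p' q' * el r s) * (1 / (el r s * el r' s'))"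
    using * val_nz[of r s] val_nz[of r' s'] by (simp add: add_frac_eq)
  ultimately show "g + h \<in> R" using R_mult by metis
qed

lemma units_iff:
  "h \<in> ring_units R \<longleftrightarrow> (\<exists>p q r s. V p q \<noteq> 0 \<and> V r s \<noteq> 0 \<and> h = el p q / el r s)"
proof
  assume h: "h \<in> ring_units R"
  then have "h \<in> R" "inverse h \<in> R" by (simp_all add: ring_units_def)
  then obtain p q r s p' q' r' s' where 1: "V r s \<noteq> 0" "h = el p q / el r s"
    and 2: "V r' s' \<noteq> 0" "inverse h = el p' q' / el r' s'"
    by (elim lringE) blast
  have "h \<noteq> 0" using h by (simp add: ring_units_def)
  then have "el p q / el r s * (el p' q' / el r' s') = 1" using 1 2 by (metis right_inverse)
  then have "el p q * el p' q' = el r s * el r' s'"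
    using val_nz[OF 1(1)] val_nz[OF 2(1)] by (simp add: field_simps)
  then have "V p q * V p' q' = V r s * V r' s'" by (rule val_cong)
  then have "V p q \<noteq> 0" using 1 2 by auto
  then show "\<exists>p q r s. V p q \<noteq> 0 \<and> V r s \<noteq> 0 \<and> h = el p q / el r s" using 1 by blast
next
  assume "\<exists>p q r s. V p q \<noteq> 0 \<and> V r s \<noteq> 0 \<and> h = el p q / el r s"
  then obtain p q r s where *: "V p q \<noteq> 0" "V r s \<noteq> 0" "h = el p q / el r s" by blast
  then show "h \<in> ring_units R"
    using lringI[of r s p q] lringI[of p q r s] val_nz[of p q] val_nz[of r s]
    by (simp add: ring_units_def)
qed

lemma el_unit: "el p q \<in> ring_units R \<longleftrightarrow> V p q \<noteq> 0"
proof
  assume "el p q \<in> ring_units R"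
  then obtain p' q' r s where *: "V p' q' \<noteq> 0" "V r s \<noteq> 0" "el p q = el p' q' / el r s"
    unfolding units_iff by blast
  then have "el p q * el r s = el p' q' * el 1 0" using val_nz[of r s] by (simp add: field_simps)
  from val_cong[OF this] show "V p q \<noteq> 0" using * by (auto simp: val_def)
next
  assume "V p q \<noteq> 0"
  moreover have "V 1 0 \<noteq> 0" "el p q = el p q / el 1 0" by (simp_all add: val_def)
  ultimately show "el p q \<in> ring_units R" unfolding units_iff by blast
qed

lemma units_mult: "g \<in> ring_units R \<Longrightarrow> h \<in> ring_units R \<Longrightarrow> g * h \<in> ring_units R"
  by (auto simp: ring_units_def R_mult)

lemma units_power: "g \<in> ring_units R \<Longrightarrow> g ^ n \<in> ring_units R"
  using el_unit[of 1 0] by (induction n) (auto simp: units_mult val_def)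

lemma par_nz: "w \<noteq> 0"
  using eta_nz ev_eq_0[of "[:- x0, 1:]"] by (simp add: par_def xi_minus del: ev_eq_0)

text \<open>At a branch point, \<open>\<xi> - x0\<close> has a double zero because \<open>f\<close> has a simple one.\<close>

lemma xi_minus_factor:
  "\<exists>e \<in> ring_units R. \<xi> - const_fn x0 = w ^ (if y0 = 0 then 2 else 1) * e"
proof (cases "y0 = 0")
  case True
  then have "poly f x0 = 0" using on_curve by simp
  then obtain g where g: "f = [:- x0, 1:] * g" "poly g x0 \<noteq> 0"
    using separable_linear_factor separable by metis
  have "1 / ev \<xi> g \<in> ring_units R"
    unfolding units_iff using g
    by (intro exI[of _ 1] exI[of _ 0] exI[of _ g]) (simp add: val_def flip: ev_el)
  moreover have "\<xi> - const_fn x0 = \<eta>^2 * (1 / ev \<xi> g)"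
  proof -
    have "\<eta>^2 = (\<xi> - const_fn x0) * ev \<xi> g" unfolding eta_sq xi_minus g(1) ev_mult ..
    moreover have "g \<noteq> 0" using g(2) by auto
    ultimately show ?thesis by simp
  qed
  ultimately show ?thesis using True by (intro bexI[of _ "1 / ev \<xi> g"]) (simp_all add: par_def)
next
  case False
  then show ?thesis using el_unit[of 1 0] by (auto simp: par_def val_def intro: bexI[of _ 1])
qed

text \<open>
  At an unramified point that is not a common zero of \<open>p\<close> and \<open>q\<close>, only one of \<open>p + q \<eta>\<close> and its
  conjugate \<open>p - q \<eta>\<close> can vanish, so the order of \<open>p + q \<eta>\<close> is zero or that of the norm
  \<open>p^2 - f q^2\<close>. At a branch point, if \<open>p + q \<eta>\<close> vanishes then so does \<open>p\<close>, and \<open>\<eta>\<close> splits off once.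
\<close>

lemma el_factor_primitive:
  assumes prim: "poly p x0 \<noteq> 0 \<or> poly q x0 \<noteq> 0"
  shows "\<exists>n. \<exists>e \<in> ring_units R. el p q = w ^ n * e"
proof (cases "V p q = 0")
  case False
  then show ?thesis using el_unit[of p q] by (intro exI[of _ 0]) auto
next
  case True
  show ?thesis
  proof (cases "y0 = 0")
    case ramified: True
    then have "poly p x0 = 0" using True by (simp add: val_def)
    then obtain p' where p': "p = [:- x0, 1:] * p'" by (auto simp: poly_eq_0_iff_dvd)
    have "poly f x0 = 0" using on_curve ramified by simp
    then obtain g where g: "f = [:- x0, 1:] * g" "poly g x0 \<noteq> 0"
      using separable_linear_factor separable by metis
    have g0: "g \<noteq> 0" using g by auto
    have "ev \<xi> g * el p q = \<eta> * el (g * q) p'"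
    proof -
      have "\<eta> * el (g * q) p' = el (f * p') (g * q)"
        using el_mult[of 0 1 "g * q" p'] by simp
      also have "f * p' = g * p" by (simp add: g(1) p' algebra_simps)
      finally show ?thesis by (simp add: el_scale)
    qed
    then have "el p q = \<eta> * (el (g * q) p' / el g 0)"
      using g0 by (simp add: field_simps flip: ev_el)
    moreover have "el (g * q) p' / el g 0 \<in> ring_units R"
      unfolding units_iff using g prim \<open>poly p x0 = 0\<close> ramified
      by (intro exI[of _ "g * q"] exI[of _ p'] exI[of _ g] exI[of _ 0]) (simp add: val_def)
    ultimately show ?thesis using ramified
      by (intro exI[of _ 1] bexI[of _ "el (g * q) p' / el g 0"]) (simp_all add: par_def)
  next
    case unramified: False
    have conj: "V p (- q) \<noteq> 0"
    proof
      assume "V p (- q) = 0"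
      then have "2 * poly p x0 = 0" "2 * (poly q x0 * y0) = 0"
        using True by (simp_all add: val_def algebra_simps)
      then show False using prim unramified by simp
    qed
    define N where "N = p * p - f * (q * q)"
    have "N \<noteq> 0" unfolding N_def norm_eq_0 using prim by auto
    then obtain r where r: "N = [:- x0, 1:] ^ order x0 N * r" "\<not> [:- x0, 1:] dvd r"
      using order_decomp by blast
    have "el p q * el p (- q) = w ^ order x0 N * ev \<xi> r"
      using el_norm[of p q] unramified arg_cong[OF r(1), of "ev \<xi>"]
      by (simp add: N_def par_def xi_minus)
    then have "el p q = w ^ order x0 N * (el r 0 / el p (- q))"
      using val_nz[OF conj] by (simp add: field_simps flip: ev_el)
    moreover have "el r 0 / el p (- q) \<in> ring_units R"
      unfolding units_iff using conj r(2)
      by (intro exI[of _ r] exI[of _ 0] exI[of _ p] exI[of _ "- q"])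
        (auto simp: val_def poly_eq_0_iff_dvd)
    ultimately show ?thesis by blast
  qed
qed

text \<open>
  Common zeros of \<open>p\<close> and \<open>q\<close> are removed by dividing by \<open>\<xi> - x0\<close>.
\<close>

lemma el_factor:
  assumes "p \<noteq> 0 \<or> q \<noteq> 0"
  shows "\<exists>n. \<exists>e \<in> ring_units R. el p q = w ^ n * e"
  using assms
proof (induction "degree p + degree q" arbitrary: p q rule: less_induct)
  case less
  show ?case
  proof (cases "poly p x0 \<noteq> 0 \<or> poly q x0 \<noteq> 0")
    case True
    then show ?thesis by (rule el_factor_primitive)
  next
    case False
    then obtain p' q' where pq: "p = [:- x0, 1:] * p'" "q = [:- x0, 1:] * q'"
      by (auto simp: poly_eq_0_iff_dvd elim!: dvdE)
    with less.prems have nz: "p' \<noteq> 0 \<or> q' \<noteq> 0" by auto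
    have deg: "degree ([:- x0, 1:] * r) = (if r = 0 then 0 else Suc (degree r))" for r
      by (simp add: degree_mult_eq del: mult_pCons_left)
    have "degree p' + degree q' < degree p + degree q"
      unfolding pq deg using nz by auto
    from less.hyps[OF this nz] obtain n e where e: "e \<in> ring_units R" "el p' q' = w ^ n * e" by blast
    obtain m d where d: "d \<in> ring_units R" "\<xi> - const_fn x0 = w ^ m * d" using xi_minus_factor by blast
    have "el p q = (\<xi> - const_fn x0) * el p' q'"
      unfolding xi_minus el_scale pq ..
    also have "\<dots> = w ^ (m + n) * (d * e)" by (simp add: d e power_add mult_ac)
    finally show ?thesis using units_mult[OF d(1) e(1)] by blast
  qed
qed

lemma par_el: "\<exists>p q. w = el p q \<and> V p q = 0"
proof (cases "y0 = 0")
  case True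
  then show ?thesis by (intro exI[of _ 0] exI[of _ 1]) (simp add: par_def val_def)
next
  case False
  then show ?thesis
    by (intro exI[of _ "[:- x0, 1:]"] exI[of _ 0]) (simp add: par_def val_def xi_minus ev_el)
qed

sublocale dvr FF R w
proof
  show "0 \<in> R" "1 \<in> R" using el_R[of 0 0] el_R[of 1 0] by simp_all
  show "w \<in> R" using par_el el_R by metis
  show "inverse w \<notin> R"
  proof
    assume w: "inverse w \<in> R"
    obtain p q where "w = el p q" "V p q = 0" using par_el by blast
    moreover have "w \<in> ring_units R" using w par_nz \<open>w \<in> R\<close> by (simp add: ring_units_def)
    ultimately show False using el_unit by metis
  qed
  fix h assume h: "h \<in> FF" "h \<noteq> 0"
  then obtain p q r where *: "r \<noteq> 0" "h = el p q / ev \<xi> r" unfolding FF_def by blast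
  then obtain m d where d: "d \<in> ring_units R" "el p q = w ^ m * d" using h el_factor[of p q] by auto
  obtain n e where e: "e \<in> ring_units R" "ev \<xi> r = w ^ n * e" using * el_factor[of r 0] by (auto simp: ev_el)
  have "h = w powi (int m - int n) * (d * inverse e)"
    using * d e par_nz by (simp add: power_int_diff field_simps)
  moreover have "d * inverse e \<in> ring_units R"
    using d e by (intro units_mult) (auto simp: ring_units_def)
  ultimately show "\<exists>n. \<exists>e \<in> ring_units R. h = w powi n * e" by blast
qed (fact lring_FF R_add R_mult par_nz)+

lemma ord_el_nonneg: "el p q \<noteq> 0 \<Longrightarrow> ord_at R (el p q) \<ge> 0"
  using ord_in_R[of "el p q"] by (simp add: el_R el_FF)

lemma ord_el_zero: "el p q \<noteq> 0 \<Longrightarrow> ord_at R (el p q) = 0 \<longleftrightarrow> V p q \<noteq> 0"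
  using ord_in_U[of "el p q"] el_unit by (simp add: el_FF)

lemma ord_xi_minus: "ord_at R (\<xi> - const_fn x0) = (if y0 = 0 then 2 else 1)"
proof -
  obtain e where e: "e \<in> ring_units R" "\<xi> - const_fn x0 = w ^ (if y0 = 0 then 2 else 1) * e"
    using xi_minus_factor by blast
  show ?thesis
    using ord_at_powi[OF e(1), of "if y0 = 0 then 2 else 1"] e(2) by (auto simp: power_int_def)
qed

text \<open>
  The residue field is the field of constants: subtract the value at the point.
\<close>

lemma residue:
  assumes "h \<in> R"
  shows "\<exists>c. h - const_fn c \<in> R - ring_units R"
proof -
  obtain p q r s where *: "V r s \<noteq> 0" "h = el p q / el r s" using assms by (rule lringE)
  define c where "c = V p q / V r s"
  have eq: "h - const_fn c = el (p - smult c r) (q - smult c s) / el r s"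
    using * val_nz[OF *(1)] by (simp add: field_simps el_def)
  have V0: "V (p - smult c r) (q - smult c s) = 0"
    using * by (simp add: val_def c_def field_simps)
  have "h - const_fn c \<notin> ring_units R"
  proof
    assume "h - const_fn c \<in> ring_units R"
    then have "(h - const_fn c) * el r s \<in> ring_units R"
      using * el_unit by (intro units_mult) auto
    moreover have "(h - const_fn c) * el r s = el (p - smult c r) (q - smult c s)"
      unfolding eq using val_nz[OF *(1)] by (simp del: el_eq_0)
    ultimately have "el (p - smult c r) (q - smult c s) \<in> ring_units R" by simp
    then show False using V0 el_unit by metis
  qed
  moreover have "h - const_fn c \<in> R" unfolding eq by (rule lringI[OF *(1)])
  ultimately show ?thesis by blast
qed

text \<open>
  The involution sends the uniformizer to itself or, at a branch point, to its negative, which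
  accounts for the sign \<open>i\<close>.
\<close>

lemma conj_mult:
  assumes "el p q * el r s = w ^ n * el p' q'"
  shows "\<exists>i::int. i^2 = 1 \<and> el p (- q) * el r (- s) = of_int i ^ n * w ^ n * el p' (- q')"
proof -
  define conj where "conj g g' \<longleftrightarrow> (\<exists>p q. g = el p q \<and> g' = el p (- q))" for g g'
  have mult: "conj (g * h) (g' * h')" if "conj g g'" "conj h h'" for g g' h h'
    using that unfolding conj_def by (fastforce simp: el_mult)
  have fn: "g' = g''" if "conj g g'" "conj g g''" for g g' g''
    using that unfolding conj_def by auto
  have pow: "conj (g ^ k) (g' ^ k)" if "conj g g'" for g g' k
  proof (induction k)
    case 0
    have "1 = el 1 0" "1 = el 1 (- 0)" by simp_all
    then show ?case unfolding conj_def by (metis power_0)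
  qed (use mult[OF that] in simp)
  have el: "conj (el p q) (el p (- q))" for p q unfolding conj_def by blast
  define i :: int where "i = (if y0 = 0 then - 1 else 1)"
  have "conj w (of_int i * w)"
  proof (cases "y0 = 0")
    case True
    then show ?thesis using el[of 0 1] el_minus[of 0 1] by (simp add: par_def i_def)
  next
    case False
    then show ?thesis using el[of "[:- x0, 1:]" 0] by (simp add: par_def i_def xi_minus ev_el)
  qed
  then have "conj (w ^ n * el p' q') ((of_int i * w) ^ n * el p' (- q'))"
    using mult pow el by blast
  moreover have "conj (w ^ n * el p' q') (el p (- q) * el r (- s))"
    unfolding assms[symmetric] using mult el by blast
  ultimately have "el p (- q) * el r (- s) = (of_int i * w) ^ n * el p' (- q')" using fn by blast
  then show ?thesis by (intro exI[of _ i]) (simp add: i_def power_mult_distrib)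
qed

text \<open>
  The involution \<open>\<eta> \<mapsto> - \<eta>\<close> maps the local ring at \<open>(x0, y0)\<close> to the local ring at \<open>(x0, - y0)\<close>,
  so it carries a factorization at the first point to one at the second.
\<close>

lemma ord_conj:
  assumes "p \<noteq> 0 \<or> q \<noteq> 0"
  shows "ord_at (lring x0 (- y0)) (el p (- q)) = ord_at (lring x0 y0) (el p q)"
proof -
  interpret c: chart_point f \<xi> \<eta> x0 "- y0"
    by unfold_locales (simp add: on_curve)
  obtain n e where e: "e \<in> ring_units R" "el p q = w ^ n * e" using el_factor assms by blast
  then obtain p' q' r s where u: "V p' q' \<noteq> 0" "V r s \<noteq> 0" "e = el p' q' / el r s"
    unfolding units_iff by blast
  have "el p q * el r s = w ^ n * el p' q'" using e u val_nz[of r s] by simp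
  from conj_mult[OF this] obtain i :: int where
    i: "i^2 = 1" "el p (- q) * el r (- s) = of_int i ^ n * w ^ n * el p' (- q')" by blast
  have "el r (- s) \<noteq> 0" using val_nz[OF u(2)] by auto
  then have "el p (- q) = w powi int n * (of_int i ^ n * (el p' (- q') / el r (- s)))"
    using i by (simp add: field_simps)
  moreover have "par x0 (- y0) = w" by (simp add: par_def)
  moreover have "of_int i ^ n * (el p' (- q') / el r (- s)) \<in> ring_units (lring x0 (- y0))"
  proof (intro c.units_mult c.units_power)
    have "i = 1 \<or> i = - 1" using i(1) by (simp add: power2_eq_1_iff)
    then show "of_int i \<in> ring_units (lring x0 (- y0))" using c.el_unit[of 1 0] c.el_unit[of "- 1" 0] 
      by (auto simp: val_def simp flip: el_minus ev_el)
    show "el p' (- q') / el r (- s) \<in> ring_units (lring x0 (- y0))"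
      unfolding c.units_iff using u(1,2) val_minus by metis
  qed
  ultimately have "ord_at (lring x0 (- y0)) (el p (- q)) = int n"
    using c.ord_at_powi by metis
  moreover have "ord_at (lring x0 y0) (el p q) = int n"
    using ord_at_powi[OF e(1), of n] e(2) by simp
  ultimately show ?thesis by simp
qed

end

lemma (in chart_point) val_eq_0_if_par_multiple:
  assumes "el p q = w * g" "g \<in> R"
  shows "V p q = 0"
proof -
  have "w * g \<in> R - ring_units R" using assms(2) w_generates by blast
  then show ?thesis using assms(1) el_unit[of p q] by simp
qed

text \<open>
  The step that removes a denominator \<open>\<xi> - x0\<close>. At an unramified point, \<open>p + q \<eta>\<close> vanishes at both
  points of the fibre, which forces \<open>p\<close> and \<open>q\<close> to vanish. At a branch point it vanishes to order
  two, and \<open>p\<close> has even order while \<open>q \<eta>\<close> has odd order.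
\<close>

lemma (in chart_point) fibre_multiple:
  assumes eq: "h * ev \<xi> [:- x0, 1:] = el p q"
    and h: "h \<in> lring x0 y0" "h \<in> lring x0 (- y0)"
  shows "poly p x0 = 0 \<and> poly q x0 = 0"
proof (cases "y0 = 0")
  case False
  interpret c: chart_point f \<xi> \<eta> x0 "- y0"
    by unfold_locales (simp add: on_curve)
  have "el p q = w * h" "el p q = par x0 (- y0) * h"
    using False by (simp_all add: par_def xi_minus mult.commute flip: eq)
  then have "val x0 y0 p q = 0" "val x0 (- y0) p q = 0"
    using val_eq_0_if_par_multiple c.val_eq_0_if_par_multiple h by blast+
  then have "2 * poly p x0 = 0" "2 * (poly q x0 * y0) = 0"
    by (simp_all add: val_def algebra_simps)
  then show ?thesis using False by simp
next
  case True
  obtain u where u: "u \<in> ring_units R" "\<xi> - const_fn x0 = w^2 * u"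
    using xi_minus_factor True by auto
  have g: "h * u \<in> R" "u \<in> R" using u h R_mult by (auto simp: ring_units_def)
  have "el p q = w * (w * (h * u))"
    using u(2) by (simp add: xi_minus power2_eq_square flip: eq)
  then have "V p q = 0" using val_eq_0_if_par_multiple g w_R R_mult by blast
  then have p0: "poly p x0 = 0" using True by (simp add: val_def)
  then obtain p' where p': "p = [:- x0, 1:] * p'" by (auto simp: poly_eq_0_iff_dvd)
  have "ev \<xi> p = w^2 * (u * el p' 0)"
    unfolding p' ev_mult using u(2) by (simp only: xi_minus ev_el mult.assoc)
  moreover have "ev \<xi> p + ev \<xi> q * w = w^2 * (h * u)"
    using eq u(2) True by (simp add: xi_minus el_def par_def mult_ac)
  moreover have m1: "el (- 1) 0 = - 1" by (simp add: el_def)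
  ultimately have "w * ev \<xi> q = w * (w * (h * u + - 1 * (u * el p' 0)))"
    by (simp add: algebra_simps power2_eq_square)
  then have "el q 0 = w * (h * u + el (- 1) 0 * (u * el p' 0))"
    using par_nz by (simp add: m1 flip: ev_el)
  moreover have "h * u + el (- 1) 0 * (u * el p' 0) \<in> R"
    using R_add[OF g(1) R_mult[OF el_R R_mult[OF g(2) el_R]]] .
  ultimately have "V q 0 = 0" using val_eq_0_if_par_multiple by blast
  then show ?thesis using p0 by (simp add: val_def)
qed

text \<open>
  The denominator is removed one linear factor at a time: regularity at both points of the fibre
  above its root forces the numerator to be divisible by the same factor.
\<close>

lemma (in chart) regular_is_polynomial:
  assumes "h \<in> FF" and reg: "\<And>x y. y^2 = poly f x \<Longrightarrow> h \<in> lring x y"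
  shows "\<exists>p q. h = el p q"
proof -
  have "\<exists>p q. h = el p q" if "h * ev \<xi> r = el p q" "r \<noteq> 0" for p q r
    using that
  proof (induction "degree r" arbitrary: p q r rule: less_induct)
    case less
    show ?case
    proof (cases "degree r = 0")
      case True
      then obtain c where c: "r = [:c:]" by (meson degree_eq_zeroE)
      then have "c \<noteq> 0" using less.prems by auto
      have "h * const_fn c = el p q" using less.prems c by simp
      then have "h = const_fn (inverse c) * el p q"
        using \<open>c \<noteq> 0\<close> unfolding const_fn_inverse by (auto simp: field_simps)
      then have "h = el (smult (inverse c) p) (smult (inverse c) q)" by (simp add: el_def algebra_simps)
      then show ?thesis by blast
    next
      case False
      then obtain x0 where "poly r x0 = 0" using alg_closed_imp_poly_has_root by blast
      then obtain r' where r': "r = [:- x0, 1:] * r'" by (auto simp: poly_eq_0_iff_dvd)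
      obtain y0 where y0: "y0^2 = poly f x0" using nth_root_exists[of 2 "poly f x0"] by auto
      interpret chart_point f \<xi> \<eta> x0 y0 by unfold_locales (rule y0)
      interpret c: chart_point f \<xi> \<eta> x0 "- y0" by unfold_locales (simp add: y0)
      have "h * ev \<xi> r' \<in> lring x0 y0" "h * ev \<xi> r' \<in> lring x0 (- y0)"
        unfolding ev_el using reg y0 by (auto intro!: R_mult c.R_mult el_R c.el_R)
      moreover have "(h * ev \<xi> r') * ev \<xi> [:- x0, 1:] = el p q"
        using less.prems(1) unfolding r' ev_mult by (simp only: mult_ac)
      ultimately have "poly p x0 = 0" "poly q x0 = 0" using fibre_multiple by blast+
      then obtain p' q' where pq: "p = [:- x0, 1:] * p'" "q = [:- x0, 1:] * q'"
        by (auto simp: poly_eq_0_iff_dvd elim!: dvdE)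
      have nz: "ev \<xi> [:- x0, 1:] \<noteq> 0" by simp
      have "ev \<xi> [:- x0, 1:] * (h * ev \<xi> r') = ev \<xi> [:- x0, 1:] * el p' q'"
        using less.prems(1) unfolding r' ev_mult pq el_scale[symmetric] by (simp only: mult_ac)
      then have "h * ev \<xi> r' = el p' q'" using nz by (simp only: mult_cancel_left) simp
      moreover have "r' \<noteq> 0" using less.prems(2) r' by auto
      moreover have "degree r' < degree r"
        using \<open>r' \<noteq> 0\<close> by (simp add: r' degree_mult_eq del: mult_pCons_left)
      ultimately show ?thesis using less.hyps by blast
    qed
  qed
  moreover obtain p q r where "r \<noteq> 0" "h = el p q / ev \<xi> r" using assms unfolding FF_def by blast
  ultimately show ?thesis by (metis ev_eq_0 nonzero_divide_eq_eq)
qed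


section \<open>The two charts of a smooth quartic\<close>

lemma ev_sum: "ev \<xi> (\<Sum>i\<in>A. p i) = (\<Sum>i\<in>A. ev \<xi> (p i))"
  by (induction A rule: infinite_finite_induct) auto

lemma ev_monom: "ev \<xi> (monom c n) = const_fn c * \<xi> ^ n"
  by (induction n) (simp_all add: monom_Suc ev_pCons monom_0)

text \<open>
  Reversal of the coefficients with respect to a fixed degree \<open>n\<close>, so that it is additive and
  an involution on polynomials of degree at most \<open>n\<close>.
\<close>

definition rev_poly :: "nat \<Rightarrow> 'a::comm_monoid_add poly \<Rightarrow> 'a poly" where
  "rev_poly n p = (\<Sum>i\<le>n. monom (coeff p i) (n - i))"

lemma coeff_rev_poly: "coeff (rev_poly n p) j = (if j \<le> n then coeff p (n - j) else 0)"
proof -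
  have "coeff (rev_poly n p) j = (\<Sum>i\<le>n. if n - i = j then coeff p i else 0)"
    by (simp add: rev_poly_def coeff_sum)
  also have "\<dots> = (\<Sum>i\<le>n. if i = n - j then (if j \<le> n then coeff p i else 0) else 0)"
    by (intro sum.cong) auto
  finally show ?thesis by simp
qed

lemma degree_rev_poly: "degree (rev_poly n p) \<le> n"
  by (intro degree_le) (simp add: coeff_rev_poly)

lemma rev_poly_rev_poly: "degree p \<le> n \<Longrightarrow> rev_poly n (rev_poly n p) = p"
  by (intro poly_eqI) (auto simp: coeff_rev_poly coeff_eq_0)

lemma rev_poly_0 [simp]: "rev_poly n 0 = 0"
  by (intro poly_eqI) (simp add: coeff_rev_poly)

lemma rev_poly_minus: "rev_poly n (- p) = - rev_poly n (p :: 'a::ab_group_add poly)"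
  by (intro poly_eqI) (simp add: coeff_rev_poly)

lemma rev_poly_eq_0: "degree p \<le> n \<Longrightarrow> rev_poly n p = 0 \<longleftrightarrow> p = 0"
  using rev_poly_rev_poly rev_poly_0 by metis

lemma poly_rev_poly_0: "poly (rev_poly n p) 0 = coeff p n"
  by (simp add: poly_0_coeff_0 coeff_rev_poly)

lemma ev_rev_poly:
  assumes "\<xi> \<noteq> 0" "degree p \<le> n"
  shows "ev \<xi> p = \<xi> ^ n * ev (1 / \<xi>) (rev_poly n p)"
proof -
  have "ev \<xi> p = ev \<xi> (\<Sum>i\<le>n. monom (coeff p i) i)"
    using poly_as_sum_of_monoms'[OF assms(2)] by simp
  also have "\<dots> = (\<Sum>i\<le>n. const_fn (coeff p i) * \<xi> ^ i)" by (simp add: ev_sum ev_monom)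
  also have "\<dots> = \<xi> ^ n * (\<Sum>i\<le>n. const_fn (coeff p i) * (1 / \<xi>) ^ (n - i))"
    unfolding sum_distrib_left using assms(1)
    by (intro sum.cong) (auto simp: power_divide power_diff field_simps)
  finally show ?thesis by (simp add: rev_poly_def ev_sum ev_monom)
qed

text \<open>
  The change of charts is an involution, so one inclusion of function fields suffices.
\<close>

lemma FF_flip:
  assumes 1: "chart f \<xi> \<eta>" and 2: "chart f' (1 / \<xi>) (\<eta> / \<xi>^2)"
  shows "chart.FF \<xi> \<eta> \<subseteq> chart.FF (1 / \<xi>) (\<eta> / \<xi>^2)"
proof
  interpret c1: chart f \<xi> \<eta> by fact
  interpret c2: chart f' "1 / \<xi>" "\<eta> / \<xi>^2" by fact
  have nz: "\<xi> \<noteq> 0" using c1.ev_eq_0[of "[:0, 1:]"] by (simp add: ev_pCons del: c1.ev_eq_0)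
  fix h assume "h \<in> c1.FF"
  then obtain p q r where *: "r \<noteq> 0" "h = c1.el p q / ev \<xi> r" unfolding c1.FF_def by blast
  define n where "n = max (degree p) (max (degree q) (degree r))"
  define T :: "'a poly" where "T = [:0, 1:]"
  have evT: "ev (1 / \<xi>) T = 1 / \<xi>" by (simp add: T_def ev_pCons)
  have "h = c2.el (T^2 * rev_poly n p) (rev_poly n q) / ev (1 / \<xi>) (T^2 * rev_poly n r)"
  proof -
    define k t where "k = \<xi> ^ n" and "t = (1 / \<xi>)^2"
    have kt: "k \<noteq> 0" "t \<noteq> 0" using nz by (simp_all add: k_def t_def)
    have rev: "ev \<xi> u = k * ev (1 / \<xi>) (rev_poly n u)" if "degree u \<le> n" for u
      unfolding k_def using ev_rev_poly[OF nz that] .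
    have deg: "degree p \<le> n" "degree q \<le> n" "degree r \<le> n" by (simp_all add: n_def)
    define P Q R where "P = ev (1 / \<xi>) (rev_poly n p)" and "Q = ev (1 / \<xi>) (rev_poly n q)"
      and "R = ev (1 / \<xi>) (rev_poly n r)"
    have "h = (k * (P + Q * \<eta>)) / (k * R)"
      unfolding *(2) c1.el_def P_def Q_def R_def by (simp add: rev[OF deg(1)] rev[OF deg(2)] rev[OF deg(3)] algebra_simps)
    also have "\<dots> = (t * (P + Q * \<eta>)) / (t * R)" using kt by simp
    also have "\<dots> = c2.el (T^2 * rev_poly n p) (rev_poly n q) / ev (1 / \<xi>) (T^2 * rev_poly n r)"
      unfolding c2.el_def P_def Q_def R_def by (simp add: evT t_def algebra_simps power_divide)
    finally show ?thesis .
  qed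
  moreover have "T^2 * rev_poly n r \<noteq> 0"
    using *(1) rev_poly_eq_0[of r n] by (simp add: T_def n_def)
  ultimately show "h \<in> c2.FF" unfolding c2.FF_def by blast
qed

lemma ev_gen_x: "ev gen_x p = to_ac (Fract p 1)"
proof (induction p)
  case (pCons c p)
  have "Fract (pCons c p) 1 = Fract [:c:] 1 + Fract [:0, 1:] 1 * Fract p 1" by simp
  moreover have "ev gen_x (pCons c p) = const_fn c + gen_x * to_ac (Fract p 1)"
    by (simp only: ev_pCons pCons.IH)
  ultimately show ?case by (simp only: const_fn_def gen_x_def to_ac_add to_ac_mult)
qed (simp flip: Zero_fract_def)

text \<open>
  A nonzero leading coefficient means that the two points at infinity are distinct, so that the
  projection to the line is unramified there.
\<close>

locale smooth_quartic =
  fixes C :: "'a::{alg_closed_field,field_char_0} quartic"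
  assumes smooth: "smooth_curve C" and lead_nz: "coeff (dehom_q C) 4 \<noteq> 0"
begin

lemma dehom_p_rev: "dehom_p C = rev_poly 4 (dehom_q C)"
  by (cases C) (auto intro!: poly_eqI simp: coeff_rev_poly coeff_pCons numeral_eq_Suc split: nat.splits)

lemma deg_dehom_q: "degree (dehom_q C) = 4"
  using lead_nz by (cases C) (auto simp: numeral_eq_Suc coeff_pCons)

lemma quartic_form_dehom:
  "quartic_form C x 1 = poly (dehom_q C) x" "quartic_form C 1 u = poly (dehom_p C) u"
  by (cases C; simp add: algebra_simps power4_eq_xxxx power3_eq_cube power2_eq_square)+

lemma quartic_form_scale: "quartic_form C (l * p) (l * q) = l^4 * quartic_form C p q"
  by (cases C) (simp add: algebra_simps power4_eq_xxxx power3_eq_cube power2_eq_square)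

lemma separable_q: "poly (dehom_q C) x = 0 \<Longrightarrow> poly (pderiv (dehom_q C)) x \<noteq> 0"
  and separable_p: "poly (dehom_p C) x = 0 \<Longrightarrow> poly (pderiv (dehom_p C)) x \<noteq> 0"
  using smooth unfolding smooth_curve_def smooth_affine_def
  by (metis mult_zero_right power_zero_numeral)+

lemma deg_dehom_p: "degree (dehom_p C) > 0"
proof (rule ccontr)
  assume "\<not> degree (dehom_p C) > 0"
  then have "coeff (dehom_p C) i = 0" if "i > 0" for i using that by (simp add: coeff_eq_0)
  then have "coeff (dehom_q C) 0 = 0" "coeff (dehom_q C) (Suc 0) = 0"
    using coeff_rev_poly[of 4 "dehom_p C" 0] coeff_rev_poly[of 4 "dehom_p C" 1]
      rev_poly_rev_poly[of "dehom_q C" 4] deg_dehom_q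
    by (auto simp flip: dehom_p_rev)
  then show False using separable_q[of 0] by (simp add: poly_0_coeff_0 coeff_pderiv)
qed

sublocale c1: chart "dehom_q C" gen_x "gen_y C"
proof
  show "ev gen_x p = 0 \<Longrightarrow> p = 0" for p :: "'a poly"
    by (simp add: ev_gen_x Zero_fract_def eq_fract)
  have "\<exists>y. y^2 = to_ac (Fract (dehom_q C) 1)"
    using nth_root_exists[of 2] by simp
  then show "gen_y C ^ 2 = ev gen_x (dehom_q C)"
    unfolding gen_y_def ev_gen_x by (rule someI_ex)
qed (use deg_dehom_q separable_q in auto)

lemma gen_x_nz: "gen_x \<noteq> (0 :: 'a poly fract alg_closure)"
  using c1.ev_eq_0[of "[:0, 1:]"] by (simp add: ev_pCons del: c1.ev_eq_0)

sublocale c2: chart "dehom_p C" "1 / gen_x" "gen_y C / gen_x^2"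
proof
  show "p = 0" if "ev (1 / gen_x) p = 0" for p :: "'a poly"
  proof -
    have "ev gen_x (rev_poly (degree p) p) = 0"
      using ev_rev_poly[OF gen_x_nz degree_rev_poly, of "degree p" p] that
      by (simp add: rev_poly_rev_poly)
    then show "p = 0" by (simp add: rev_poly_eq_0)
  qed
  show "(gen_y C / gen_x^2)^2 = ev (1 / gen_x) (dehom_p C)"
    using ev_rev_poly[OF gen_x_nz, of "dehom_q C" 4] gen_x_nz deg_dehom_q c1.eta_sq
    by (simp add: dehom_p_rev power_divide)
qed (use deg_dehom_p separable_p in auto)

lemma FF_eq: "c1.FF = function_field C" "c2.FF = function_field C"
proof -
  show 1: "c1.FF = function_field C"
  proof (intro Set.set_eqI iffI)
    fix h assume "h \<in> c1.FF"
    then obtain p q r where *: "r \<noteq> 0" "h = c1.el p q / ev gen_x r" unfolding c1.FF_def by blast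
    have "h = to_ac (Fract p 1 / Fract r 1) + to_ac (Fract q 1 / Fract r 1) * gen_y C"
      unfolding * c1.el_def ev_gen_x by (simp add: add_divide_distrib del: divide_fract)
    then show "h \<in> function_field C" unfolding function_field_def by blast
  next
    fix h assume "h \<in> function_field C"
    then obtain \<alpha> \<beta> where h: "h = to_ac \<alpha> + to_ac \<beta> * gen_y C" unfolding function_field_def by blast
    obtain p r where 1: "\<alpha> = Fract p r" "r \<noteq> 0" by (cases \<alpha>)
    obtain q s where 2: "\<beta> = Fract q s" "s \<noteq> 0" by (cases \<beta>)
    have q: "to_ac (Fract p r) = ev gen_x p / ev gen_x r" if "r \<noteq> 0" for p r :: "'a poly"
      using that unfolding ev_gen_x by (simp flip: to_ac_divide)
    have "ev gen_x r \<noteq> 0" "ev gen_x s \<noteq> 0" using 1 2 by simp_all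
    then have "h = c1.el (p * s) (q * r) / ev gen_x (r * s)"
      unfolding h 1(1) 2(1) q[OF 1(2)] q[OF 2(2)] c1.el_def by (simp add: field_simps)
    moreover have "r * s \<noteq> 0" using 1 2 by simp
    ultimately show "h \<in> c1.FF" unfolding c1.FF_def by blast
  qed
  have "c1.FF \<subseteq> c2.FF" using FF_flip c1.chart_axioms c2.chart_axioms by blast
  moreover have "c2.FF \<subseteq> c1.FF"
    using FF_flip[of "dehom_p C" "1 / gen_x" "gen_y C / gen_x^2" "dehom_q C"] c1.chart_axioms c2.chart_axioms gen_x_nz
    by (simp add: power_divide)
  ultimately show "c2.FF = function_field C" using 1 by simp
qed

end

section \<open>Geometric points and their valuations\<close>

text \<open>The point with affine coordinates \<open>(x, y)\<close>, and the point at infinity with \<open>y/x^2 = s\<close>.\<close>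

definition aff :: "'a::field \<Rightarrow> 'a \<Rightarrow> 'a wpt" where "aff x y = wpoint (x, 1, y)"

definition inf :: "'a::field \<Rightarrow> 'a wpt" where "inf s = wpoint (1, 0, s)"

definition conj_pt :: "'a::field wpt \<Rightarrow> 'a wpt" where
  "conj_pt P = (\<lambda>(p, q, S). (p, q, - S)) ` P"

lemma in_wpoint: "(p, q, S) \<in> wpoint (p', q', S') \<longleftrightarrow>
    (\<exists>l. l \<noteq> 0 \<and> p = l * p' \<and> q = l * q' \<and> S = l^2 * S')"
  by (auto simp: wpoint_def)

lemma wpoint_self: "(p, q, S) \<in> wpoint (p, q, S)"
  unfolding in_wpoint by (rule exI[of _ 1]) simp

lemma wpoint_scale: "l \<noteq> 0 \<Longrightarrow> wpoint (l * p, l * q, l^2 * S) = wpoint (p, q, S)"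
proof -
  have sub: "wpoint (l * p, l * q, l^2 * S) \<subseteq> wpoint (p, q, S)" if "l \<noteq> 0" for l p q S :: 'a
  proof
    fix z assume "z \<in> wpoint (l * p, l * q, l^2 * S)"
    then obtain k where k: "k \<noteq> 0" "z = (k * (l * p), k * (l * q), k^2 * (l^2 * S))"
      by (auto simp: wpoint_def)
    then have "z = ((k * l) * p, (k * l) * q, (k * l)^2 * S)" "k * l \<noteq> 0"
      using that by (simp_all add: power_mult_distrib mult.assoc)
    then show "z \<in> wpoint (p, q, S)" unfolding wpoint_def by blast
  qed
  assume l: "l \<noteq> 0"
  show ?thesis
    using sub[OF l, of p q S] sub[of "inverse l" "l * p" "l * q" "l^2 * S"] l
    by (auto simp flip: mult.assoc power_mult_distrib)
qed

lemma wpoint_eqD: "wpoint (p, q, S) = W \<Longrightarrow> (p, q, S) \<in> W"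
  using wpoint_self by blast

lemma aff_eq_iff [simp]: "aff x y = aff x' y' \<longleftrightarrow> x = x' \<and> y = y'"
  by (auto simp: aff_def in_wpoint dest!: wpoint_eqD)

lemma inf_eq_iff [simp]: "inf s = inf s' \<longleftrightarrow> s = s'"
  by (auto simp: inf_def in_wpoint dest!: wpoint_eqD)

lemma aff_neq_inf [simp]: "aff x y \<noteq> inf s" "inf s \<noteq> aff x y"
  by (auto simp: aff_def inf_def in_wpoint dest!: wpoint_eqD)

lemma conj_wpoint: "conj_pt (wpoint (p, q, S)) = wpoint (p, q, - S)"
  by (force simp: conj_pt_def wpoint_def image_def)

lemma conj_aff [simp]: "conj_pt (aff x y) = aff x (- y)"
  and conj_inf [simp]: "conj_pt (inf s) = inf (- s)"
  by (simp_all add: aff_def inf_def conj_wpoint)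

lemma wpoint_cases:
  assumes "(p, q) \<noteq> (0, 0)"
  shows "wpoint (p, q, S) = (if q \<noteq> 0 then aff (p / q) (S / q^2) else inf (S / p^2))"
  using assms wpoint_scale[of q "p / q" 1 "S / q^2"] wpoint_scale[of p 1 0 "S / p^2"]
  by (auto simp: aff_def inf_def)

context smooth_quartic
begin

abbreviation "f \<equiv> dehom_q C"
abbreviation "K \<equiv> function_field C"
abbreviation "pts \<equiv> curve_points C"
abbreviation "vo \<equiv> vanishing_order C"

text \<open>The leading coefficient, whose square roots are the two points at infinity.\<close>
abbreviation "lc \<equiv> coeff (dehom_q C) 4"

lemma lc: "poly (dehom_p C) 0 = lc"
  by (simp add: dehom_p_rev poly_rev_poly_0)

lemma curve_points_eq: "pts = {aff x y | x y. y^2 = poly f x} \<union> {inf s | s. s^2 = lc}"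
proof (intro Set.set_eqI iffI)
  fix P assume "P \<in> pts"
  then obtain p q S where P: "P = wpoint (p, q, S)" "(p, q) \<noteq> (0, 0)" "S^2 = quartic_form C p q"
    unfolding curve_points_def by blast
  show "P \<in> {aff x y | x y. y^2 = poly f x} \<union> {inf s | s. s^2 = lc}"
  proof (cases "q = 0")
    case False
    have "(S / q^2)^2 = poly f (p / q)"
      using False P(3) quartic_form_scale[of q "p / q" 1]
      by (simp add: quartic_form_dehom power_divide flip: power_mult)
    then show ?thesis using P False by (auto simp: wpoint_cases)
  next
    case True
    then have "(S / p^2)^2 = lc"
      using P(2,3) quartic_form_scale[of p 1 0]
      by (simp add: quartic_form_dehom lc power_divide flip: power_mult)
    then show ?thesis using P True by (auto simp: wpoint_cases)
  qed
next
  fix P assume "P \<in> {aff x y | x y. y^2 = poly f x} \<union> {inf s | s. s^2 = lc}"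
  then show "P \<in> pts"
  proof (elim UnE CollectE exE conjE)
    fix x y assume *: "P = aff x y" "y^2 = poly f x"
    show ?thesis unfolding curve_points_def
      by (rule CollectI, rule exI[of _ x], rule exI[of _ 1], rule exI[of _ y])
        (simp add: * aff_def quartic_form_dehom)
  next
    fix s assume *: "P = inf s" "s^2 = lc"
    show ?thesis unfolding curve_points_def
      by (rule CollectI, rule exI[of _ 1], rule exI[of _ 0], rule exI[of _ s])
        (simp add: * inf_def quartic_form_dehom lc)
  qed
qed

lemma aff_pts [simp]: "aff x y \<in> pts \<longleftrightarrow> y^2 = poly f x"
  and inf_pts [simp]: "inf s \<in> pts \<longleftrightarrow> s^2 = lc"
  by (auto simp: curve_points_eq)

lemma ptsE:
  assumes "P \<in> pts"
  obtains (aff) x y where "P = aff x y" "y^2 = poly f x" | (inf) s where "P = inf s" "s^2 = lc"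
  using assms by (auto simp: curve_points_eq)

lemma chart_aff: "y^2 = poly f x \<Longrightarrow> chart_point f gen_x (gen_y C) x y"
  by unfold_locales

lemma chart_inf: "s^2 = lc \<Longrightarrow> chart_point (dehom_p C) (1 / gen_x) (gen_y C / gen_x^2) 0 s"
  by unfold_locales (simp add: lc)

lemma local_ring_aff:
  assumes "y^2 = poly f x"
  shows "local_ring C (aff x y) = c1.lring x y"
proof -
  interpret chart_point f gen_x "gen_y C" x y using assms by (rule chart_aff)
  let ?L = "\<lambda>G H. eval2 const_fn G gen_x (gen_y C) / eval2 const_fn H gen_x (gen_y C)"
  show ?thesis unfolding lring_eval2
  proof (intro Set.set_eqI iffI)
    fix h assume "h \<in> local_ring C (aff x y)"
    then obtain p q S G H l where *: "l \<noteq> 0" "p = l * x" "q = l * 1" "S = l^2 * y"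
      "if q \<noteq> 0 then eval2 id H (p / q) (S / q^2) \<noteq> 0 \<and> h = ?L G H else
         eval2 id H (q / p) (S / p^2) \<noteq> 0 \<and>
           h = eval2 const_fn G (1 / gen_x) (gen_y C / gen_x^2) /
               eval2 const_fn H (1 / gen_x) (gen_y C / gen_x^2)"
      unfolding local_ring_def aff_def in_wpoint by blast
    then have "eval2 id H x y \<noteq> 0" "h = ?L G H" by simp_all
    then show "h \<in> {h. \<exists>G H. eval2 id H x y \<noteq> 0 \<and> h = ?L G H}" by blast
  next
    fix h assume "h \<in> {h. \<exists>G H. eval2 id H x y \<noteq> 0 \<and> h = ?L G H}"
    then obtain G H where "eval2 id H x y \<noteq> 0" "h = ?L G H" by blast
    then show "h \<in> local_ring C (aff x y)"
      unfolding local_ring_def aff_def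
      by (intro CollectI exI[of _ x] exI[of _ 1] exI[of _ y] exI[of _ G] exI[of _ H])
        (simp add: wpoint_self)
  qed
qed

lemma local_ring_inf:
  assumes "s^2 = lc"
  shows "local_ring C (inf s) = c2.lring 0 s"
proof -
  interpret chart_point "dehom_p C" "1 / gen_x" "gen_y C / gen_x^2" 0 s using assms by (rule chart_inf)
  let ?L = "\<lambda>G H. eval2 const_fn G (1 / gen_x) (gen_y C / gen_x^2) /
    eval2 const_fn H (1 / gen_x) (gen_y C / gen_x^2)"
  show ?thesis unfolding lring_eval2
  proof (intro Set.set_eqI iffI)
    fix h assume "h \<in> local_ring C (inf s)"
    then obtain p q S G H l where *: "l \<noteq> 0" "p = l * 1" "q = l * 0" "S = l^2 * s"
      "if q \<noteq> 0 then eval2 id H (p / q) (S / q^2) \<noteq> 0 \<and>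
           h = eval2 const_fn G gen_x (gen_y C) / eval2 const_fn H gen_x (gen_y C)
       else eval2 id H (q / p) (S / p^2) \<noteq> 0 \<and> h = ?L G H"
      unfolding local_ring_def inf_def in_wpoint by blast
    then have "eval2 id H 0 s \<noteq> 0" "h = ?L G H" by simp_all
    then show "h \<in> {h. \<exists>G H. eval2 id H 0 s \<noteq> 0 \<and> h = ?L G H}" by blast
  next
    fix h assume "h \<in> {h. \<exists>G H. eval2 id H 0 s \<noteq> 0 \<and> h = ?L G H}"
    then obtain G H where "eval2 id H 0 s \<noteq> 0" "h = ?L G H" by blast
    then show "h \<in> local_ring C (inf s)"
      unfolding local_ring_def inf_def
      by (intro CollectI exI[of _ 1] exI[of _ 0] exI[of _ s] exI[of _ G] exI[of _ H])
        (simp add: wpoint_self)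
  qed
qed

lemma vanishing_order_ord_at: "vo P h = ord_at (local_ring C P) h"
  unfolding vanishing_order_def ord_at_def uniformizer_def local_units_def ring_units_def ..

text \<open>
  The general rules for orders of vanishing rest on these three facts alone, which makes them uniform
  in the affine points and the points at infinity.
\<close>

lemma point_dvr:
  assumes "P \<in> pts"
  shows "\<exists>w. dvr K (local_ring C P) w"
    and "h \<in> local_ring C P \<Longrightarrow> \<exists>c. h - const_fn c \<in> local_ring C P - ring_units (local_ring C P)"
    and "c \<noteq> 0 \<Longrightarrow> const_fn c \<in> ring_units (local_ring C P)"
proof -
  have "(\<exists>w. dvr K (local_ring C P) w) \<and>
    (h \<in> local_ring C P \<longrightarrow> (\<exists>c. h - const_fn c \<in> local_ring C P - ring_units (local_ring C P))) \<and>
    (c \<noteq> 0 \<longrightarrow> const_fn c \<in> ring_units (local_ring C P))"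
    using assms
  proof (cases rule: ptsE)
    case (aff x y)
    interpret chart_point f gen_x "gen_y C" x y using aff(2) by (rule chart_aff)
    show ?thesis
      using dvr_axioms residue el_unit[of "[:c:]" 0]
      unfolding aff(1) local_ring_aff[OF aff(2)] FF_eq by (auto simp: c1.val_def simp flip: c1.ev_el)
  next
    case (inf s)
    interpret chart_point "dehom_p C" "1 / gen_x" "gen_y C / gen_x^2" 0 s using inf(2) by (rule chart_inf)
    show ?thesis
      using dvr_axioms residue el_unit[of "[:c:]" 0]
      unfolding inf(1) local_ring_inf[OF inf(2)] FF_eq by (auto simp: c2.val_def simp flip: c2.ev_el)
  qed
  then show "\<exists>w. dvr K (local_ring C P) w"
    "h \<in> local_ring C P \<Longrightarrow> \<exists>c. h - const_fn c \<in> local_ring C P - ring_units (local_ring C P)"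
    "c \<noteq> 0 \<Longrightarrow> const_fn c \<in> ring_units (local_ring C P)" by blast+
qed

lemma K_add: "g \<in> K \<Longrightarrow> h \<in> K \<Longrightarrow> g + h \<in> K"
  and K_mult: "g \<in> K \<Longrightarrow> h \<in> K \<Longrightarrow> g * h \<in> K"
  and K_el: "c1.el p q \<in> K" and K_el2: "c2.el p q \<in> K"
  using c1.FF_add c1.FF_mult c1.el_FF c2.el_FF by (simp_all add: FF_eq)

lemma K_ev: "ev gen_x p \<in> K" using K_el[of p 0] by (simp add: c1.el_def)

lemma K_const: "const_fn c \<in> K" using K_ev[of "[:c:]"] by simp

lemma K_1: "1 \<in> K" using K_const[of 1] by simp

lemma K_inverse: "h \<in> K \<Longrightarrow> inverse h \<in> K"
proof -
  assume "h \<in> K"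
  then obtain p q r where *: "r \<noteq> 0" "h = c1.el p q / ev gen_x r"
    unfolding FF_eq(1)[symmetric] c1.FF_def by blast
  then have "inverse h = ev gen_x r * inverse (c1.el p q)" by (simp add: divide_inverse mult.commute)
  then show ?thesis using K_mult K_ev c1.inverse_el_FF by (simp add: FF_eq)
qed

lemma K_divide: "g \<in> K \<Longrightarrow> h \<in> K \<Longrightarrow> g / h \<in> K"
  by (simp add: divide_inverse K_mult K_inverse)

lemma K_power: "h \<in> K \<Longrightarrow> h ^ n \<in> K"
  by (induction n) (simp_all add: K_1 K_mult)

lemma K_uminus: "h \<in> K \<Longrightarrow> - h \<in> K"
  using K_mult[OF K_const[of "- 1"]] by simp

lemma K_diff: "g \<in> K \<Longrightarrow> h \<in> K \<Longrightarrow> g - h \<in> K"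
  using K_add[OF _ K_uminus] by fastforce

lemma K_gen_x: "gen_x \<in> K" using K_ev[of "[:0, 1:]"] by (simp add: ev_pCons)

lemma vo_mult:
  assumes "P \<in> pts" "g \<in> K" "g \<noteq> 0" "h \<in> K" "h \<noteq> 0"
  shows "vo P (g * h) = vo P g + vo P h"
  using point_dvr(1)[OF assms(1)] dvr.ord_mult assms unfolding vanishing_order_ord_at by blast

lemma vo_const: "P \<in> pts \<Longrightarrow> c \<noteq> 0 \<Longrightarrow> vo P (const_fn c) = 0"
  using point_dvr(1)[of P] point_dvr(3)[of P c] dvr.ord_unit unfolding vanishing_order_ord_at by blast

lemma vo_1: "P \<in> pts \<Longrightarrow> vo P 1 = 0"
  using vo_const[of P 1] by simp

lemma vo_inverse:
  assumes "P \<in> pts" "h \<in> K" "h \<noteq> 0"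
  shows "vo P (inverse h) = - vo P h"
  using vo_mult[OF assms(1,2,3), of "inverse h"] assms vo_1 by (simp add: K_inverse)

lemma vo_divide:
  assumes "P \<in> pts" "g \<in> K" "g \<noteq> 0" "h \<in> K" "h \<noteq> 0"
  shows "vo P (g / h) = vo P g - vo P h"
  using vo_mult[OF assms(1,2,3), of "inverse h"] vo_inverse assms by (simp add: K_inverse divide_inverse)

lemma vo_power:
  assumes "P \<in> pts" "h \<in> K" "h \<noteq> 0"
  shows "vo P (h ^ n) = int n * vo P h"
  using assms by (induction n) (simp_all add: vo_1 vo_mult K_power algebra_simps)

lemma vo_uminus: 
  assumes "P \<in> pts" "h \<in> K" "h \<noteq> 0"
  shows "vo P (- h) = vo P h"
  using vo_mult[OF assms(1) K_const, of "- 1" h] assms vo_const[of P "- 1"] by simp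

text \<open>
  The zero function vanishes to every order. With this convention the condition is additive.
\<close>

definition vge :: "'a wpt \<Rightarrow> int \<Rightarrow> 'a poly fract alg_closure \<Rightarrow> bool" where
  "vge P m h \<longleftrightarrow> h = 0 \<or> m \<le> vo P h"

lemma vge_add:
  assumes "P \<in> pts" "g \<in> K" "h \<in> K" "vge P m g" "vge P m h"
  shows "vge P m (g + h)"
proof -
  obtain w where w: "dvr K (local_ring C P) w" using point_dvr(1) assms by blast
  show ?thesis
    using dvr.ord_add[OF w assms(2) _ assms(3), of m] assms(4,5)
    unfolding vge_def vanishing_order_ord_at
    by (cases "g = 0"; cases "h = 0"; cases "g + h = 0") simp_all
qed

lemma vge_mult:
  assumes "P \<in> pts" "g \<in> K" "h \<in> K" "vge P m g" "vge P n h"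
  shows "vge P (m + n) (g * h)"
  using assms vo_mult[OF assms(1)] unfolding vge_def by (cases "g = 0"; cases "h = 0") auto

lemma vge_uminus: "P \<in> pts \<Longrightarrow> h \<in> K \<Longrightarrow> vge P m h \<Longrightarrow> vge P m (- h)"
  using vo_uminus unfolding vge_def by fastforce

lemma vge_diff:
  assumes "P \<in> pts" "g \<in> K" "h \<in> K" "vge P m g" "vge P m h"
  shows "vge P m (g - h)"
  using vge_add[OF assms(1,2) K_uminus[OF assms(3)] assms(4) vge_uminus] assms by simp

lemma vge_mono: "vge P m h \<Longrightarrow> n \<le> m \<Longrightarrow> vge P n h"
  by (auto simp: vge_def)

lemma vge_const: "P \<in> pts \<Longrightarrow> vge P 0 (const_fn c)"
  by (cases "c = 0") (auto simp: vge_def vo_const)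

lemma vge_0_iff:
  assumes "P \<in> pts" "h \<in> K"
  shows "vge P 0 h \<longleftrightarrow> h \<in> local_ring C P"
proof -
  obtain w where w: "dvr K (local_ring C P) w" using point_dvr(1) assms by blast
  then have "0 \<in> local_ring C P" by (rule dvr.R_0)
  then show ?thesis using dvr.ord_in_R[OF w] assms unfolding vge_def vanishing_order_ord_at by auto
qed

lemma residue:
  assumes "P \<in> pts" "h \<in> K" "vge P 0 h"
  shows "\<exists>c. vge P 1 (h - const_fn c)"
proof -
  obtain w where w: "dvr K (local_ring C P) w" using point_dvr(1) assms by blast
  obtain c where c: "h - const_fn c \<in> local_ring C P" "h - const_fn c \<notin> ring_units (local_ring C P)"
    using point_dvr(2)[OF assms(1)] vge_0_iff[OF assms(1,2)] assms(3) by blast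
  have K: "h - const_fn c \<in> K" using K_diff K_const assms by blast
  have "vge P 1 (h - const_fn c)"
    using dvr.ord_in_R[OF w K] dvr.ord_in_U[OF w K] c unfolding vge_def vanishing_order_ord_at by force
  then show ?thesis by blast
qed

lemma riemann_roch_space_eq:
  "riemann_roch_space C D = {h \<in> K. \<forall>P \<in> pts. vge P (- D P) h}"
proof -
  have "(0 \<le> i + j) = (- j \<le> i)" for i j :: int by auto
  then show ?thesis unfolding riemann_roch_space_def vge_def by auto
qed

section \<open>Orders of vanishing of explicit functions\<close>

lemma vge_el: "y^2 = poly f x \<Longrightarrow> vge (aff x y) 0 (c1.el p q)"
proof -
  assume "y^2 = poly f x"
  then interpret chart_point f gen_x "gen_y C" x y by (rule chart_aff)
  show ?thesis using ord_el_nonneg[of p q] unfolding vge_def vanishing_order_ord_at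
    by (auto simp: local_ring_aff[OF on_curve])
qed

lemma vo_el_zero:
  assumes "y^2 = poly f x" "c1.el p q \<noteq> 0"
  shows "vo (aff x y) (c1.el p q) = 0 \<longleftrightarrow> poly p x + poly q x * y \<noteq> 0"
proof -
  interpret chart_point f gen_x "gen_y C" x y using assms(1) by (rule chart_aff)
  show ?thesis using ord_el_zero[OF assms(2)]
    unfolding vanishing_order_ord_at by (simp add: local_ring_aff[OF on_curve] c1.val_def)
qed

lemma vo_x_minus:
  assumes "y^2 = poly f x"
  shows "vo (aff x y) (gen_x - const_fn x') = (if x' = x then if y = 0 then 2 else 1 else 0)"
proof (cases "x' = x")
  case True
  interpret chart_point f gen_x "gen_y C" x y using assms by (rule chart_aff)
  show ?thesis using ord_xi_minus True
    unfolding vanishing_order_ord_at by (simp add: local_ring_aff[OF on_curve])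
next
  case False
  then show ?thesis using vo_el_zero[OF assms, of "[:- x', 1:]" 0]
    by (simp add: c1.xi_minus flip: c1.ev_el)
qed

lemma vo_el2_zero:
  assumes "s^2 = lc" "c2.el p q \<noteq> 0"
  shows "vo (inf s) (c2.el p q) \<ge> 0"
    and "vo (inf s) (c2.el p q) = 0 \<longleftrightarrow> poly p 0 + poly q 0 * s \<noteq> 0"
proof -
  interpret chart_point "dehom_p C" "1 / gen_x" "gen_y C / gen_x^2" 0 s using assms(1) by (rule chart_inf)
  show "vo (inf s) (c2.el p q) \<ge> 0"
    and "vo (inf s) (c2.el p q) = 0 \<longleftrightarrow> poly p 0 + poly q 0 * s \<noteq> 0"
    using ord_el_zero[OF assms(2)] ord_el_nonneg[OF assms(2)]
    unfolding vanishing_order_ord_at by (simp_all add: local_ring_inf[OF assms(1)] c2.val_def)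
qed

lemma vo_inf_gen_x:
  assumes "s^2 = lc"
  shows "vo (inf s) gen_x = - 1"
proof -
  interpret chart_point "dehom_p C" "1 / gen_x" "gen_y C / gen_x^2" 0 s using assms by (rule chart_inf)
  have s: "s \<noteq> 0" using assms lead_nz by auto
  have "vo (inf s) (inverse gen_x) = 1" using ord_xi_minus s
    unfolding vanishing_order_ord_at by (simp add: local_ring_inf[OF assms] inverse_eq_divide)
  then show ?thesis using vo_inverse[of "inf s" gen_x] assms gen_x_nz K_gen_x by simp
qed

text \<open>
  Passage to the chart at infinity, where \<open>y = x^2 v\<close>. The weight of \<open>y\<close> explains the bound
  \<open>n - 2\<close> on the degree of \<open>q\<close>.
\<close>

lemma el_flip:
  assumes "degree p \<le> n" "q = 0 \<or> degree q + 2 \<le> n"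
  shows "c1.el p q = gen_x ^ n * c2.el (rev_poly n p) (rev_poly (n - 2) q)"
proof -
  have "ev gen_x q * gen_y C = gen_x ^ n * (ev (1 / gen_x) (rev_poly (n - 2) q) * (gen_y C / gen_x^2))"
  proof (cases "q = 0")
    case False
    then have "degree q \<le> n - 2" "n = (n - 2) + 2" using assms(2) by auto
    then have "gen_x ^ n = gen_x ^ (n - 2) * (gen_x :: 'a poly fract alg_closure) ^ 2"
      by (metis power_add)
    then show ?thesis
      using ev_rev_poly[OF gen_x_nz \<open>degree q \<le> n - 2\<close>] gen_x_nz by simp
  qed simp
  then show ?thesis
    unfolding c1.el_def c2.el_def using ev_rev_poly[OF gen_x_nz assms(1)] by (simp add: distrib_left)
qed

lemma vo_inf_el:
  assumes "s^2 = lc" "degree p \<le> n" "q = 0 \<or> degree q + 2 \<le> n" "c1.el p q \<noteq> 0"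
  shows "vo (inf s) (c1.el p q) = vo (inf s) (c2.el (rev_poly n p) (rev_poly (n - 2) q)) - int n"
    and "c2.el (rev_poly n p) (rev_poly (n - 2) q) \<noteq> 0"
proof -
  note flip = el_flip[OF assms(2,3)]
  show nz: "c2.el (rev_poly n p) (rev_poly (n - 2) q) \<noteq> 0" using assms(4) unfolding flip by auto
  show "vo (inf s) (c1.el p q) = vo (inf s) (c2.el (rev_poly n p) (rev_poly (n - 2) q)) - int n"
    unfolding flip using assms(1) nz gen_x_nz
    by (subst vo_mult) (simp_all add: K_el2 K_power K_gen_x vo_power vo_inf_gen_x del: c2.el_eq_0)
qed

lemma vge_inf_el:
  assumes "s^2 = lc" "degree p \<le> n" "q = 0 \<or> degree q + 2 \<le> n"
  shows "vge (inf s) (- int n) (c1.el p q)"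
proof (cases "c1.el p q = 0")
  case False
  show ?thesis
    unfolding vge_def using vo_inf_el[OF assms False] vo_el2_zero(1)[OF assms(1)] by fastforce
qed (simp add: vge_def)

lemma vo_inf_ev:
  assumes "s^2 = lc" "p \<noteq> 0"
  shows "vo (inf s) (ev gen_x p) = - int (degree p)"
proof -
  have nz: "c1.el p 0 \<noteq> 0" using assms by simp
  note v = vo_inf_el[OF assms(1) order.refl _ nz]
  have "vo (inf s) (c2.el (rev_poly (degree p) p) (rev_poly (degree p - 2) 0)) = 0"
    using v assms by (subst vo_el2_zero(2)) (simp_all add: poly_rev_poly_0)
  then show ?thesis using v by (simp add: c1.ev_el)
qed

lemma vo_conj:
  assumes "P \<in> pts" "p \<noteq> 0 \<or> q \<noteq> 0"
  shows "vo (conj_pt P) (c1.el p (- q)) = vo P (c1.el p q)"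
  using assms(1)
proof (cases rule: ptsE)
  case (aff x y)
  interpret chart_point f gen_x "gen_y C" x y using aff(2) by (rule chart_aff)
  have "(- y)^2 = poly f x" using aff by simp
  from local_ring_aff[OF this] local_ring_aff[OF aff(2)] show ?thesis
    unfolding vanishing_order_ord_at using ord_conj[OF assms(2)] aff by simp
next
  case (inf s)
  interpret chart_point "dehom_p C" "1 / gen_x" "gen_y C / gen_x^2" 0 s using inf(2) by (rule chart_inf)
  have s: "(- s)^2 = lc" using inf by simp
  define n where "n = max (degree p) (degree q + 2)"
  have n: "degree p \<le> n" "q = 0 \<or> degree q + 2 \<le> n" "- q = 0 \<or> degree (- q) + 2 \<le> n"
    by (auto simp: n_def)
  have "rev_poly n p \<noteq> 0 \<or> rev_poly (n - 2) q \<noteq> 0"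
    using assms(2) n rev_poly_eq_0[of p n] rev_poly_eq_0[of q "n - 2"] by fastforce
  from ord_conj[OF this] have "vo (inf (- s)) (c2.el (rev_poly n p) (- rev_poly (n - 2) q)) =
     vo (inf s) (c2.el (rev_poly n p) (rev_poly (n - 2) q))"
    unfolding vanishing_order_ord_at using local_ring_inf[OF s] local_ring_inf[OF inf(2)] by simp
  then show ?thesis
    using vo_inf_el(1)[OF s n(1,3)] vo_inf_el(1)[OF inf(2) n(1,2)] assms(2) inf(1)
    by (simp add: rev_poly_minus)
qed

lemma conj_pts: "P \<in> pts \<Longrightarrow> conj_pt P \<in> pts"
  by (elim ptsE) auto

lemma conj_conj: "P \<in> pts \<Longrightarrow> conj_pt (conj_pt P) = P"
  by (elim ptsE) auto

lemma vo_conj_ev: "P \<in> pts \<Longrightarrow> p \<noteq> 0 \<Longrightarrow> vo (conj_pt P) (ev gen_x p) = vo P (ev gen_x p)"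
  using vo_conj[of P p 0] by (simp add: c1.ev_el)

text \<open>
  The functions whose only poles are at infinity, of order at most \<open>n\<close>: a pole order at both
  points above \<open>u = 0\<close> that is smaller than expected forces the leading coefficients of both
  polynomials to vanish, as \<open>s\<close> and \<open>- s\<close> are distinct.
\<close>

lemma poles_at_infinity:
  assumes h: "h \<in> K" and reg: "\<And>x y. y^2 = poly f x \<Longrightarrow> vge (aff x y) 0 h"
    and inf: "\<And>s. s^2 = lc \<Longrightarrow> vge (inf s) (- int n) h"
  shows "\<exists>p q. h = c1.el p q \<and> degree p \<le> n \<and> (q = 0 \<or> degree q + 2 \<le> n)"
proof -
  have "h \<in> c1.lring x y" if "y^2 = poly f x" for x y
    using reg[OF that] vge_0_iff[of "aff x y" h] h that by (simp add: local_ring_aff)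
  moreover have "h \<in> c1.FF" using h by (simp add: FF_eq)
  ultimately obtain p q where pq: "h = c1.el p q" using c1.regular_is_polynomial[of h] by blast
  define m where "m = (if q = 0 then degree p else max (degree p) (degree q + 2))"
  have m: "degree p \<le> m" "q = 0 \<or> degree q + 2 \<le> m" by (auto simp: m_def)
  have "m \<le> n"
  proof (rule ccontr)
    assume "\<not> m \<le> n"
    then have "h \<noteq> 0" by (auto simp: pq m_def)
    obtain s where s: "s^2 = lc" using nth_root_exists[of 2 lc] by auto
    let ?P = "rev_poly m p" and ?Q = "rev_poly (m - 2) q"
    have "poly ?P 0 + poly ?Q 0 * s' = 0" if "s'^2 = lc" for s'
    proof -
      have "c2.el ?P ?Q \<noteq> 0" "vo (inf s') h = vo (inf s') (c2.el ?P ?Q) - int m"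
        using vo_inf_el[OF that m] \<open>h \<noteq> 0\<close> pq by simp_all
      moreover have "vo (inf s') h \<ge> - int n" using inf[OF that] \<open>h \<noteq> 0\<close> by (simp add: vge_def)
      ultimately show ?thesis using vo_el2_zero(2)[OF that, of ?P ?Q] \<open>\<not> m \<le> n\<close> by fastforce
    qed
    from this[of s] this[of "- s"] have "2 * poly ?P 0 = 0" "2 * (poly ?Q 0 * s) = 0"
      using s by (simp_all add: algebra_simps)
    moreover have "s \<noteq> 0" using s lead_nz by auto
    ultimately have 0: "coeff p m = 0" "coeff q (m - 2) = 0" by (simp_all add: poly_rev_poly_0)
    have "m = degree p \<or> q \<noteq> 0 \<and> m = degree q + 2" by (auto simp: m_def max_def)
    then consider "m = degree p" | "q \<noteq> 0" "m = degree q + 2" by blast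
    then show False
    proof cases
      case 1
      then have "p = 0" using 0(1) by simp
      then show False using 1 \<open>\<not> m \<le> n\<close> by simp
    qed (use 0 in simp)
  qed
  then show ?thesis using pq m by (intro exI[of _ p] exI[of _ q]) auto
qed

end

section \<open>The Riemann inequality and the genus\<close>

lemma divisor_degree_eq:
  assumes "finite A" "{P. D P \<noteq> 0} \<subseteq> A"
  shows "divisor_degree D = sum D A"
  unfolding divisor_degree_def using assms by (intro sum.mono_neutral_left) auto

lemma divisor_degree_add:
  assumes "finite {P. D P \<noteq> 0}" "finite {P. E P \<noteq> 0}"
  shows "divisor_degree (\<lambda>P. D P + E P) = divisor_degree D + divisor_degree E"
proof -
  let ?A = "{P. D P \<noteq> 0} \<union> {P. E P \<noteq> 0}"
  have "divisor_degree (\<lambda>P. D P + E P) = sum (\<lambda>P. D P + E P) ?A"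
    "divisor_degree D = sum D ?A" "divisor_degree E = sum E ?A"
    using assms by (intro divisor_degree_eq; auto)+
  then show ?thesis by (simp add: sum.distrib)
qed

lemma divisor_degree_point: "divisor_degree (\<lambda>P. of_bool (P = Q)) = 1"
  using divisor_degree_eq[of "{Q}" "\<lambda>P. of_bool (P = Q)"] by auto

context smooth_quartic
begin

abbreviation "smul \<equiv> \<lambda>c h. const_fn c * (h :: 'a poly fract alg_closure)"

sublocale VS: vector_space smul
  by unfold_locales (simp_all add: algebra_simps)

sublocale VP: vector_space_pair smul smul ..

abbreviation "RR \<equiv> riemann_roch_space C"

lemma RR_iff: "h \<in> RR D \<longleftrightarrow> h \<in> K \<and> (\<forall>P \<in> pts. vge P (- D P) h)"
  by (simp add: riemann_roch_space_eq)

lemma RR_mono: "(\<And>P. P \<in> pts \<Longrightarrow> D P \<le> D' P) \<Longrightarrow> RR D \<subseteq> RR D'"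
  unfolding RR_iff subset_iff by (meson neg_le_iff_le vge_mono)

text \<open>
  The Riemann inequality \<open>l(D) \<ge> deg D\<close>, together with finite-dimensionality, in a form in which
  it can be passed on from one divisor to another.
\<close>

definition riemann :: "('a wpt \<Rightarrow> int) \<Rightarrow> bool" where
  "riemann D \<longleftrightarrow> (\<exists>W. finite W \<and> RR D \<subseteq> VS.span W) \<and> divisor_degree D \<le> int (VS.dim (RR D))"

text \<open>
  Allowing one more pole enlarges the space by at most one dimension: the quotient of two functions
  attaining the new pole order has a residue in \<open>k\<close>, so a linear combination of them does not
  attain it.
\<close>

lemma RR_step:
  assumes P: "P \<in> pts" and W: "finite W" "RR (\<lambda>Q. D Q + of_bool (Q = P)) \<subseteq> VS.span W"
  shows "VS.dim (RR (\<lambda>Q. D Q + of_bool (Q = P))) \<le> VS.dim (RR D) + 1"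
proof -
  let ?D' = "\<lambda>Q. D Q + of_bool (Q = P)"
  have sub: "RR D \<subseteq> RR ?D'" by (rule RR_mono) simp
  obtain B where B: "B \<subseteq> RR D" "VS.independent B" "RR D \<subseteq> VS.span B" "card B = VS.dim (RR D)"
    by (rule VS.basis_exists)
  have finB: "finite B" using VS.independent_span_bound[OF W(1) B(2)] B(1) sub W(2) by blast
  show ?thesis
  proof (cases "RR ?D' \<subseteq> RR D")
    case True
    then have "RR ?D' = RR D" using sub by blast
    then show ?thesis by simp
  next
    case False
    then obtain h where h: "h \<in> RR ?D'" "h \<notin> RR D" by blast
    have hK: "h \<in> K" using h(1) by (simp add: RR_iff)
    have other: "vge Q (- D Q) g" if "g \<in> RR ?D'" "Q \<in> pts" "Q \<noteq> P" for g Q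
    proof -
      have "vge Q (- ?D' Q) g" using that(1,2) by (simp add: RR_iff)
      then show ?thesis using that(3) by simp
    qed
    have "\<not> vge P (- D P) h" using h hK other[OF h(1)] by (auto simp: RR_iff)
    moreover have "vge P (- D P - 1) h" using h(1) P by (force simp: RR_iff)
    ultimately have h0: "h \<noteq> 0" "vo P h = - D P - 1" by (auto simp: vge_def)
    have "g \<in> VS.span (insert h B)" if g: "g \<in> RR ?D'" for g
    proof -
      have gK: "g \<in> K" "vge P (- D P - 1) g" using g P by (force simp: RR_iff)+
      have "vge P 0 (g / h)"
        using gK h0 hK P vo_divide[OF P gK(1) _ hK] by (cases "g = 0") (auto simp: vge_def)
      then obtain c where c: "vge P 1 (g / h - const_fn c)"
        using residue[OF P K_divide[OF gK(1) hK]] by blast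
      have d: "g - const_fn c * h = h * (g / h - const_fn c)" using h0 by (simp add: algebra_simps)
      have "vge P (- D P - 1 + 1) (h * (g / h - const_fn c))"
        using P hK gK c h0 by (intro vge_mult K_diff K_divide K_const) (auto simp: vge_def)
      moreover have "vge Q (- D Q) (g - const_fn c * h)" if Q: "Q \<in> pts" "Q \<noteq> P" for Q
      proof -
        have "vge Q (0 + - D Q) (const_fn c * h)"
          using Q other[OF h(1)] by (intro vge_mult vge_const K_const hK) auto
        then show ?thesis using other[OF g] Q by (intro vge_diff gK K_mult K_const hK) auto
      qed
      moreover have "g - const_fn c * h \<in> K" by (intro K_diff K_mult K_const gK hK)
      ultimately have "g - const_fn c * h \<in> RR D"
        unfolding RR_iff using d by (metis add.commute diff_add_cancel uminus_add_conv_diff)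
      then have "g - const_fn c * h \<in> VS.span (insert h B)"
        using B(3) VS.span_mono[of B "insert h B"] by blast
      moreover have "const_fn c * h \<in> VS.span (insert h B)"
        by (intro VS.span_scale VS.span_base) simp
      ultimately show ?thesis using VS.span_add[of "g - const_fn c * h" _ "const_fn c * h"] by simp
    qed
    then have "VS.dim (RR ?D') \<le> card (insert h B)"
      using finB by (intro VS.dim_le_card) auto
    also have "\<dots> \<le> card B + 1" using finB by (simp add: card_insert_if)
    finally show ?thesis using B(4) by simp
  qed
qed

lemma divisorsD: "D \<in> divisors C \<Longrightarrow> finite {P. D P \<noteq> 0}" "D \<in> divisors C \<Longrightarrow> D P \<noteq> 0 \<Longrightarrow> P \<in> pts"
  by (auto simp: divisors_def)

lemma divisors_add:
  assumes "D \<in> divisors C" "E \<in> divisors C"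
  shows "(\<lambda>P. D P + E P) \<in> divisors C"
proof -
  have "{P. D P + E P \<noteq> 0} \<subseteq> {P. D P \<noteq> 0} \<union> {P. E P \<noteq> 0}" by auto
  then show ?thesis using assms unfolding divisors_def by (auto intro: finite_subset)
qed

lemma divisors_uminus: "D \<in> divisors C \<Longrightarrow> (\<lambda>P. - D P) \<in> divisors C"
  by (simp add: divisors_def)

lemma divisors_point: "Q \<in> pts \<Longrightarrow> (\<lambda>P. of_bool (P = Q)) \<in> divisors C"
  by (auto simp: divisors_def)

text \<open>
  The inequality is inherited by smaller divisors: the degree drops by one and the dimension by at
  most one.
\<close>

lemma riemann_step:
  assumes D: "D \<in> divisors C" and P: "P \<in> pts" and r: "riemann (\<lambda>Q. D Q + of_bool (Q = P))"
  shows "riemann D"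
proof -
  obtain W where W: "finite W" "RR (\<lambda>Q. D Q + of_bool (Q = P)) \<subseteq> VS.span W"
    using r unfolding riemann_def by blast
  have "RR D \<subseteq> RR (\<lambda>Q. D Q + of_bool (Q = P))" by (rule RR_mono) simp
  moreover have "divisor_degree (\<lambda>Q. D Q + of_bool (Q = P)) = divisor_degree D + 1"
    using divisor_degree_add[of D "\<lambda>Q. of_bool (Q = P)"] divisorsD(1)[OF D]
      divisorsD(1)[OF divisors_point[OF P]] by (simp add: divisor_degree_point)
  ultimately show ?thesis
    using W RR_step[OF P W] r unfolding riemann_def by force
qed

lemma riemann_le:
  assumes "D \<in> divisors C" and D': "D' \<in> divisors C" "riemann D'" and le: "\<And>P. D P \<le> D' P"
  shows "riemann D"
  using assms(1) le
proof (induction "nat (divisor_degree (\<lambda>P. D' P + - D P))" arbitrary: D rule: less_induct)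
  case less
  show ?case
  proof (cases "D = D'")
    case False
    then obtain P where "D P \<noteq> D' P" by blast
    with less.prems(2) have P: "D P < D' P" by (simp add: order_less_le)
    then have pts: "P \<in> pts" using divisorsD(2)[OF less.prems(1), of P] divisorsD(2)[OF D'(1), of P]
      by (cases "D P = 0") auto
    define E where "E = (\<lambda>Q. D Q + of_bool (Q = P))"
    have E: "E \<in> divisors C" unfolding E_def by (intro divisors_add less.prems divisors_point pts)
    have EP: "E Q \<le> D' Q" for Q using less.prems(2)[of Q] P by (simp add: E_def)
    have "divisor_degree (\<lambda>P. D' P + - D P) =
      divisor_degree (\<lambda>Q. (D' Q + - E Q) + of_bool (Q = P))" by (simp add: E_def algebra_simps)
    also have "\<dots> = divisor_degree (\<lambda>Q. D' Q + - E Q) + 1"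
      using divisorsD(1)[OF divisors_add[OF D'(1) divisors_uminus[OF E]]]
        divisorsD(1)[OF divisors_point[OF pts]]
      by (subst divisor_degree_add) (simp_all add: divisor_degree_point)
    finally have "divisor_degree (\<lambda>P. D' P + - D P) = divisor_degree (\<lambda>Q. D' Q + - E Q) + 1" .
    moreover have "divisor_degree (\<lambda>Q. D' Q + - E Q) \<ge> 0"
      unfolding divisor_degree_def using EP by (intro sum_nonneg) (simp add: le_diff_eq)
    ultimately have "riemann E" using less.hyps[OF _ E EP] by simp
    then show ?thesis using riemann_step[OF less.prems(1) pts] by (simp add: E_def)
  qed (use D' in simp)
qed

text \<open>The value is zero off the curve because divisors are supported on the curve.\<close>

definition divx :: "'a \<Rightarrow> 'a wpt \<Rightarrow> int" where
  "divx x0 P = (if P \<in> pts then vo P (gen_x - const_fn x0) else 0)"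

lemma x_minus: "gen_x - const_fn x0 = ev gen_x [:- x0, 1:]"
  by (simp add: ev_pCons)

lemma divx_aff: "y^2 = poly f x \<Longrightarrow> divx x0 (aff x y) = (if x0 = x then if y = 0 then 2 else 1 else 0)"
  by (simp add: divx_def vo_x_minus)

lemma divx_inf: "s^2 = lc \<Longrightarrow> divx x0 (inf s) = - 1"
  unfolding divx_def x_minus by (subst vo_inf_ev) auto

lemma divx_divisor: "divx x0 \<in> divisors C" and divx_degree: "divisor_degree (divx x0) = 0"
proof -
  obtain y where y: "y^2 = poly f x0" using nth_root_exists[of 2 "poly f x0"] by auto
  obtain s where s: "s^2 = lc" using nth_root_exists[of 2 lc] by auto
  have s0: "s \<noteq> 0" using s lead_nz by auto
  have sn: "(- y)^2 = poly f x0" "(- s)^2 = lc" using s y by simp_all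
  let ?A = "{aff x0 y, aff x0 (- y), inf s, inf (- s)}"
  have sub: "{P. divx x0 P \<noteq> 0} \<subseteq> ?A"
  proof
    fix P assume P: "P \<in> {P. divx x0 P \<noteq> 0}"
    then have "P \<in> pts" by (auto simp: divx_def split: if_splits)
    then show "P \<in> ?A"
    proof (cases rule: ptsE)
      case (aff x y')
      then have "x = x0" using P divx_aff[OF aff(2)] by (auto split: if_splits)
      then have "y'^2 = y^2" using aff y by simp
      then show ?thesis using aff \<open>x = x0\<close> by (auto simp: power2_eq_iff)
    next
      case (inf s')
      then have "s'^2 = s^2" using s by simp
      then show ?thesis using inf by (auto simp: power2_eq_iff)
    qed
  qed
  then show "divx x0 \<in> divisors C"
    unfolding divisors_def using y s sn by (auto intro: finite_subset)
  have "divisor_degree (divx x0) = sum (divx x0) ?A" using sub by (intro divisor_degree_eq) auto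
  also have "\<dots> = 0"
  proof (cases "y = 0")
    case True
    then have "divx x0 (aff x0 0) = 2" using divx_aff[of 0 x0 x0] y by simp
    then show ?thesis using s0 True by (simp add: divx_inf[OF s] divx_inf[OF sn(2)])
  next
    case False
    then show ?thesis using s0
      by (simp add: divx_aff[OF y] divx_aff[OF sn(1)] divx_inf[OF s] divx_inf[OF sn(2)])
  qed
  finally show "divisor_degree (divx x0) = 0" .
qed

text \<open>
  Multiplication by \<open>x - x0\<close> identifies the spaces of \<open>D\<close> and of \<open>D\<close> minus the divisor of \<open>x - x0\<close>,
  which have the same degree.
\<close>

lemma riemann_shift:
  assumes D: "D \<in> divisors C" and r: "riemann (\<lambda>P. D P + - divx x0 P)"
  shows "riemann D"
proof -
  obtain k where k_def: "k = gen_x - const_fn x0" by simp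
  let ?E = "\<lambda>P. D P + - divx x0 P"
  have k: "k \<in> K" "k \<noteq> 0" "inverse k \<in> K" "inverse k \<noteq> 0"
    unfolding k_def x_minus by (simp_all add: K_ev K_inverse)
  have shift: "vge P (m + vo P g) (g * h)" if "vge P m h" "P \<in> pts" "g \<in> K" "g \<noteq> 0" "h \<in> K" for P m g h
    using that vo_mult[OF that(2,3,4,5)] by (cases "h = 0") (simp_all add: vge_def)
  have 1: "k * h \<in> RR ?E" if "h \<in> RR D" for h
    unfolding RR_iff
  proof (intro conjI ballI)
    show "k * h \<in> K" using that k by (auto simp: RR_iff intro: K_mult)
    fix P assume "P \<in> pts"
    then show "vge P (- ?E P) (k * h)"
      using shift[of P "- D P" h k] that k by (simp add: RR_iff divx_def flip: k_def)
  qed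
  have 2: "inverse k * h \<in> RR D" if "h \<in> RR ?E" for h
    unfolding RR_iff
  proof (intro conjI ballI)
    show "inverse k * h \<in> K" using that k by (auto simp: RR_iff intro: K_mult)
    fix P assume "P \<in> pts"
    then show "vge P (- D P) (inverse k * h)"
      using shift[of P "- ?E P" h "inverse k"] that k vo_inverse[of P k] by (simp add: RR_iff divx_def flip: k_def)
  qed
  obtain W where W: "finite W" "RR ?E \<subseteq> VS.span W" using r unfolding riemann_def by blast
  have lin: "Vector_Spaces.linear smul smul (\<lambda>h. inverse k * h)"
    unfolding Vector_Spaces.linear_iff using VS.vector_space_axioms by (simp add: distrib_left mult.left_commute)
  have inj: "inj_on (\<lambda>h. inverse k * h) S" for S using k by (intro inj_onI) simp
  have span: "RR D \<subseteq> VS.span ((\<lambda>h. inverse k * h) ` W)"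
  proof
    fix h assume "h \<in> RR D"
    then have "k * h \<in> VS.span W" using 1 W by blast
    then have "inverse k * (k * h) \<in> (\<lambda>h. inverse k * h) ` VS.span W" by blast
    then show "h \<in> VS.span ((\<lambda>h. inverse k * h) ` W)"
      unfolding VP.linear_span_image[OF lin, of W] using k(2) by (simp flip: mult.assoc)
  qed
  obtain B where B: "B \<subseteq> RR ?E" "VS.independent B" "RR ?E \<subseteq> VS.span B" "card B = VS.dim (RR ?E)"
    by (rule VS.basis_exists)
  have "VS.independent ((\<lambda>h. inverse k * h) ` B)"
    by (rule VP.linear_independent_injective_image[OF lin B(2) inj])
  then have "VS.dim ((\<lambda>h. inverse k * h) ` B) = card ((\<lambda>h. inverse k * h) ` B)"
    by (rule VS.dim_eq_card_independent)
  then have dimB: "VS.dim ((\<lambda>h. inverse k * h) ` B) = VS.dim (RR ?E)"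
    unfolding card_image[OF inj] B(4) .
  obtain B' where B': "B' \<subseteq> RR D" "VS.independent B'" "RR D \<subseteq> VS.span B'" "card B' = VS.dim (RR D)"
    by (rule VS.basis_exists)
  have "finite B'"
    using VS.independent_span_bound[OF finite_imageI[OF W(1)] B'(2) order.trans[OF B'(1) span]] by blast
  moreover have "(\<lambda>h. inverse k * h) ` B \<subseteq> VS.span B'"
    by (rule order.trans[OF image_subsetI B'(3)]) (use 2 B(1) in blast)
  ultimately have "VS.dim ((\<lambda>h. inverse k * h) ` B) \<le> card B'"
    by (intro VS.dim_le_card)
  moreover have "divisor_degree ?E + divisor_degree (divx x0) = divisor_degree D"
    using divisor_degree_add[of ?E "divx x0"] divisorsD(1)[OF divx_divisor]
      divisorsD(1)[OF divisors_add[OF D divisors_uminus[OF divx_divisor]]] by simp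
  moreover have "divisor_degree ?E \<le> int (VS.dim (RR ?E))" using r by (simp only: riemann_def)
  ultimately have "divisor_degree D \<le> int (VS.dim (RR D))"
    unfolding dimB B'(4) divx_degree by linarith
  then show ?thesis unfolding riemann_def using finite_imageI[OF W(1)] span by metis
qed

definition infdiv :: "nat \<Rightarrow> 'a wpt \<Rightarrow> int" where
  "infdiv n P = (if \<exists>s. P = inf s \<and> s^2 = lc then int n else 0)"

lemma infdiv_simps [simp]: "infdiv n (aff x y) = 0" "s^2 = lc \<Longrightarrow> infdiv n (inf s) = int n"
  by (auto simp: infdiv_def)

lemma infdiv_divisor: "infdiv n \<in> divisors C" and infdiv_degree: "divisor_degree (infdiv n) = 2 * int n"
proof -
  obtain s where s: "s^2 = lc" using nth_root_exists[of 2 lc] by auto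
  then have s0: "s \<noteq> 0" and sn: "(- s)^2 = lc" using lead_nz by auto
  have "s' = s \<or> s' = - s" if "s'^2 = lc" for s' using that s by (metis power2_eq_iff)
  then have sub: "{P. infdiv n P \<noteq> 0} \<subseteq> {inf s, inf (- s)}"
    by (auto simp: infdiv_def split: if_splits)
  then show "infdiv n \<in> divisors C"
    unfolding divisors_def using s sn by (auto intro: finite_subset)
  have "divisor_degree (infdiv n) = sum (infdiv n) {inf s, inf (- s)}"
    using sub by (intro divisor_degree_eq) auto
  then show "divisor_degree (infdiv n) = 2 * int n" using s s0 sn by simp
qed

lemma RR_infdiv:
  "RR (infdiv n) = {c1.el p q | p q. degree p \<le> n \<and> (q = 0 \<or> degree q + 2 \<le> n)}"
proof (intro Set.set_eqI iffI)
  fix h assume h: "h \<in> RR (infdiv n)"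
  have "vge (aff x y) 0 h" if "y^2 = poly f x" for x y
    using h that unfolding RR_iff by (metis aff_pts infdiv_simps(1) minus_zero)
  moreover have "vge (inf s) (- int n) h" if "s^2 = lc" for s
    using h that unfolding RR_iff by (metis inf_pts infdiv_simps(2))
  ultimately show "h \<in> {c1.el p q | p q. degree p \<le> n \<and> (q = 0 \<or> degree q + 2 \<le> n)}"
    using poles_at_infinity[of h n] h by (auto simp: RR_iff)
next
  fix h assume "h \<in> {c1.el p q | p q. degree p \<le> n \<and> (q = 0 \<or> degree q + 2 \<le> n)}"
  then obtain p q where *: "h = c1.el p q" "degree p \<le> n" "q = 0 \<or> degree q + 2 \<le> n" by blast
  show "h \<in> RR (infdiv n)"
    unfolding RR_iff *(1)
  proof (intro conjI ballI K_el)
    fix P assume "P \<in> pts"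
    then show "vge P (- infdiv n P) (c1.el p q)"
      using vge_el vge_inf_el * by (cases rule: ptsE) auto
  qed
qed

lemma ev_in_span: "degree p \<le> n \<Longrightarrow> ev gen_x p * h \<in> VS.span ((\<lambda>i. gen_x ^ i * h) ` {..n})"
proof -
  assume "degree p \<le> n"
  then have "ev gen_x p = (\<Sum>i\<le>n. const_fn (coeff p i) * gen_x ^ i)"
    using poly_as_sum_of_monoms'[of p n] by (metis (no_types, lifting) ev_monom ev_sum sum.cong)
  then have "ev gen_x p * h = (\<Sum>i\<le>n. const_fn (coeff p i) * (gen_x ^ i * h))"
    by (simp add: sum_distrib_right mult.assoc)
  moreover have "\<dots> \<in> VS.span ((\<lambda>i. gen_x ^ i * h) ` {..n})"
    by (rule VS.span_sum, rule VS.span_scale, rule VS.span_base, rule imageI) simp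
  ultimately show ?thesis by simp
qed

text \<open>
  The powers \<open>x^i\<close> with \<open>i \<le> n + 2\<close> and the \<open>x^i y\<close> with \<open>i \<le> n\<close> form a basis with \<open>2 (n + 2)\<close>
  elements.
\<close>

lemma riemann_infdiv: "riemann (infdiv (n + 2))"
proof -
  let ?A = "(\<lambda>i. c1.el (monom 1 i) 0) ` {..n + 2}" and ?B = "(\<lambda>i. c1.el 0 (monom 1 i)) ` {..n}"
  have x: "c1.el (monom 1 i) 0 = gen_x ^ i * 1" "c1.el 0 (monom 1 i) = gen_x ^ i * gen_y C" for i
    by (simp_all add: c1.el_def ev_monom)
  have "h \<in> VS.span (?A \<union> ?B)" if "h \<in> RR (infdiv (n + 2))" for h
  proof -
    obtain p q where *: "h = c1.el p q" "degree p \<le> n + 2" "q = 0 \<or> degree q + 2 \<le> n + 2"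
      using \<open>h \<in> RR (infdiv (n + 2))\<close> unfolding RR_infdiv by blast
    have "degree q \<le> n" using *(3) by auto
    then have "ev gen_x q * gen_y C \<in> VS.span ?B" unfolding x by (rule ev_in_span)
    moreover have "ev gen_x p * 1 \<in> VS.span ?A" unfolding x by (rule ev_in_span[OF *(2)])
    ultimately have "ev gen_x p * 1 + ev gen_x q * gen_y C \<in> VS.span (?A \<union> ?B)"
      using VS.span_mono[OF Un_upper1, of ?A ?B] VS.span_mono[OF Un_upper2, of ?B ?A]
      by (intro VS.span_add) (simp_all only: subset_iff)
    then show ?thesis unfolding *(1) c1.el_def by (simp only: mult_1_right)
  qed
  then have span: "RR (infdiv (n + 2)) \<subseteq> VS.span (?A \<union> ?B)" by blast
  have inj: "inj_on (\<lambda>i. c1.el (monom 1 i) 0) S" "inj_on (\<lambda>i. c1.el 0 (monom 1 i)) S" for S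
    by (auto intro!: inj_onI simp: monom_eq_iff')
  have disj: "?A \<inter> ?B = {}" by (auto simp: monom_eq_0_iff)
  have indep: "VS.independent (?A \<union> ?B)"
  proof (rule VS.independent_if_scalars_zero)
    fix c h assume sum: "(\<Sum>h\<in>?A \<union> ?B. const_fn (c h) * h) = 0" and h: "h \<in> ?A \<union> ?B"
    define a b where "a i = c (c1.el (monom 1 i) 0)" and "b i = c (c1.el 0 (monom 1 i))" for i
    define p q where "p = (\<Sum>i\<le>n + 2. monom (a i) i)" and "q = (\<Sum>i\<le>n. monom (b i) i)"
    have "c1.el p q = (\<Sum>i\<le>n + 2. const_fn (a i) * c1.el (monom 1 i) 0) +
        (\<Sum>i\<le>n. const_fn (b i) * c1.el 0 (monom 1 i))"
      unfolding x by (simp only: c1.el_def p_def q_def ev_sum ev_monom sum_distrib_right mult.assoc mult_1_right)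
    also have "\<dots> = (\<Sum>h\<in>?A. const_fn (c h) * h) + (\<Sum>h\<in>?B. const_fn (c h) * h)"
      by (simp only: sum.reindex[OF inj(1)] sum.reindex[OF inj(2)] a_def b_def comp_def)
    also have "\<dots> = (\<Sum>h\<in>?A \<union> ?B. const_fn (c h) * h)"
      using disj by (intro sum.union_disjoint[symmetric]) simp_all
    finally have "p = 0" "q = 0" using sum by auto
    have co: "coeff (\<Sum>i\<le>m. monom (g i) i) j = (if j \<le> m then g j else 0)"
      for m j and g :: "nat \<Rightarrow> 'a" by (simp add: coeff_sum)
    have "a i = 0" if "i \<le> n + 2" for i
      using co[of a "n + 2" i] that \<open>p = 0\<close> by (simp only: p_def[symmetric] coeff_0 if_True)
    moreover have "b i = 0" if "i \<le> n" for i
      using co[of b n i] that \<open>q = 0\<close> by (simp only: q_def[symmetric] coeff_0 if_True)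
    ultimately show "c h = 0" using h unfolding a_def b_def by blast
  qed simp
  have "?A \<union> ?B \<subseteq> RR (infdiv (n + 2))"
    unfolding RR_infdiv by (fastforce simp: degree_monom_eq)
  then have "card (?A \<union> ?B) = VS.dim (RR (infdiv (n + 2)))"
    using span indep by (intro VS.basis_card_eq_dim)
  moreover have "card (?A \<union> ?B) = 2 * (n + 2)"
    using disj by (simp add: card_Un_disjoint card_image[OF inj(1)] card_image[OF inj(2)])
  ultimately show ?thesis
    unfolding riemann_def infdiv_degree using span by (intro conjI exI[of _ "?A \<union> ?B"]) auto
qed

text \<open>
  Subtracting the divisors of the functions \<open>x - x0\<close> moves all poles allowed by \<open>D\<close> to infinity, where \<open>D\<close> is
  dominated by a multiple of the divisor of points at infinity. The induction is on the total
  multiplicity of the affine points that occur positively.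
\<close>

theorem riemann_inequality:
  assumes "D \<in> divisors C"
  shows "riemann D"
  using assms
proof (induction "\<Sum>P | D P \<noteq> 0 \<and> (\<forall>s. P \<noteq> inf s). nat (D P)" arbitrary: D rule: less_induct)
  case less
  show ?case
  proof (cases "\<exists>P. D P > 0 \<and> (\<forall>s. P \<noteq> inf s)")
    case True
    then obtain P where P: "D P > 0" "\<forall>s. P \<noteq> inf s" by blast
    then have "P \<in> pts" using divisorsD(2)[OF less.prems] by auto
    then obtain x0 y0 where xy: "P = aff x0 y0" "y0^2 = poly f x0" using P(2) by (auto elim: ptsE)
    define E where "E = (\<lambda>P. D P + - divx x0 P)"
    have E: "E \<in> divisors C"
      unfolding E_def by (intro divisors_add less.prems divisors_uminus divx_divisor)
    define A where "A = {P. (D P \<noteq> 0 \<or> E P \<noteq> 0) \<and> (\<forall>s. P \<noteq> inf s)}"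
    have finA: "finite A"
      using divisorsD(1)[OF less.prems] divisorsD(1)[OF E]
      by (auto simp: A_def intro: finite_subset[of _ "{P. D P \<noteq> 0} \<union> {P. E P \<noteq> 0}"])
    have le: "E Q \<le> D Q" if "Q \<in> A" for Q
    proof (cases "Q \<in> pts")
      case True
      then show ?thesis using that divx_aff by (auto simp: E_def A_def elim!: ptsE)
    qed (simp add: E_def divx_def)
    have "(\<Sum>P | E P \<noteq> 0 \<and> (\<forall>s. P \<noteq> inf s). nat (E P)) = (\<Sum>P\<in>A. nat (E P))"
      using finA by (intro sum.mono_neutral_left) (auto simp: A_def)
    also have "\<dots> < (\<Sum>P\<in>A. nat (D P))"
    proof (rule sum_strict_mono_ex1[OF finA])
      show "\<forall>P\<in>A. nat (E P) \<le> nat (D P)" using le by (simp add: nat_mono)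
      have "E P < D P" using divx_aff[OF xy(2), of x0] by (simp add: E_def xy)
      then show "\<exists>P\<in>A. nat (E P) < nat (D P)"
        using P by (intro bexI[of _ P]) (auto simp: A_def)
    qed
    also have "\<dots> = (\<Sum>P | D P \<noteq> 0 \<and> (\<forall>s. P \<noteq> inf s). nat (D P))"
      using finA by (intro sum.mono_neutral_right) (auto simp: A_def)
    finally have "riemann E" using less.hyps E by blast
    then show ?thesis using riemann_shift[OF less.prems] by (simp add: E_def)
  next
    case False
    define n where "n = (\<Sum>P | D P \<noteq> 0. nat \<bar>D P\<bar>)"
    have bound: "D P \<le> int n" for P
    proof (cases "D P = 0")
      case False
      then have "nat \<bar>D P\<bar> \<le> n"
        unfolding n_def using divisorsD(1)[OF less.prems] by (intro member_le_sum) auto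
      then show ?thesis by linarith
    qed simp
    have "D P \<le> infdiv (n + 2) P" for P
    proof (cases "\<exists>s. P = inf s \<and> s^2 = lc")
      case True
      then have "infdiv (n + 2) P = int (n + 2)" unfolding infdiv_def by (rule if_P)
      then show ?thesis using bound[of P] by simp
    next
      case n: False
      have "D P \<le> 0"
      proof (rule ccontr)
        assume "\<not> D P \<le> 0"
        then have P: "D P > 0" "P \<in> pts" using divisorsD(2)[OF less.prems, of P] by simp_all
        from P(2) show False by (cases rule: ptsE) (use P(1) False n in \<open>metis aff_neq_inf(1)\<close>)+
      qed
      moreover have "infdiv (n + 2) P = 0" unfolding infdiv_def if_not_P[OF n] ..
      ultimately show ?thesis by simp
    qed
    then show ?thesis using riemann_le[OF less.prems infdiv_divisor riemann_infdiv] by blast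
  qed
qed

lemma RR_nonzero:
  assumes "D \<in> divisors C" "divisor_degree D > 0"
  shows "\<exists>h \<in> RR D. h \<noteq> 0"
proof (rule ccontr)
  assume "\<not> (\<exists>h \<in> RR D. h \<noteq> 0)"
  then have "VS.dim (RR D) \<le> card ({} :: 'a poly fract alg_closure set)"
    by (intro VS.dim_le_card) auto
  then show False using riemann_inequality[OF assms(1)] assms(2) by (simp add: riemann_def)
qed

text \<open>
  The inequality bounds \<open>deg D + 1 - l(D)\<close> by one; for the sum of the two points at infinity the
  space consists of the polynomials in \<open>x\<close> of degree at most one, and the bound is attained.
\<close>

theorem genus_one: "has_genus C 1"
  unfolding has_genus_def
proof (intro conjI ballI bexI[of _ "infdiv 1"] infdiv_divisor)
  fix D assume "D \<in> divisors C"
  then show "divisor_degree D + 1 - riemann_roch_dim C D \<le> 1"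
    using riemann_inequality unfolding riemann_def riemann_roch_dim_def by fastforce
next
  have "RR (infdiv 1) \<subseteq> VS.span ((\<lambda>i. gen_x ^ i * 1) ` {..1})"
  proof
    fix h assume "h \<in> RR (infdiv 1)"
    then obtain p where "h = ev gen_x p * 1" "degree p \<le> 1"
      unfolding RR_infdiv by (auto simp: c1.el_def)
    then show "h \<in> VS.span ((\<lambda>i. gen_x ^ i * 1) ` {..1})" using ev_in_span by blast
  qed
  then have "VS.dim (RR (infdiv 1)) \<le> card ((\<lambda>i. gen_x ^ i * 1 :: 'a poly fract alg_closure) ` {..1})"
    by (intro VS.dim_le_card) auto
  also have "\<dots> \<le> card {..1::nat}" by (rule card_image_le) simp
  finally have "VS.dim (RR (infdiv 1)) \<le> 2" by simp
  then show "divisor_degree (infdiv 1) + 1 - riemann_roch_dim C (infdiv 1) = 1"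
    using riemann_inequality[OF infdiv_divisor, of 1]
    unfolding riemann_def riemann_roch_dim_def infdiv_degree by linarith
qed

end

section \<open>Linear equivalence of points\<close>

context smooth_quartic
begin

lemma principalI: "h \<in> K \<Longrightarrow> h \<noteq> 0 \<Longrightarrow> (\<And>P. P \<in> pts \<Longrightarrow> vo P h = D P) \<Longrightarrow> principal C D"
  unfolding principal_def by blast

lemma principal_add:
  assumes "principal C D" "principal C E"
  shows "principal C (\<lambda>P. D P + E P)"
proof -
  obtain g where g: "g \<in> K" "g \<noteq> 0" "\<And>P. P \<in> pts \<Longrightarrow> vo P g = D P"
    using assms(1) unfolding principal_def by blast
  obtain h where h: "h \<in> K" "h \<noteq> 0" "\<And>P. P \<in> pts \<Longrightarrow> vo P h = E P"
    using assms(2) unfolding principal_def by blast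
  show ?thesis
    by (rule principalI[of "g * h"]) (use g h in \<open>simp_all add: K_mult vo_mult\<close>)
qed

lemma principal_uminus:
  assumes "principal C D"
  shows "principal C (\<lambda>P. - D P)"
proof -
  obtain g where g: "g \<in> K" "g \<noteq> 0" "\<And>P. P \<in> pts \<Longrightarrow> vo P g = D P"
    using assms(1) unfolding principal_def by blast
  show ?thesis
    by (rule principalI[of "inverse g"]) (use g in \<open>simp_all add: K_inverse vo_inverse\<close>)
qed

lemma principal_diff:
  assumes "principal C D" "principal C E"
  shows "principal C (\<lambda>P. D P - E P)"
  using principal_add[OF assms(1) principal_uminus[OF assms(2)]] by simp

lemma principal_0: "principal C (\<lambda>P. 0)"
  by (rule principalI[of 1]) (simp_all add: K_1 vo_1)

lemma principal_scale: "principal C D \<Longrightarrow> principal C (\<lambda>P. int n * D P)"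
proof (induction n)
  case (Suc n)
  then have "principal C (\<lambda>P. D P + int n * D P)" by (intro principal_add)
  then show ?case by (simp add: algebra_simps)
qed (simp add: principal_0)

lemma principal_divx: "principal C (divx x0)"
  by (rule principalI[of "gen_x - const_fn x0"]) (simp_all add: x_minus K_ev divx_def)

text \<open>
  No function has a single simple pole: after multiplication by \<open>x - x0\<close> it would be a polynomial
  in \<open>x\<close> of degree at most one, hence invariant under the hyperelliptic involution, and at a
  branch point such functions have even order.
\<close>

lemma point_unique:
  assumes R: "R \<in> pts" and pr: "principal C (\<lambda>Y. of_bool (Y = R') - of_bool (Y = R))"
  shows "R = R'"
proof (rule ccontr)
  assume neq: "R \<noteq> R'"
  obtain h where h: "h \<in> K" "h \<noteq> 0" "\<And>P. P \<in> pts \<Longrightarrow> vo P h = of_bool (P = R') - of_bool (P = R)"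
    using pr unfolding principal_def by blast
  have pole: "vo R h = - 1" using h(3)[OF R] neq by simp
  have conj: "conj_pt R = R" if "vo (conj_pt R) h = - 1"
    using that h(3)[OF conj_pts[OF R]] by (cases "conj_pt R = R"; cases "conj_pt R = R'") simp_all
  have linear: "\<exists>p. g = ev gen_x p \<and> degree p \<le> 1" if "g \<in> RR (infdiv 1)" for g
    using that unfolding RR_infdiv by (auto simp: c1.el_def)
  from R show False
  proof (cases rule: ptsE)
    case (inf s)
    have "h \<in> RR (infdiv 1)"
      unfolding RR_iff
    proof (intro conjI ballI h(1))
      fix P assume P: "P \<in> pts"
      have "vo P h \<ge> - infdiv 1 P"
        using P h(3)[OF P] inf by (cases "P = R") (simp_all add: infdiv_def)
      then show "vge P (- infdiv 1 P) h" by (simp add: vge_def)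
    qed
    then obtain p where p: "h = ev gen_x p" using linear by blast
    then have "vo (conj_pt R) h = - 1" using vo_conj_ev[OF R, of p] h(2) pole by auto
    then have "inf (- s) = inf s" using conj inf by simp
    then have "s = 0" by simp
    then show False using inf lead_nz by simp
  next
    case (aff x0 y0)
    define k where "k = gen_x - const_fn x0"
    have k: "k \<in> K" "k \<noteq> 0" "\<And>P. P \<in> pts \<Longrightarrow> vo P k = divx x0 P"
      unfolding k_def by (simp_all add: x_minus K_ev divx_def)
    have vk: "vo P (h * k) = of_bool (P = R') - of_bool (P = R) + divx x0 P" if "P \<in> pts" for P
      using vo_mult[OF that h(1,2) k(1,2)] h(3)[OF that] k(3)[OF that] by simp
    have "h * k \<in> RR (infdiv 1)"
      unfolding RR_iff
    proof (intro conjI ballI K_mult h k)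
      fix P assume P: "P \<in> pts"
      have "vo P (h * k) \<ge> - infdiv 1 P"
        using P
      proof (cases rule: ptsE)
        case (aff x y)
        then show ?thesis
          unfolding vk[OF P] using divx_aff[OF aff(2), of x0] \<open>R = aff x0 y0\<close>
          by (cases "P = R"; cases "P = R'") simp_all
      next
        case (inf s)
        then have "P \<noteq> R" using \<open>R = aff x0 y0\<close> by (simp only: aff_neq_inf not_False_eq_True)
        then show ?thesis
          unfolding vk[OF P] using divx_inf[OF inf(2), of x0] inf
          by (cases "P = R'") simp_all
      qed
      then show "vge P (- infdiv 1 P) (h * k)" by (simp add: vge_def)
    qed
    then obtain p where p: "h * k = ev gen_x p" "degree p \<le> 1" using linear by blast
    have p0: "p \<noteq> 0" using p(1) h(2) k(2) by auto
    have "vo (conj_pt R) (h * k) = vo R (h * k)" using vo_conj_ev[OF R p0] p(1) by simp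
    moreover have "vo (conj_pt R) k = vo R k"
      unfolding k_def x_minus by (rule vo_conj_ev[OF R]) simp
    ultimately have "vo (conj_pt R) h = - 1"
      using vo_mult[OF R h(1,2) k(1,2)] vo_mult[OF conj_pts[OF R] h(1,2) k(1,2)] pole by simp
    then have "aff x0 (- y0) = aff x0 y0" using conj aff by simp
    then have y0: "y0 = 0" by simp
    have "vo R (ev gen_x p) = 1"
      unfolding p(1)[symmetric] vk[OF R] using neq aff y0 divx_aff[OF aff(2), of x0] by simp
    moreover have "vo R (ev gen_x p) \<noteq> 1"
    proof (cases "degree p = 0")
      case True
      then obtain c where "p = [:c:]" by (meson degree_eq_zeroE)
      then show ?thesis using vo_const[OF R, of c] p0 by auto
    next
      case False
      then have "degree p = 1" using p(2) by simp
      then obtain d c where cd: "p = [:d, c:]" "c \<noteq> 0" by (metis degree1_coeffs)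
      obtain x1 where "x1 = - d / c" by simp
      then have "p = smult c [:- x1, 1:]" using cd by simp
      then have p': "ev gen_x p = const_fn c * (gen_x - const_fn x1)"
        by (simp add: ev_pCons algebra_simps)
      have K1: "gen_x - const_fn x1 \<in> K" "gen_x - const_fn x1 \<noteq> 0"
        unfolding x_minus by (simp_all add: K_ev)
      have "vo R (ev gen_x p) = divx x1 R"
        unfolding p' using vo_mult[OF R K_const[of c] _ K1] cd(2) R vo_const[OF R cd(2)]
        by (simp add: divx_def)
      then show ?thesis using divx_aff[OF aff(2), of x1] y0 aff by simp
    qed
    ultimately show False by simp
  qed
qed

text \<open>
  A proper factorization of \<open>y^2 - f\<close> would be into two linear factors in \<open>y\<close> and make \<open>f\<close> a square.
\<close>

lemma irreducible: "irreducible_curve C"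
  unfolding irreducible_curve_def
proof (rule Factorial_Ring.irreducibleI)
  let ?F = "[:- f, 0, 1:]"
  show "?F \<noteq> 0" by simp
  show "\<not> ?F dvd 1"
    by (auto simp: is_unit_poly_iff)
  fix G H assume GH: "?F = G * H"
  have nz: "G \<noteq> 0" "H \<noteq> 0" using GH by auto
  have deg: "degree G + degree H = 2"
    using degree_mult_eq[OF nz] arg_cong[OF GH, of degree] by simp
  have lead: "lead_coeff G * lead_coeff H = 1"
    using lead_coeff_mult[of G H] arg_cong[OF GH, of lead_coeff] by simp
  have unit: "P dvd 1" if P: "degree P = 0" "lead_coeff P * c = 1" for P :: "'a poly poly" and c
  proof -
    obtain a where a: "P = [:a:]" using P(1) by (meson degree_eq_zeroE)
    then have "1 = P * [:c:]" using P(2) by (simp add: one_pCons mult.commute)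
    then show ?thesis by (rule dvdI)
  qed
  show "G dvd 1 \<or> H dvd 1"
  proof (cases "degree G = 0 \<or> degree H = 0")
    case True
    then show ?thesis using unit[of G] unit[of H] lead by (metis mult.commute)
  next
    case False
    then have "degree G = 1" "degree H = 1" using deg by auto
    then obtain g0 g1 h0 h1 where c: "G = [:g0, g1:]" "H = [:h0, h1:]"
      by (metis degree1_coeffs)
    with lead \<open>degree G = 1\<close> \<open>degree H = 1\<close> have 1: "g1 * h1 = 1" by auto
    have 2: "g0 * h0 = - f" "g0 * h1 + g1 * h0 = 0"
      using arg_cong[OF GH, of "\<lambda>p. coeff p 0"] arg_cong[OF GH, of "\<lambda>p. coeff p 1"] unfolding c
      by (simp_all add: coeff_mult_0 algebra_simps)
    have "(g0 * h1)^2 = - (g0 * h1) * (g1 * h0)" using 2(2) by (simp add: power2_eq_square add_eq_0_iff)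
    also have "\<dots> = - (g0 * h0) * (g1 * h1)" by (simp add: algebra_simps)
    finally have "(g0 * h1)^2 = f * 1^2" using 1 2(1) by simp
    then have "(1 :: 'a poly) = 0"
      using separable_not_square[OF c1.deg_f c1.separable] by blast
    then show ?thesis by simp
  qed
qed

end

section \<open>Descent of vanishing conditions to the base field\<close>

text \<open>Newton iteration for square roots modulo powers of \<open>l\<close>, with \<open>v\<close> an inverse of \<open>2 t\<close>.\<close>

lemma sqrt_mod_power:
  fixes l f t v :: "'r::comm_ring_1"
  assumes "l dvd t^2 - f" and "l dvd v * (2 * t) - 1"
  shows "\<exists>t'. l dvd t' - t \<and> l ^ Suc m dvd t'^2 - f"
proof (induction m)
  case 0
  show ?case using assms(1) by (intro exI[of _ t]) simp
next
  case (Suc m)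
  then obtain t' where t': "l dvd t' - t" "l ^ Suc m dvd t'^2 - f" by blast
  then obtain d where d: "t'^2 - f = l ^ Suc m * d" by (auto simp: dvd_def)
  define t'' where "t'' = t' - l ^ Suc m * (v * d)"
  have "l dvd (v * (2 * t) - 1) + 2 * v * (t' - t)"
    by (rule dvd_add[OF assms(2) dvd_mult[OF t'(1)]])
  then have "l dvd v * (2 * t') - 1" by (simp add: algebra_simps)
  then have "l ^ Suc m * l dvd l ^ Suc m * ((v * (2 * t') - 1) * d)"
    by (intro mult_dvd_mono) auto
  moreover have "l ^ Suc m * l dvd l ^ Suc m * l ^ Suc m * (v * d)^2"
    by (intro dvd_mult2 mult_dvd_mono) (auto simp: dvd_power)
  ultimately have "l ^ Suc m * l dvd l ^ Suc m * l ^ Suc m * (v * d)^2 - l ^ Suc m * ((v * (2 * t') - 1) * d)"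
    by (rule dvd_diff[rotated])
  moreover have "t''^2 - f = (t'^2 - f) - 2 * t' * (l ^ Suc m * (v * d)) + l ^ Suc m * l ^ Suc m * (v * d)^2"
    by (simp add: t''_def power2_eq_square algebra_simps)
  then have "t''^2 - f = l ^ Suc m * l ^ Suc m * (v * d)^2 - l ^ Suc m * ((v * (2 * t') - 1) * d)"
    unfolding d by (simp add: algebra_simps)
  ultimately have "l ^ Suc (Suc m) dvd t''^2 - f" by (simp add: mult.commute)
  moreover have "l dvd (t' - t) - l ^ Suc m * (v * d)"
    by (rule dvd_diff[OF t'(1)]) simp
  then have "l dvd t'' - t" by (simp add: t''_def algebra_simps)
  ultimately show ?case by blast
qed

context chart_point
begin

abbreviation "l \<equiv> [:- x0, 1:]"

text \<open>Vanishing to order at least \<open>m\<close>, with the zero function included.\<close>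

definition vanishes :: "nat \<Rightarrow> 'a poly fract alg_closure \<Rightarrow> bool" where
  "vanishes m h \<longleftrightarrow> (\<exists>g \<in> R. h = w ^ m * g)"

lemma vanishes_iff:
  assumes "h \<in> FF" "h \<noteq> 0"
  shows "vanishes m h \<longleftrightarrow> int m \<le> ord_at R h"
proof
  assume "vanishes m h"
  then obtain g where g: "g \<in> R" "h = w ^ m * g" unfolding vanishes_def by blast
  then have "g \<noteq> 0" "g \<in> FF" using assms(2) R_F by auto
  then obtain e where e: "e \<in> ring_units R" "g = w powi (ord_at R g) * e" using ord_decomp by blast
  have "h = w powi (int m + ord_at R g) * e"
    unfolding g(2) using par_nz by (subst e(2)) (simp add: power_int_add)
  then have "ord_at R h = int m + ord_at R g" using ord_at_powi e(1) by blast
  then show "int m \<le> ord_at R h" using ord_in_R[OF \<open>g \<in> FF\<close> \<open>g \<noteq> 0\<close>] g(1) by simp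
next
  assume m: "int m \<le> ord_at R h"
  obtain e where e: "e \<in> ring_units R" "h = w powi (ord_at R h) * e" using ord_decomp assms by blast
  have "h = w ^ m * (w powi (ord_at R h - int m) * e)"
    using par_nz by (subst e(2)) (simp add: power_int_diff)
  moreover have "w powi (ord_at R h - int m) * e \<in> R" using powi_unit_in_R[OF e(1)] m by simp
  ultimately show "vanishes m h" unfolding vanishes_def by blast
qed

lemma vanishes_add: "vanishes m g \<Longrightarrow> vanishes m h \<Longrightarrow> vanishes m (g + h)"
  unfolding vanishes_def using R_add by (metis distrib_left)

lemma vanishes_mult: "vanishes m h \<Longrightarrow> g \<in> R \<Longrightarrow> vanishes m (g * h)"
  unfolding vanishes_def using R_mult by (metis mult.left_commute)

lemma vanishes_diff: "vanishes m g \<Longrightarrow> vanishes m h \<Longrightarrow> vanishes m (g - h)"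
  using vanishes_add[of m g "el (- 1) 0 * h"] vanishes_mult[OF _ el_R[of "- 1" 0], of m h]
  by (simp add: el_def)

lemma ord_ev:
  assumes "p \<noteq> 0"
  shows "ord_at R (ev \<xi> p) = (if y0 = 0 then 2 else 1) * int (order x0 p)"
proof -
  obtain r where r: "p = l ^ order x0 p * r" "\<not> l dvd r" using order_decomp[OF assms] by blast
  then have "ev \<xi> r \<in> ring_units R" using el_unit[of r 0] by (auto simp: ev_el val_def poly_eq_0_iff_dvd)
  moreover obtain u where u: "u \<in> ring_units R" "\<xi> - const_fn x0 = w ^ (if y0 = 0 then 2 else 1) * u"
    using xi_minus_factor by blast
  moreover have "ev \<xi> p = (\<xi> - const_fn x0) ^ order x0 p * ev \<xi> r"
    using arg_cong[OF r(1), of "ev \<xi>"] unfolding xi_minus by simp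
  then have "ev \<xi> p = w powi int ((if y0 = 0 then 2 else 1) * order x0 p) * (u ^ order x0 p * ev \<xi> r)"
    unfolding u(2) by (simp only: power_mult_distrib power_int_of_nat mult.assoc power_mult)
  moreover have "u ^ order x0 p * ev \<xi> r \<in> ring_units R"
    using calculation(1,2) by (intro units_mult units_power)
  ultimately have "ord_at R (ev \<xi> p) = int ((if y0 = 0 then 2 else 1) * order x0 p)"
    using ord_at_powi by metis
  then show ?thesis by simp
qed

lemma vanishes_ev: "vanishes m (ev \<xi> p) \<longleftrightarrow> l ^ (if y0 = 0 then (m + 1) div 2 else m) dvd p"
proof (cases "p = 0")
  case True
  then show ?thesis unfolding vanishes_def using R_0 by auto
next
  case False
  then have "vanishes m (ev \<xi> p) \<longleftrightarrow> int m \<le> (if y0 = 0 then 2 else 1) * int (order x0 p)"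
    unfolding ord_ev[OF False, symmetric]
    by (intro vanishes_iff) (use el_FF[of p 0] in \<open>simp_all add: ev_el\<close>)
  also have "\<dots> \<longleftrightarrow> (if y0 = 0 then (m + 1) div 2 else m) \<le> order x0 p" by auto
  finally show ?thesis using False by (simp add: order_divides)
qed

text \<open>
  Away from the branch points, \<open>p + q \<eta>\<close> can be replaced by the polynomial \<open>p + q t\<close>, where \<open>t\<close>
  approximates the branch of the square root of \<open>f\<close> through the point.
\<close>

lemma vanishes_unramified:
  assumes "y0 \<noteq> 0" and t: "poly t x0 = y0" "l ^ m dvd t^2 - f"
  shows "vanishes m (el p q) \<longleftrightarrow> l ^ m dvd p + q * t"
proof -
  have "V t 1 \<noteq> 0" using assms(1) t(1) by (simp add: val_def)
  obtain r where r: "t^2 - f = l ^ m * r" using t(2) by (auto simp: dvd_def)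
  have "el t 1 * (ev \<xi> t - \<eta>) = ev \<xi> (t^2 - f)"
    using el_norm[of t 1] by (simp add: el_def power2_eq_square)
  also have "\<dots> = w ^ m * ev \<xi> r" unfolding r using assms(1) by (simp add: par_def xi_minus)
  finally have "(ev \<xi> t - \<eta>) * el t 1 = w ^ m * el r 0" by (simp only: ev_el mult.commute)
  then have "ev \<xi> t - \<eta> = w ^ m * (el r 0 / el t 1)"
    using val_nz[OF \<open>V t 1 \<noteq> 0\<close>] by (simp only: eq_divide_eq times_divide_eq_right not_False_eq_True if_True)
  then have approx: "vanishes m (ev \<xi> t - \<eta>)"
    unfolding vanishes_def using lringI[OF \<open>V t 1 \<noteq> 0\<close>] by blast
  have q: "vanishes m (ev \<xi> q * (ev \<xi> t - \<eta>))"
    using vanishes_mult[OF approx] el_R[of q 0] by (simp add: ev_el)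
  have eq: "ev \<xi> (p + q * t) = el p q + ev \<xi> q * (ev \<xi> t - \<eta>)"
    "el p q = ev \<xi> (p + q * t) - ev \<xi> q * (ev \<xi> t - \<eta>)"
    by (simp_all add: el_def algebra_simps)
  have "vanishes m (el p q) \<longleftrightarrow> vanishes m (ev \<xi> (p + q * t))"
    using eq q vanishes_add vanishes_diff by metis
  then show ?thesis unfolding vanishes_ev using assms(1) by (simp only: if_False)
qed

text \<open>
  At a branch point \<open>p\<close> has even and \<open>q \<eta>\<close> odd order, so no cancellation occurs. The half-sum of
  \<open>p + q \<eta>\<close> and its conjugate isolates \<open>p\<close>.
\<close>

lemma vanishes_ramified:
  assumes "y0 = 0"
  shows "vanishes m (el p q) \<longleftrightarrow> l ^ ((m + 1) div 2) dvd p \<and> l ^ (m div 2) dvd q"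
proof -
  have q: "vanishes m (ev \<xi> q * \<eta>) \<longleftrightarrow> l ^ (m div 2) dvd q"
  proof (cases "q = 0")
    case False
    have "ord_at R (ev \<xi> q * \<eta>) = ord_at R (ev \<xi> q) + ord_at R \<eta>"
      by (rule ord_mult) (use False eta_nz el_FF[of q 0] el_FF[of 0 1] in \<open>simp_all add: ev_el\<close>)
    moreover have "ord_at R \<eta> = 1" using ord_at_powi[OF U_1, of 1] assms by (simp add: par_def)
    moreover have "ord_at R (ev \<xi> q) = 2 * int (order x0 q)" using ord_ev[OF False] assms by simp
    ultimately have "ord_at R (ev \<xi> q * \<eta>) = 2 * int (order x0 q) + 1" by simp
    moreover have "ev \<xi> q * \<eta> = el 0 q" by (simp add: el_def)
    ultimately have "vanishes m (ev \<xi> q * \<eta>) \<longleftrightarrow> int m \<le> 2 * int (order x0 q) + 1"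
      using vanishes_iff[of "el 0 q" m] False by (simp add: el_FF)
    also have "\<dots> \<longleftrightarrow> m div 2 \<le> order x0 q" by auto
    finally show ?thesis using False by (simp add: order_divides)
  next
    case True
    then show ?thesis unfolding vanishes_def by (auto intro: bexI[of _ 0] simp: R_0)
  qed
  have p: "vanishes m (ev \<xi> p) \<longleftrightarrow> l ^ ((m + 1) div 2) dvd p" using vanishes_ev assms by simp
  have "vanishes m (ev \<xi> p)" if h: "vanishes m (el p q)"
  proof (cases "p = 0 \<and> q = 0")
    case False
    then have "int m \<le> ord_at R (el p q)" using h vanishes_iff[of "el p q"] by (simp add: el_FF)
    then have "vanishes m (el p (- q))"
      using ord_conj[of p q] False vanishes_iff[of "el p (- q)"] assms by (auto simp: el_FF)
    then have "vanishes m (el p q + el p (- q))" by (rule vanishes_add[OF h])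
    then have "vanishes m (ev \<xi> (smult (1 / 2) 1) * (el p q + el p (- q)))"
      using vanishes_mult el_R[of "smult (1 / 2) 1" 0] unfolding ev_el by blast
    moreover have "ev \<xi> (smult (1 / 2) 1) * (el p q + el p (- q)) = ev \<xi> (smult (1 / 2) 1 * (p + p))"
    proof -
      have "el p q + el p (- q) = ev \<xi> (p + p)"
        unfolding el_def ev_add ev_minus by simp
      then show ?thesis by (simp only: ev_mult)
    qed
    moreover have "smult (1 / 2) 1 * (p + p) = p"
      by (simp only: mult_smult_left mult_1_left smult_add_right flip: smult_add_left) simp
    ultimately show ?thesis by (simp only:)
  next
    case True
    then show ?thesis unfolding vanishes_def by (intro bexI[of _ 0]) (simp_all add: R_0)
  qed
  moreover have "ev \<xi> q * \<eta> = el p q - ev \<xi> p" "el p q = ev \<xi> p + ev \<xi> q * \<eta>"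
    by (simp_all add: el_def)
  ultimately have "vanishes m (el p q) \<longleftrightarrow> vanishes m (ev \<xi> p) \<and> vanishes m (ev \<xi> q * \<eta>)"
    using vanishes_add vanishes_diff by metis
  then show ?thesis using p q by simp
qed

end

abbreviation mp :: "'k::field poly \<Rightarrow> 'k alg_closure poly" where "mp \<equiv> map_poly to_ac"

lemma mp_mult: "mp (p * q) = mp p * mp q"
  by (intro poly_eqI) (simp add: coeff_map_poly coeff_mult to_ac_sum)

lemma mp_add: "mp (p + q) = mp p + mp q"
  by (intro poly_eqI) (simp add: coeff_map_poly)

lemma mp_diff: "mp (p - q) = mp p - mp q"
  by (intro poly_eqI) (simp add: coeff_map_poly)

lemma mp_1: "mp 1 = 1"
  by (intro poly_eqI) (simp add: coeff_map_poly coeff_1)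

lemma mp_power: "mp (p ^ n) = mp p ^ n"
  by (induction n) (simp_all add: mp_1 mp_mult)

lemma mp_eq_iff: "mp p = mp q \<longleftrightarrow> p = q"
  by (auto simp: poly_eq_iff coeff_map_poly)

lemma mp_eq_0: "mp p = 0 \<longleftrightarrow> p = 0"
  using mp_eq_iff[of p 0] by simp

lemma mp_linear: "mp [:a, b:] = [:to_ac a, to_ac b:]"
  by (intro poly_eqI) (simp add: coeff_map_poly coeff_pCons split: nat.split)

lemma poly_mp: "poly (mp p) (to_ac x) = to_ac (poly p x)"
  by (induction p) (simp_all add: map_poly_pCons)

lemma degree_mp: "degree (mp p) = degree p"
  by (intro degree_map_poly) simp

text \<open>
  Linear functionals from the algebraic closure to the base field. They are a substitute for Galois
  descent: a nonzero solution of linear equations over the base field is mapped to a solution in the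
  base field, and the functional can be chosen not to kill it.
\<close>

definition base_linear :: "('k::field alg_closure \<Rightarrow> 'k) \<Rightarrow> bool" where
  "base_linear \<phi> \<longleftrightarrow> (\<forall>x y. \<phi> (x + y) = \<phi> x + \<phi> y) \<and> (\<forall>c x. \<phi> (to_ac c * x) = c * \<phi> x)"

lemma base_linear_exists:
  fixes z :: "'k::field alg_closure"
  assumes "z \<noteq> 0"
  shows "\<exists>\<phi>. base_linear \<phi> \<and> \<phi> z = 1"
proof -
  interpret v1: vector_space "\<lambda>c x. to_ac c * x :: 'k alg_closure"
    by unfold_locales (simp_all add: algebra_simps)
  interpret v2: vector_space "\<lambda>c x. c * x :: 'k"
    by unfold_locales (simp_all add: algebra_simps)
  interpret p: vector_space_pair "\<lambda>c x. to_ac c * x :: 'k alg_closure" "\<lambda>c x. c * x :: 'k" ..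
  have "v1.independent {z}" using assms by simp
  from p.linear_independent_extend[OF this, of "\<lambda>_. 1"]
  obtain g where "Vector_Spaces.linear (\<lambda>c x. to_ac c * x) (\<lambda>c x. c * x) g" "g z = 1" by auto
  then show ?thesis unfolding Vector_Spaces.linear_iff base_linear_def by blast
qed

context
  fixes \<phi> :: "'k::field alg_closure \<Rightarrow> 'k"
  assumes lin: "base_linear \<phi>"
begin

lemma phi_add: "\<phi> (x + y) = \<phi> x + \<phi> y" and phi_scale: "\<phi> (to_ac c * x) = c * \<phi> x"
  using lin by (auto simp: base_linear_def)

lemma phi_0: "\<phi> 0 = 0"
  using phi_scale[of 0 0] by simp

lemma phi_sum: "\<phi> (sum g A) = (\<Sum>x\<in>A. \<phi> (g x))"
  by (induction A rule: infinite_finite_induct) (simp_all add: phi_0 phi_add)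

lemma coeff_phi: "coeff (map_poly \<phi> p) i = \<phi> (coeff p i)"
  by (simp add: coeff_map_poly phi_0)

lemma map_phi_add: "map_poly \<phi> (p + q) = map_poly \<phi> p + map_poly \<phi> q"
  by (intro poly_eqI) (simp add: coeff_phi phi_add)

lemma map_phi_mult: "map_poly \<phi> (mp q * p) = q * map_poly \<phi> p"
  by (intro poly_eqI) (simp add: coeff_phi coeff_mult phi_sum coeff_map_poly phi_scale)

lemma map_phi_dvd:
  assumes "mp d dvd p + q * mp t"
  shows "mp d dvd mp (map_poly \<phi> p) + mp (map_poly \<phi> q) * mp t"
proof -
  obtain r where "p + mp t * q = mp d * r" using assms by (auto simp: dvd_def mult.commute)
  then have "map_poly \<phi> p + t * map_poly \<phi> q = d * map_poly \<phi> r"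
    by (metis map_phi_add map_phi_mult)
  then have "mp (map_poly \<phi> p) + mp t * mp (map_poly \<phi> q) = mp d * mp (map_poly \<phi> r)"
    by (metis mp_add mp_mult)
  then show ?thesis by (simp add: mult.commute)
qed

lemma rev_poly_phi: "rev_poly n (map_poly \<phi> p) = map_poly \<phi> (rev_poly n p)"
  by (intro poly_eqI) (simp add: coeff_phi coeff_rev_poly phi_0)

lemma degree_phi: "degree (map_poly \<phi> p) \<le> degree p"
  by (intro degree_le) (simp add: coeff_phi phi_0 coeff_eq_0)

end

lemma base_linear_nonzero:
  assumes "p \<noteq> 0 \<or> q \<noteq> 0"
  shows "\<exists>\<phi>. base_linear \<phi> \<and> (map_poly \<phi> p \<noteq> 0 \<or> map_poly \<phi> q \<noteq> 0)"
proof -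
  obtain z where z: "z \<noteq> 0" "(\<exists>i. z = coeff p i) \<or> (\<exists>i. z = coeff q i)"
    using that[of "lead_coeff p"] that[of "lead_coeff q"] assms by (cases "p = 0") (simp_all, blast+)
  obtain \<phi> where phi: "base_linear \<phi>" "\<phi> z = 1" using base_linear_exists z(1) by blast
  from z(2) have "(\<exists>i. coeff (map_poly \<phi> p) i = 1) \<or> (\<exists>i. coeff (map_poly \<phi> q) i = 1)"
    using phi(2) unfolding coeff_phi[OF phi(1)] by blast
  then have "map_poly \<phi> p \<noteq> 0 \<or> map_poly \<phi> q \<noteq> 0" by auto
  then show ?thesis using phi(1) by blast
qed

text \<open>
  A functional that fixes the base field maps a quotient of two polynomials over the base field to
  itself.
\<close>

lemma mp_quotient:
  assumes "mp p = mp q * r"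
  shows "\<exists>r'. p = q * r'"
proof -
  obtain \<psi> where psi: "base_linear \<psi>" "\<psi> 1 = (1 :: 'a)" using base_linear_exists[of 1] by auto
  have "map_poly \<psi> 1 = 1"
    by (intro poly_eqI) (simp add: coeff_phi[OF psi(1)] coeff_1 psi(2) phi_0[OF psi(1)])
  moreover have "map_poly \<psi> (mp p * 1) = map_poly \<psi> (mp q * r)" using assms by simp
  ultimately have "p = q * map_poly \<psi> r" unfolding map_phi_mult[OF psi(1)] by simp
  then show ?thesis ..
qed

lemma rev_poly_mp: "rev_poly n (mp p) = mp (rev_poly n p)"
  by (intro poly_eqI) (simp add: coeff_map_poly coeff_rev_poly)

text \<open>
  Vanishing to a given order at a rational point amounts to divisibility conditions whose
  coefficients lie in the base field. Such conditions are inherited by the image of the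
  coefficients under any linear functional.
\<close>

lemma vanishes_descent:
  fixes \<phi> :: "'k::field_char_0 alg_closure \<Rightarrow> 'k"
  assumes lin: "base_linear \<phi>" and ch: "chart_point (mp f0) \<xi> \<eta> (to_ac x1) (to_ac y1)"
    and van: "chart_point.vanishes \<xi> \<eta> (to_ac x1) (to_ac y1) m (chart.el \<xi> \<eta> p q)"
  shows "chart_point.vanishes \<xi> \<eta> (to_ac x1) (to_ac y1) m
    (chart.el \<xi> \<eta> (mp (map_poly \<phi> p)) (mp (map_poly \<phi> q)))"
proof -
  interpret chart_point "mp f0" \<xi> \<eta> "to_ac x1" "to_ac y1" by (rule ch)
  have l: "[:- to_ac x1, 1:] ^ k = mp ([:- x1, 1:] ^ k)" for k
    by (simp add: mp_power mp_linear)
  show ?thesis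
  proof (cases "y1 = 0")
    case True
    then have "to_ac y1 = 0" by simp
    note ram = vanishes_ramified[OF this]
    show ?thesis
      using van map_phi_dvd[OF lin, of _ p 0 0] map_phi_dvd[OF lin, of _ q 0 0] unfolding ram l by simp
  next
    case False
    have f0: "y1^2 = poly f0 x1" using on_curve by (simp add: poly_mp flip: to_ac_power)
    have "[:- x1, 1:] dvd [:y1:]^2 - f0" "[:- x1, 1:] dvd [:1 / (2 * y1):] * (2 * [:y1:]) - 1"
      using f0 False by (simp_all add: dvd_iff_poly_eq_0)
    from sqrt_mod_power[OF this, of m]
    obtain t where t: "[:- x1, 1:] dvd t - [:y1:]" "[:- x1, 1:] ^ Suc m dvd t^2 - f0" by blast
    have "poly t x1 = y1" using t(1) by (simp add: dvd_iff_poly_eq_0)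
    then have 1: "poly (mp t) (to_ac x1) = to_ac y1" by (simp add: poly_mp)
    have "[:- x1, 1:] ^ m dvd t^2 - f0" using t(2) by (rule power_le_dvd) simp
    then have 2: "[:- to_ac x1, 1:] ^ m dvd (mp t)^2 - mp f0"
      unfolding l by (metis dvd_def mp_diff mp_mult mp_power)
    have "to_ac y1 \<noteq> 0" using False by simp
    note unram = vanishes_unramified[OF this 1 2]
    show ?thesis using van map_phi_dvd[OF lin] unfolding unram l by blast
  qed
qed

text \<open>
  The leading coefficient is a square in the base field, so the two points at infinity are rational.
\<close>

locale rational_quartic =
  fixes C0 :: "'k::field_char_0 quartic" and \<sigma> :: 'k
  assumes smooth0: "smooth_curve (geometric C0)"
    and lead0: "\<sigma>^2 = coeff (dehom_q C0) 4" "\<sigma> \<noteq> 0"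
begin

lemma dehom_geometric: "dehom_q (geometric C0) = mp (dehom_q C0)" "dehom_p (geometric C0) = mp (dehom_p C0)"
  by (cases C0; simp add: map_poly_pCons)+

sublocale smooth_quartic "geometric C0"
proof
  show "coeff (dehom_q (geometric C0)) 4 \<noteq> 0"
  proof -
    have "coeff (dehom_q C0) 4 \<noteq> 0" unfolding lead0(1)[symmetric] using lead0(2) by simp
    then show ?thesis unfolding dehom_geometric by (simp add: coeff_map_poly)
  qed
qed (rule smooth0)

abbreviation "f0 \<equiv> dehom_q C0"
abbreviation "C \<equiv> geometric C0"
abbreviation "rat_pts \<equiv> rational_points C0"

lemma lc_sigma: "lc = (to_ac \<sigma>)^2"
  unfolding dehom_geometric by (simp add: coeff_map_poly lead0(1)[symmetric])

lemma quartic_form0: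
  "quartic_form C0 x 1 = poly f0 x" "quartic_form C0 1 0 = \<sigma>^2"
  "quartic_form C0 (l * p) (l * q) = l^4 * quartic_form C0 p q"
  unfolding lead0(1)
  by (cases C0; simp add: algebra_simps power4_eq_xxxx power3_eq_cube power2_eq_square numeral_eq_Suc)+

lemma rational_points_eq:
  "rat_pts = {aff (to_ac x) (to_ac y) | x y. y^2 = poly f0 x} \<union> {inf (to_ac s) | s. s^2 = \<sigma>^2}"
proof (intro Set.set_eqI iffI)
  fix P assume "P \<in> rat_pts"
  then obtain p q S where P: "P = wpoint (to_ac p, to_ac q, to_ac S)" "(p, q) \<noteq> (0, 0)"
    "S^2 = quartic_form C0 p q"
    unfolding rational_points_def by blast
  have P': "P = (if q \<noteq> 0 then aff (to_ac (p / q)) (to_ac (S / q^2)) else inf (to_ac (S / p^2)))"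
    unfolding P(1) using P(2) by (subst wpoint_cases) auto
  show "P \<in> {aff (to_ac x) (to_ac y) | x y. y^2 = poly f0 x} \<union> {inf (to_ac s) | s. s^2 = \<sigma>^2}"
  proof (cases "q = 0")
    case False
    have "(S / q^2)^2 = poly f0 (p / q)"
      using False P(3) quartic_form0(3)[of q "p / q" 1]
      by (simp add: quartic_form0 power_divide flip: power_mult)
    moreover have "P = aff (to_ac (p / q)) (to_ac (S / q^2))" unfolding P' using False by (simp only: if_P simp_thms)
    ultimately show ?thesis by blast
  next
    case True
    then have "(S / p^2)^2 = \<sigma>^2"
      using P(2,3) quartic_form0(3)[of p 1 0]
      by (simp add: quartic_form0 power_divide flip: power_mult)
    moreover have "P = inf (to_ac (S / p^2))" unfolding P' using True by (simp only: simp_thms if_False)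
    ultimately show ?thesis by blast
  qed
next
  fix P assume "P \<in> {aff (to_ac x) (to_ac y) | x y. y^2 = poly f0 x} \<union> {inf (to_ac s) | s. s^2 = \<sigma>^2}"
  then show "P \<in> rat_pts"
  proof (elim UnE CollectE exE conjE)
    fix x y assume *: "P = aff (to_ac x) (to_ac y)" "y^2 = poly f0 x"
    show ?thesis unfolding rational_points_def
      by (rule CollectI, rule exI[of _ x], rule exI[of _ 1], rule exI[of _ y])
        (simp add: * aff_def quartic_form0)
  next
    fix s assume *: "P = inf (to_ac s)" "s^2 = \<sigma>^2"
    show ?thesis unfolding rational_points_def
      by (rule CollectI, rule exI[of _ 1], rule exI[of _ 0], rule exI[of _ s])
        (simp add: * inf_def quartic_form0)
  qed
qed

lemma rat_ptsE:
  assumes "P \<in> rat_pts"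
  obtains (aff) x y where "P = aff (to_ac x) (to_ac y)" "y^2 = poly f0 x"
    | (inf) s where "P = inf (to_ac s)" "s^2 = \<sigma>^2"
  using assms unfolding rational_points_eq by blast

lemma rat_aff: "y^2 = poly f0 x \<Longrightarrow> aff (to_ac x) (to_ac y) \<in> rat_pts"
  and rat_inf: "s^2 = \<sigma>^2 \<Longrightarrow> inf (to_ac s) \<in> rat_pts"
  unfolding rational_points_eq by blast+

lemma on_curve0: "(to_ac y)^2 = poly f (to_ac x) \<longleftrightarrow> y^2 = poly f0 x"
  by (simp add: dehom_geometric poly_mp flip: to_ac_power)

lemma rat_pts_subset: "P \<in> rat_pts \<Longrightarrow> P \<in> pts"
proof (elim rat_ptsE)
  fix x y assume "P = aff (to_ac x) (to_ac y)" "y^2 = poly f0 x"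
  then show ?thesis using on_curve0[of y x] by (simp only: aff_pts)
next
  fix s assume "P = inf (to_ac s)" "s^2 = \<sigma>^2"
  then show ?thesis by (simp only: inf_pts lc_sigma flip: to_ac_power)
qed

lemma conj_rat: "P \<in> rat_pts \<Longrightarrow> conj_pt P \<in> rat_pts"
proof (elim rat_ptsE)
  fix x y assume "P = aff (to_ac x) (to_ac y)" "y^2 = poly f0 x"
  then show ?thesis using rat_aff[of "- y" x] by simp
next
  fix s assume "P = inf (to_ac s)" "s^2 = \<sigma>^2"
  then show ?thesis using rat_inf[of "- s"] by simp
qed

lemma vge_vanishes_aff:
  assumes "y^2 = poly f x" "h \<in> K"
  shows "vge (aff x y) (int m) h \<longleftrightarrow> chart_point.vanishes gen_x (gen_y C) x y m h"
proof -
  interpret chart_point f gen_x "gen_y C" x y using assms(1) by (rule chart_aff)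
  show ?thesis
  proof (cases "h = 0")
    case True
    then show ?thesis unfolding vge_def vanishes_def by (auto intro: bexI[of _ 0] simp: R_0)
  next
    case False
    then show ?thesis
      using vanishes_iff[of h m] assms unfolding vge_def vanishing_order_ord_at
      by (simp add: local_ring_aff FF_eq)
  qed
qed

lemma vge_vanishes_inf:
  assumes "s^2 = lc" "h \<in> K"
  shows "vge (inf s) (int m) h \<longleftrightarrow> chart_point.vanishes (1 / gen_x) (gen_y C / gen_x^2) 0 s m h"
proof -
  interpret chart_point "dehom_p C" "1 / gen_x" "gen_y C / gen_x^2" 0 s using assms(1) by (rule chart_inf)
  show ?thesis
  proof (cases "h = 0")
    case True
    then show ?thesis unfolding vge_def vanishes_def by (auto intro: bexI[of _ 0] simp: R_0)
  next
    case False
    then show ?thesis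
      using vanishes_iff[of h m] assms unfolding vge_def vanishing_order_ord_at
      by (simp add: local_ring_inf FF_eq)
  qed
qed

lemma vge_el_flip:
  assumes "s^2 = lc" "degree p \<le> n" "q = 0 \<or> degree q + 2 \<le> n"
  shows "vge (inf s) m (c1.el p q) \<longleftrightarrow> vge (inf s) (m + int n) (c2.el (rev_poly n p) (rev_poly (n - 2) q))"
proof (cases "c1.el p q = 0")
  case True
  then show ?thesis by (simp add: vge_def)
next
  case False
  show ?thesis using vo_inf_el[OF assms False] False unfolding vge_def by fastforce
qed

lemma vge_descent:
  assumes lin: "base_linear \<phi>" and P: "P \<in> rat_pts" and van: "vge P m (c1.el p q)"
  shows "vge P m (c1.el (mp (map_poly \<phi> p)) (mp (map_poly \<phi> q)))"
  using P
proof (cases rule: rat_ptsE)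
  case (aff x y)
  have c: "(to_ac y)^2 = poly f (to_ac x)" using aff on_curve0 by simp
  show ?thesis
  proof (cases "m \<le> 0")
    case True
    then show ?thesis unfolding aff using vge_mono[OF vge_el[OF c]] by blast
  next
    case False
    then obtain k where m: "m = int k" by (metis nat_0_le linear)
    have ch: "chart_point (mp f0) gen_x (gen_y C) (to_ac x) (to_ac y)"
      using chart_aff[OF c] unfolding dehom_geometric .
    show ?thesis
      using vanishes_descent[OF lin ch, of k p q] van
      unfolding aff(1) m vge_vanishes_aff[OF c K_el] by blast
  qed
next
  case (inf s)
  have c: "(to_ac s)^2 = lc" using inf(2) by (simp add: lc_sigma flip: to_ac_power)
  define n where "n = max (degree p) (degree q + 2)"
  let ?p = "mp (map_poly \<phi> p)" and ?q = "mp (map_poly \<phi> q)"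
  have n: "degree p \<le> n" "q = 0 \<or> degree q + 2 \<le> n" "degree ?p \<le> n" "?q = 0 \<or> degree ?q + 2 \<le> n"
    using degree_phi[OF lin, of p] degree_phi[OF lin, of q] by (auto simp: n_def degree_mp)
  have van': "vge (inf (to_ac s)) (m + int n) (c2.el (rev_poly n p) (rev_poly (n - 2) q))"
    using van vge_el_flip[OF c n(1,2)] inf by simp
  have "vge (inf (to_ac s)) (m + int n) (c2.el (rev_poly n ?p) (rev_poly (n - 2) ?q))"
  proof (cases "m + int n \<le> 0")
    case True
    have "vge (inf (to_ac s)) 0 (c2.el (rev_poly n ?p) (rev_poly (n - 2) ?q))"
      using vo_el2_zero(1)[OF c] unfolding vge_def by blast
    then show ?thesis using True vge_mono by blast
  next
    case False
    then obtain k where k: "m + int n = int k" by (metis nat_0_le linear)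
    have ch: "chart_point (mp (dehom_p C0)) (1 / gen_x) (gen_y C / gen_x^2) (to_ac 0) (to_ac s)"
      using chart_inf[OF c] unfolding dehom_geometric by simp
    show ?thesis
      using vanishes_descent[OF lin ch, of k "rev_poly n p" "rev_poly (n - 2) q"] van'
      unfolding k vge_vanishes_inf[OF c K_el2] rev_poly_mp rev_poly_phi[OF lin] to_ac_0 by blast
  qed
  then show ?thesis using vge_el_flip[OF c n(3,4)] inf by simp
qed

end

section \<open>The group of rational points\<close>

context smooth_quartic
begin

lemma principal_cong: "principal C D \<Longrightarrow> (\<And>P. P \<in> pts \<Longrightarrow> D P = E P) \<Longrightarrow> principal C E"
  unfolding principal_def by metis

lemma conj_eq_iff: "P \<in> pts \<Longrightarrow> Q \<in> pts \<Longrightarrow> conj_pt P = Q \<longleftrightarrow> P = conj_pt Q"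
  using conj_conj by metis

text \<open>The fibre of the projection to the line through an affine point is the zero divisor of
  \<open>x - x0\<close>, with the correct multiplicity at branch points.\<close>

lemma fibre_aff:
  assumes "P \<in> pts" "y0^2 = poly f x0"
  shows "of_bool (P = aff x0 y0) + of_bool (P = aff x0 (- y0)) = divx x0 P + infdiv 1 P"
  using assms(1)
proof (cases rule: ptsE)
  case (aff x y)
  have "y = y0 \<or> y = - y0" if "x = x0" using that aff(2) assms(2) by (metis power2_eq_iff)
  moreover have "- y \<noteq> y" if "y \<noteq> 0" using that by simp
  ultimately show ?thesis
    unfolding aff(1) divx_aff[OF aff(2)] by (cases "x = x0"; cases "y = y0"; cases "y0 = 0") auto
next
  case (inf s)
  then show ?thesis unfolding inf(1) divx_inf[OF inf(2)] by simp
qed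

lemma fibre_inf:
  assumes "P \<in> pts" "s^2 = lc"
  shows "of_bool (P = inf s) + of_bool (P = inf (- s)) = infdiv 1 P"
  using assms(1)
proof (cases rule: ptsE)
  case (aff x y)
  then show ?thesis by simp
next
  case (inf s')
  have "s' = s \<or> s' = - s" using inf(2) assms(2) by (metis power2_eq_iff)
  moreover have "s \<noteq> 0" using assms(2) lead_nz by auto
  ultimately show ?thesis using inf by auto
qed

lemma principal_fibre:
  assumes "Q \<in> pts"
  shows "principal C (\<lambda>P. of_bool (P = Q) + of_bool (P = conj_pt Q) - infdiv 1 P)"
  using assms
proof (cases rule: ptsE)
  case (aff x y)
  show ?thesis unfolding aff(1) conj_aff
    by (rule principal_cong[OF principal_divx[of x]]) (use fibre_aff[OF _ aff(2)] in fastforce)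
next
  case (inf s)
  show ?thesis unfolding inf(1) conj_inf
    by (rule principal_cong[OF principal_0]) (use fibre_inf[OF _ inf(2)] in fastforce)
qed

end

context rational_quartic
begin

lemma infdiv_2: "infdiv 2 P = 2 * infdiv 1 P"
  by (simp add: infdiv_def)

text \<open>
  The fibre through an affine point is cut out by \<open>x - x0\<close>. For a point at infinity the constant
  polynomial serves the purpose, because \<open>infdiv 1\<close> already is the fibre.
\<close>

lemma rational_fibre:
  assumes "Q \<in> rat_pts"
  shows "\<exists>m. m \<noteq> 0 \<and> (\<forall>P \<in> pts. of_bool (P = Q) + of_bool (P = conj_pt Q) =
    vo P (ev gen_x (mp m)) + infdiv 1 P)"
  using assms
proof (cases rule: rat_ptsE)
  case (aff x y)
  have "of_bool (P = Q) + of_bool (P = conj_pt Q) = vo P (ev gen_x (mp [:- x, 1:])) + infdiv 1 P"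
    if "P \<in> pts" for P
    using fibre_aff[OF that, of "to_ac y" "to_ac x"] on_curve0[of y x] aff that
    by (simp add: divx_def x_minus mp_linear)
  then show ?thesis by (intro exI[of _ "[:- x, 1:]"]) simp
next
  case (inf s)
  have "of_bool (P = Q) + of_bool (P = conj_pt Q) = vo P (ev gen_x (mp 1)) + infdiv 1 P"
    if "P \<in> pts" for P
    using fibre_inf[OF that, of "to_ac s"] inf lc_sigma vo_1[OF that] by (simp add: mp_1 flip: to_ac_power)
  then show ?thesis by (intro exI[of _ 1]) simp
qed

text \<open>
  Three rational points lie on a curve \<open>S = parabola\<close>, which meets the quartic in a fourth point.
  The function \<open>p + q y\<close> cutting out this curve can be chosen over the base field by descent.
  Its norm is a quartic form with three rational roots, so the fourth root is rational too.
\<close>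

lemma fourth_point:
  assumes A: "A \<in> rat_pts" and B: "B \<in> rat_pts" and D: "D \<in> rat_pts"
  shows "\<exists>E \<in> rat_pts. principal C
    (\<lambda>P. of_bool (P = A) + of_bool (P = B) + of_bool (P = D) + of_bool (P = E) - infdiv 2 P)"
proof -
  define ABD :: "'k alg_closure wpt \<Rightarrow> int" where
    "ABD = (\<lambda>P. of_bool (P = A) + of_bool (P = B) + of_bool (P = D))"
  have ABD_0: "ABD P = 0" if "P \<notin> rat_pts" for P
    using that A B D by (auto simp: ABD_def of_bool_def)
  have ABD_nonneg: "ABD P \<ge> 0" for P by (simp add: ABD_def)
  have ABD_div: "ABD \<in> divisors C"
    unfolding ABD_def using A B D by (intro divisors_add divisors_point rat_pts_subset)
  have "divisor_degree ABD = 3"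
    unfolding ABD_def
    by (subst divisor_degree_add, rule finite_subset[of _ "{A, B}"], force, force, force,
        subst divisor_degree_add) (simp_all add: divisor_degree_point)
  then have deg: "divisor_degree (\<lambda>P. infdiv 2 P + - ABD P) + 3 = divisor_degree (infdiv 2)"
    using divisor_degree_add[of "\<lambda>P. infdiv 2 P + - ABD P" ABD] divisorsD(1)[OF ABD_div]
      divisorsD(1)[OF divisors_add[OF infdiv_divisor divisors_uminus[OF ABD_div]]] by simp
  then have "divisor_degree (\<lambda>P. infdiv 2 P + - ABD P) > 0" unfolding infdiv_degree by simp
  from RR_nonzero[OF divisors_add[OF infdiv_divisor divisors_uminus[OF ABD_div]] this]
  obtain h where h: "h \<in> RR (\<lambda>P. infdiv 2 P + - ABD P)" "h \<noteq> 0" by blast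
  have "RR (\<lambda>P. infdiv 2 P + - ABD P) \<subseteq> RR (infdiv 2)"
    by (rule RR_mono) (use ABD_nonneg in simp)
  then have "h \<in> RR (infdiv 2)" using h(1) by (rule subsetD)
  then obtain p q where pq: "h = c1.el p q" "degree p \<le> 2" "q = 0 \<or> degree q + 2 \<le> 2"
    unfolding RR_infdiv by blast
  have "p \<noteq> 0 \<or> q \<noteq> 0" using h(2) pq(1) by simp
  then obtain \<phi> where phi: "base_linear \<phi>" "map_poly \<phi> p \<noteq> 0 \<or> map_poly \<phi> q \<noteq> 0"
    using base_linear_nonzero by blast
  define p0 q0 where "p0 = map_poly \<phi> p" and "q0 = map_poly \<phi> q"
  have nz: "mp p0 \<noteq> 0 \<or> mp q0 \<noteq> 0" unfolding mp_eq_0 p0_def q0_def by (rule phi(2))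
  have dp: "degree (mp p0) \<le> 2" "mp q0 = 0 \<or> degree (mp q0) + 2 \<le> 2" "degree q0 = 0"
    using pq degree_phi[OF phi(1), of p] degree_phi[OF phi(1), of q]
    by (auto simp: p0_def q0_def degree_mp)
  define g where "g = c1.el (mp p0) (mp q0)"
  define g' where "g' = c1.el (mp p0) (- mp q0)"
  have g: "g \<in> K" "g \<noteq> 0" "g' \<in> K" "g' \<noteq> 0"
    using nz by (simp_all add: g_def g'_def K_el)
  \<comment> \<open>The divisor of zeros of \<open>g\<close> besides \<open>A\<close>, \<open>B\<close> and \<open>D\<close>.\<close>
  define G where "G P = vo P g - (ABD P - infdiv 2 P)" for P
  have G_nonneg: "G P \<ge> 0" if P: "P \<in> pts" for P
  proof (cases "P \<in> rat_pts")
    case True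
    have "vge P (- (infdiv 2 P + - ABD P)) (c1.el p q)" using h(1) P unfolding RR_iff pq(1) by blast
    then have "vge P (- (infdiv 2 P + - ABD P)) g"
      unfolding g_def p0_def q0_def by (rule vge_descent[OF phi(1) True])
    then show ?thesis using g(2) by (simp add: vge_def G_def)
  next
    case False
    have "g \<in> RR (infdiv 2)" unfolding RR_infdiv g_def using dp by blast
    then have "vge P (- infdiv 2 P) g" using P by (simp add: RR_iff)
    then show ?thesis using g(2) ABD_0[OF False] by (simp add: vge_def G_def)
  qed
  define N where "N = p0 * p0 - f0 * (q0 * q0)"
  have gg': "g * g' = ev gen_x (mp N)"
    unfolding g_def g'_def c1.el_norm N_def by (simp add: mp_diff mp_mult dehom_geometric)
  have vg': "vo P g' = vo (conj_pt P) g" if "P \<in> pts" for P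
    using vo_conj[OF conj_pts[OF that] nz] conj_conj[OF that] by (simp add: g_def g'_def)
  obtain mA mB mD where m: "mA \<noteq> 0" "mB \<noteq> 0" "mD \<noteq> 0"
    "\<forall>P \<in> pts. of_bool (P = A) + of_bool (P = conj_pt A) = vo P (ev gen_x (mp mA)) + infdiv 1 P"
    "\<forall>P \<in> pts. of_bool (P = B) + of_bool (P = conj_pt B) = vo P (ev gen_x (mp mB)) + infdiv 1 P"
    "\<forall>P \<in> pts. of_bool (P = D) + of_bool (P = conj_pt D) = vo P (ev gen_x (mp mD)) + infdiv 1 P"
    using rational_fibre[OF A] rational_fibre[OF B] rational_fibre[OF D] by blast
  define M where "M = mA * mB * mD"
  have M: "M \<noteq> 0" "ev gen_x (mp M) \<noteq> 0" using m by (simp_all add: M_def mp_eq_0)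
  have vM: "vo P (ev gen_x (mp M)) + 3 * infdiv 1 P = ABD P + ABD (conj_pt P)" if P: "P \<in> pts" for P
  proof -
    have conj: "P = conj_pt Q \<longleftrightarrow> conj_pt P = Q" if "Q \<in> rat_pts" for Q
      using conj_eq_iff[OF P rat_pts_subset[OF that]] by simp
    have "vo P (ev gen_x (mp M)) = vo P (ev gen_x (mp mA)) + vo P (ev gen_x (mp mB)) + vo P (ev gen_x (mp mD))"
      using m(1-3) P by (simp add: M_def mp_mult vo_mult K_ev K_mult mp_eq_0)
    then show ?thesis
      using m(4)[rule_format, OF P, unfolded conj[OF A]] m(5)[rule_format, OF P, unfolded conj[OF B]]
        m(6)[rule_format, OF P, unfolded conj[OF D]] unfolding ABD_def by linarith
  qed
  \<comment> \<open>The norm divided by the three known linear factors has at most one pole at each point at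
    infinity and none elsewhere, so it is a polynomial \<open>T\<close> of degree at most one.\<close>
  define k where "k = ev gen_x (mp N) / ev gen_x (mp M)"
  have N0: "ev gen_x (mp N) \<noteq> 0" using g unfolding gg'[symmetric] by simp
  have k: "k \<in> K" "k \<noteq> 0" using N0 M by (simp_all add: k_def K_divide K_ev)
  have GG: "G P + G (conj_pt P) = vo P k + infdiv 1 P" if P: "P \<in> pts" for P
  proof -
    have "vo P (ev gen_x (mp N)) = vo P g + vo (conj_pt P) g"
      unfolding gg'[symmetric] using P g vo_mult vg' by simp
    moreover have "vo P k = vo P (ev gen_x (mp N)) - vo P (ev gen_x (mp M))"
      unfolding k_def using P N0 M by (intro vo_divide K_ev)
    moreover have "infdiv 1 (conj_pt P) = infdiv 1 P"
      using P by (elim ptsE) simp_all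
    ultimately show ?thesis using vM[OF P] by (simp add: G_def infdiv_2)
  qed
  have "k \<in> RR (infdiv 1)"
    unfolding RR_iff
  proof (intro conjI ballI k)
    fix P assume P: "P \<in> pts"
    have "vo P k \<ge> - infdiv 1 P" using GG[OF P] G_nonneg[OF P] G_nonneg[OF conj_pts[OF P]] by simp
    then show "vge P (- infdiv 1 P) k" by (simp add: vge_def)
  qed
  then obtain T where T: "k = ev gen_x T" "degree T \<le> 1"
    unfolding RR_infdiv by (auto simp: c1.el_def)
  then have NT: "mp N = mp M * T"
    using M N0 c1.ev_eq_0[of "mp N - mp M * T"] by (simp add: k_def field_simps del: c1.ev_eq_0)
  obtain T0 where "N = M * T0" using mp_quotient[OF NT] by blast
  then have "mp M * mp T0 = mp M * T" using NT by (simp only: mp_mult)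
  then have "T = mp T0" using M(1) mp_eq_0[of M] by simp
  then have T0: "k = ev gen_x (mp T0)" "T0 \<noteq> 0" "degree T0 \<le> 1"
    using T k(2) degree_mp[of T0] by auto
  obtain E' where E': "E' \<in> pts" "(\<exists>s. E' = inf s) \<or> (\<exists>x y. E' = aff (to_ac x) y)"
    "\<And>P. P \<in> pts \<Longrightarrow> vo P k + infdiv 1 P = of_bool (P = E') + of_bool (P = conj_pt E')"
  proof (cases "degree T0 = 0")
    case True
    then obtain c where c: "T0 = [:c:]" by (meson degree_eq_zeroE)
    then have k': "k = const_fn (to_ac c)" "to_ac c \<noteq> 0" using T0(1,2) by (simp_all add: map_poly_pCons)
    show thesis
    proof (rule that[of "inf (to_ac \<sigma>)"])
      show "inf (to_ac \<sigma>) \<in> pts" by (simp only: inf_pts lc_sigma)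
      show "(\<exists>s. inf (to_ac \<sigma>) = inf s) \<or> (\<exists>x y. inf (to_ac \<sigma>) = aff (to_ac x) y)" by blast
      fix P assume P: "P \<in> pts"
      show "vo P k + infdiv 1 P = of_bool (P = inf (to_ac \<sigma>)) + of_bool (P = conj_pt (inf (to_ac \<sigma>)))"
        using fibre_inf[OF P lc_sigma[symmetric]] vo_const[OF P k'(2)] unfolding k'(1) conj_inf by simp
    qed
  next
    case False
    then have "degree T0 = 1" using T0(3) by simp
    then obtain d c where dc: "T0 = [:d, c:]" "c \<noteq> 0" by (metis degree1_coeffs)
    obtain x where "x = - d / c" by simp
    then have "T0 = smult c [:- x, 1:]" using dc by simp
    then have "mp T0 = smult (to_ac c) [:- to_ac x, 1:]" by (simp add: mp_linear)
    then have k': "k = const_fn (to_ac c) * (gen_x - const_fn (to_ac x))" "to_ac c \<noteq> 0"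
      unfolding T0(1) x_minus using dc(2) by (simp_all only: ev_smult) simp
    obtain y where y: "y^2 = poly f (to_ac x)" using nth_root_exists[of 2 "poly f (to_ac x)"] by auto
    show thesis
    proof (rule that[of "aff (to_ac x) y"])
      show "aff (to_ac x) y \<in> pts" by (simp only: aff_pts y)
      show "(\<exists>s. aff (to_ac x) y = inf s) \<or> (\<exists>x' y'. aff (to_ac x) y = aff (to_ac x') y')" by blast
      fix P assume P: "P \<in> pts"
      have K1: "gen_x - const_fn (to_ac x) \<in> K" "gen_x - const_fn (to_ac x) \<noteq> 0"
        unfolding x_minus by (simp_all add: K_ev)
      have "vo P k = divx (to_ac x) P"
        unfolding k'(1) using vo_mult[OF P K_const _ K1, of "to_ac c"] vo_const[OF P k'(2)] k'(2) P
        by (simp add: divx_def)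
      then show "vo P k + infdiv 1 P = of_bool (P = aff (to_ac x) y) + of_bool (P = conj_pt (aff (to_ac x) y))"
        using fibre_aff[OF P y] unfolding conj_aff by simp
    qed
  qed
  have GE': "G P + G (conj_pt P) = of_bool (P = E') + of_bool (P = conj_pt E')" if "P \<in> pts" for P
    using GG[OF that] E'(3)[OF that] by simp
  have E'c: "conj_pt E' \<in> pts" "conj_pt (conj_pt E') = E'" using conj_pts conj_conj E'(1) by blast+
  \<comment> \<open>\<open>G\<close> is effective and together with its conjugate makes up one fibre, so it is a single point.\<close>
  obtain E where E: "E \<in> pts" "E = E' \<or> E = conj_pt E'" "\<And>P. P \<in> pts \<Longrightarrow> G P = of_bool (P = E)"
  proof -
    have zero: "G P = 0" if "P \<in> pts" "P \<noteq> E'" "P \<noteq> conj_pt E'" for P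
      using GE'[OF that(1)] G_nonneg[OF that(1)] G_nonneg[OF conj_pts[OF that(1)]] that(2,3) by simp
    have sum: "G E' + G (conj_pt E') = 1 + of_bool (E' = conj_pt E')"
      using GE'[OF E'(1)] by simp
    show thesis
    proof (cases "G E' = 0")
      case True
      then have ne: "E' \<noteq> conj_pt E'" "G (conj_pt E') = 1"
        using sum by (auto simp: of_bool_def split: if_splits)
      show thesis
        by (rule that[of "conj_pt E'"]) (use E'c zero True ne in auto)
    next
      case False
      then have 1: "G E' = 1" "E' \<noteq> conj_pt E' \<Longrightarrow> G (conj_pt E') = 0"
        using sum G_nonneg[OF E'(1)] G_nonneg[OF E'c(1)] by (cases "E' = conj_pt E'"; simp)+
      show thesis
        by (rule that[of E']) (use E'(1) zero 1 in auto)
    qed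
  qed
  have "E \<in> rat_pts"
    using E(1)
  proof (cases rule: ptsE)
    case (inf s)
    then have "s = to_ac \<sigma> \<or> s = - to_ac \<sigma>" unfolding lc_sigma by (simp add: power2_eq_iff)
    then have "E = inf (to_ac \<sigma>) \<or> E = inf (to_ac (- \<sigma>))" using inf(1) by auto
    then show ?thesis using rat_inf[of \<sigma>] rat_inf[of "- \<sigma>"] by auto
  next
    case (aff x' y)
    then obtain x where x: "x' = to_ac x" using E(2) E'(2) by auto
    have "vo E g = ABD E + 1" using E(3)[OF E(1)] unfolding G_def aff(1) by simp
    then have pos: "vo E g > 0" using ABD_nonneg[of E] by simp
    have rat_if: "E \<in> rat_pts" if "y = to_ac y1" for y1
    proof -
      have "y1^2 = poly f0 x" using aff(2) unfolding x that by (simp only: on_curve0)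
      from rat_aff[OF this] show ?thesis unfolding aff(1) x that .
    qed
    obtain \<delta> where \<delta>: "q0 = [:\<delta>:]" using dp(3) by (meson degree_eq_zeroE)
    have "poly (mp p0) x' + poly (mp q0) x' * y = 0"
      using vo_el_zero[OF aff(2), of "mp p0" "mp q0"] g(2) pos unfolding g_def aff(1) by fastforce
    then have lin: "to_ac (poly p0 x) + to_ac \<delta> * y = 0"
      unfolding x \<delta> poly_mp by simp
    show ?thesis
    proof (cases "\<delta> = 0")
      case False
      then have "y = to_ac (- poly p0 x / \<delta>)" using lin by (simp add: field_simps add_eq_0_iff)
      then show ?thesis by (rule rat_if)
    next
      \<comment> \<open>Now \<open>g\<close> is a polynomial in \<open>x\<close> and its zeros come in conjugate pairs.\<close>
      case True
      then have "g' = g" by (simp add: g_def g'_def \<delta>)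
      then have "vo (conj_pt E) g = vo E g" using vg'[OF E(1)] by simp
      then have "ABD (conj_pt E) + of_bool (conj_pt E = E) > 0"
        using pos E(3)[OF conj_pts[OF E(1)]] unfolding G_def aff(1) conj_aff by simp
      then consider "conj_pt E = E" | "conj_pt E \<in> rat_pts"
        using ABD_0[of "conj_pt E"] by fastforce
      then show ?thesis
      proof cases
        case 1
        then have "y = to_ac 0" unfolding aff(1) by simp
        then show ?thesis by (rule rat_if)
      next
        case 2
        then have "conj_pt (conj_pt E) \<in> rat_pts" by (rule conj_rat)
        then show ?thesis by (simp only: conj_conj[OF E(1)])
      qed
    qed
  qed
  moreover have "principal C
    (\<lambda>P. of_bool (P = A) + of_bool (P = B) + of_bool (P = D) + of_bool (P = E) - infdiv 2 P)"
  proof (rule principalI[OF g(1,2)])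
    fix P assume "P \<in> pts"
    from E(3)[OF this] show "vo P g =
      of_bool (P = A) + of_bool (P = B) + of_bool (P = D) + of_bool (P = E) - infdiv 2 P"
      unfolding G_def ABD_def by linarith
  qed
  ultimately show ?thesis by blast
qed

definition sum_rel :: "'k alg_closure wpt \<Rightarrow> 'k alg_closure wpt \<Rightarrow> 'k alg_closure wpt \<Rightarrow> 'k alg_closure wpt \<Rightarrow> bool" where
  "sum_rel Z P Q R \<longleftrightarrow> principal C
    (\<lambda>Y. of_bool (Y = P) + of_bool (Y = Q) - of_bool (Y = R) - of_bool (Y = Z))"

text \<open>
  The fourth point \<open>E\<close> on the curve through \<open>P\<close>, \<open>Q\<close> and the conjugate of \<open>Z\<close> satisfies
  \<open>P + Q + conj Z + E \<sim> Z + conj Z + E + conj E\<close>, because all fibres are linearly equivalent. So the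
  sum is the conjugate of \<open>E\<close>.
\<close>

lemma sum_exists:
  assumes "P \<in> rat_pts" "Q \<in> rat_pts" "Z \<in> rat_pts"
  shows "\<exists>R \<in> rat_pts. sum_rel Z P Q R"
proof -
  obtain E where E: "E \<in> rat_pts" "principal C (\<lambda>Y. of_bool (Y = P) + of_bool (Y = Q) +
      of_bool (Y = conj_pt Z) + of_bool (Y = E) - infdiv 2 Y)"
    using fourth_point[OF assms(1,2) conj_rat[OF assms(3)]] by blast
  have "principal C (\<lambda>Y. (of_bool (Y = P) + of_bool (Y = Q) +
      of_bool (Y = conj_pt Z) + of_bool (Y = E) - infdiv 2 Y)
      - (of_bool (Y = Z) + of_bool (Y = conj_pt Z) - infdiv 1 Y)
      - (of_bool (Y = E) + of_bool (Y = conj_pt E) - infdiv 1 Y))"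
    by (rule principal_diff[OF principal_diff[OF E(2) principal_fibre[OF rat_pts_subset[OF assms(3)]]]
          principal_fibre[OF rat_pts_subset[OF E(1)]]])
  then have "sum_rel Z P Q (conj_pt E)"
    unfolding sum_rel_def by (rule principal_cong) (simp add: infdiv_2)
  then show ?thesis using conj_rat[OF E(1)] by blast
qed

lemma sum_unique:
  assumes "sum_rel Z P Q R" "sum_rel Z P Q R'" "R \<in> rat_pts"
  shows "R = R'"
proof -
  have "principal C (\<lambda>Y. of_bool (Y = R') - of_bool (Y = R))"
    using principal_diff[OF assms(1,2)[unfolded sum_rel_def]] by (rule principal_cong) simp
  then show ?thesis using point_unique rat_pts_subset[OF assms(3)] by blast
qed

context
  fixes Z assumes Z: "Z \<in> rat_pts"
begin

lemma point_add:
  assumes "P \<in> rat_pts" "Q \<in> rat_pts"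
  shows "point_add C0 Z P Q \<in> rat_pts" "sum_rel Z P Q (point_add C0 Z P Q)"
proof -
  obtain R where R: "R \<in> rat_pts" "sum_rel Z P Q R" using sum_exists assms Z by blast
  have "point_add C0 Z P Q = R"
    unfolding point_add_def sum_rel_def[symmetric]
    by (rule the_equality) (use R sum_unique in blast)+
  then show "point_add C0 Z P Q \<in> rat_pts" "sum_rel Z P Q (point_add C0 Z P Q)" using R by simp_all
qed

lemma point_add_eqI:
  assumes "P \<in> rat_pts" "Q \<in> rat_pts" "sum_rel Z P Q R"
  shows "point_add C0 Z P Q = R"
  using sum_unique[OF point_add(2)[OF assms(1,2)] assms(3) point_add(1)[OF assms(1,2)]] .

text \<open>
  The group axioms hold for linear equivalence classes, and a point is determined by its class.
\<close>

lemma comm_group_points: "comm_group (point_group C0 Z)"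
proof (rule comm_groupI; simp only: point_group_def monoid.simps partial_object.simps)
  fix P Q assume PQ: "P \<in> rat_pts" "Q \<in> rat_pts"
  show "point_add C0 Z P Q \<in> rat_pts" by (rule point_add(1)[OF PQ])
  show "point_add C0 Z P Q = point_add C0 Z Q P"
    using PQ point_add(2)[OF PQ(2,1)] by (intro point_add_eqI) (simp_all add: sum_rel_def add.commute)
  fix S assume S: "S \<in> rat_pts"
  let ?U = "point_add C0 Z P Q" and ?V = "point_add C0 Z Q S"
  have V: "?V \<in> rat_pts" and W: "point_add C0 Z P ?V \<in> rat_pts" using PQ S point_add(1) by blast+
  have "principal C (\<lambda>Y. (of_bool (Y = P) + of_bool (Y = ?V) - of_bool (Y = point_add C0 Z P ?V) - of_bool (Y = Z))
    + (of_bool (Y = Q) + of_bool (Y = S) - of_bool (Y = ?V) - of_bool (Y = Z))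
    - (of_bool (Y = P) + of_bool (Y = Q) - of_bool (Y = ?U) - of_bool (Y = Z)))"
    by (rule principal_diff[OF principal_add[OF point_add(2)[OF PQ(1) V, unfolded sum_rel_def]
          point_add(2)[OF PQ(2) S, unfolded sum_rel_def]] point_add(2)[OF PQ, unfolded sum_rel_def]])
  then have "sum_rel Z ?U S (point_add C0 Z P ?V)"
    unfolding sum_rel_def by (rule principal_cong) simp
  then show "point_add C0 Z ?U S = point_add C0 Z P ?V"
    using point_add(1)[OF PQ] S by (intro point_add_eqI)
next
  show "Z \<in> rat_pts" by (rule Z)
  fix P assume P: "P \<in> rat_pts"
  have "sum_rel Z Z P P" unfolding sum_rel_def by (rule principal_cong[OF principal_0]) simp
  then show "point_add C0 Z Z P = P" using P Z by (intro point_add_eqI)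
  obtain R where R: "R \<in> rat_pts" "sum_rel P Z Z R" using sum_exists P Z by blast
  have "principal C (\<lambda>Y. - (of_bool (Y = Z) + of_bool (Y = Z) - of_bool (Y = R) - of_bool (Y = P)))"
    using R(2) unfolding sum_rel_def by (rule principal_uminus)
  then have "sum_rel Z R P Z" unfolding sum_rel_def by (rule principal_cong) simp
  then have "point_add C0 Z R P = Z" using R(1) P by (intro point_add_eqI)
  then show "\<exists>R \<in> rat_pts. point_add C0 Z R P = Z" using R(1) by blast
qed

lemma multiple_principal:
  assumes b: "b \<in> rat_pts"
  shows "b [^]\<^bsub>point_group C0 Z\<^esub> n \<in> rat_pts \<and>
    principal C (\<lambda>Y. int n * (of_bool (Y = b) - of_bool (Y = Z)) -
      (of_bool (Y = b [^]\<^bsub>point_group C0 Z\<^esub> n) - of_bool (Y = Z)))"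
proof (induction n)
  case 0
  have "principal C (\<lambda>Y. int 0 * (of_bool (Y = b) - of_bool (Y = Z)) - (of_bool (Y = Z) - of_bool (Y = Z)))"
    by (rule principal_cong[OF principal_0]) simp
  then show ?case using Z by (simp add: nat_pow_def point_group_def)
next
  case (Suc n)
  let ?P = "b [^]\<^bsub>point_group C0 Z\<^esub> n"
  have Suc_pow: "b [^]\<^bsub>point_group C0 Z\<^esub> Suc n = point_add C0 Z ?P b"
    by (simp add: nat_pow_def point_group_def)
  have P: "?P \<in> rat_pts" using Suc by blast
  have "principal C (\<lambda>Y. (int n * (of_bool (Y = b) - of_bool (Y = Z)) - (of_bool (Y = ?P) - of_bool (Y = Z))) +
    (of_bool (Y = ?P) + of_bool (Y = b) - of_bool (Y = point_add C0 Z ?P b) - of_bool (Y = Z)))"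
    by (rule principal_add[OF conjunct2[OF Suc] point_add(2)[OF P b, unfolded sum_rel_def]])
  then have "principal C (\<lambda>Y. int (Suc n) * (of_bool (Y = b) - of_bool (Y = Z)) -
      (of_bool (Y = point_add C0 Z ?P b) - of_bool (Y = Z)))"
    by (rule principal_cong) (simp add: algebra_simps)
  then show ?case unfolding Suc_pow using point_add(1)[OF P b] by blast
qed

text \<open>
  A relation on the single point \<open>b\<close> makes a nonzero multiple of \<open>b\<close> equal to the origin; replacing the
  exponent by its absolute value, this is a statement about divisors.
\<close>

lemma rank_ge_1_or_torsion:
  assumes b: "b \<in> rat_pts"
  shows "group_rank (point_group C0 Z) \<ge> 1 \<or>
    (\<exists>n > 0. principal C (\<lambda>Y. int n * (of_bool (Y = b) - of_bool (Y = Z))))"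
proof -
  let ?G = "point_group C0 Z"
  interpret G: comm_group ?G by (rule comm_group_points)
  have carrier: "b \<in> carrier ?G" using b by (simp add: point_group_def)
  show ?thesis
  proof (cases "int_independent ?G {b}")
    case True
    then have "enat (card {b}) \<le> group_rank ?G"
      unfolding group_rank_def by (intro Sup_upper) blast
    then show ?thesis by (simp add: one_enat_def)
  next
    case False
    then obtain c :: "'k alg_closure wpt \<Rightarrow> int" where c:
      "(\<Otimes>\<^bsub>?G\<^esub>x\<in>{b}. x [^]\<^bsub>?G\<^esub> c x) = \<one>\<^bsub>?G\<^esub>" "c b \<noteq> 0"
      unfolding int_independent_def using carrier by auto
    have "(\<Otimes>\<^bsub>?G\<^esub>x\<in>{b}. x [^]\<^bsub>?G\<^esub> c x) = b [^]\<^bsub>?G\<^esub> c b"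
      using G.finprod_insert[of "{}" b "\<lambda>x. x [^]\<^bsub>?G\<^esub> c x"] carrier by (simp add: Pi_def)
    then have one: "b [^]\<^bsub>?G\<^esub> c b = \<one>\<^bsub>?G\<^esub>" using c(1) by simp
    define n where "n = nat \<bar>c b\<bar>"
    have "b [^]\<^bsub>?G\<^esub> int n = \<one>\<^bsub>?G\<^esub>"
    proof (cases "c b \<ge> 0")
      case True
      then show ?thesis using one by (simp add: n_def)
    next
      case neg: False
      then have "int n = - c b" by (simp add: n_def)
      then show ?thesis using G.int_pow_neg[OF carrier, of "c b"] one by simp
    qed
    then have "b [^]\<^bsub>?G\<^esub> n = Z" by (simp add: int_pow_int point_group_def)
    then have "principal C (\<lambda>Y. int n * (of_bool (Y = b) - of_bool (Y = Z)) - (of_bool (Y = Z) - of_bool (Y = Z)))"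
      using multiple_principal[OF b, of n] by simp
    then have "principal C (\<lambda>Y. int n * (of_bool (Y = b) - of_bool (Y = Z)))"
      by (rule principal_cong) simp
    moreover have "n > 0" using c(2) by (simp add: n_def)
    ultimately show ?thesis by blast
  qed
qed

end

text \<open>
  If both points at infinity were torsion with respect to the origin, so would be their difference.
\<close>

lemma rank_ge_1:
  assumes "\<And>n. n > 0 \<Longrightarrow> \<not> principal C (\<lambda>Y. int n * (of_bool (Y = inf (to_ac \<sigma>)) - of_bool (Y = inf (- to_ac \<sigma>))))"
    and Z: "Z \<in> rat_pts"
  shows "group_rank (point_group C0 Z) \<ge> 1"
proof (rule ccontr)
  assume neg: "\<not> group_rank (point_group C0 Z) \<ge> 1"
  have r: "inf (to_ac \<sigma>) \<in> rat_pts" "inf (- to_ac \<sigma>) \<in> rat_pts"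
    using rat_inf[of \<sigma>] rat_inf[of "- \<sigma>"] by simp_all
  obtain m where m: "m > 0" "principal C (\<lambda>Y. int m * (of_bool (Y = inf (to_ac \<sigma>)) - of_bool (Y = Z)))"
    using rank_ge_1_or_torsion[OF Z r(1)] neg by blast
  obtain n where n: "n > 0" "principal C (\<lambda>Y. int n * (of_bool (Y = inf (- to_ac \<sigma>)) - of_bool (Y = Z)))"
    using rank_ge_1_or_torsion[OF Z r(2)] neg by blast
  have "principal C (\<lambda>Y. int n * (int m * (of_bool (Y = inf (to_ac \<sigma>)) - of_bool (Y = Z)))
      - int m * (int n * (of_bool (Y = inf (- to_ac \<sigma>)) - of_bool (Y = Z))))"
    by (rule principal_diff[OF principal_scale[OF m(2)] principal_scale[OF n(2)]])
  then have "principal C (\<lambda>Y. int (m * n) * (of_bool (Y = inf (to_ac \<sigma>)) - of_bool (Y = inf (- to_ac \<sigma>))))"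
    by (rule principal_cong) (simp add: algebra_simps)
  moreover have "m * n > 0" using m(1) n(1) by simp
  ultimately show False using assms(1) by blast
qed

end

section \<open>Infinite order of the difference of the points at infinity\<close>

text \<open>
  If \<open>n\<close> times the difference of the points at infinity is principal, a function with this divisor
  is \<open>\<alpha> + \<beta> v\<close> in terms of the coordinates \<open>u = 1/x\<close>, \<open>v = y/x^2\<close>, up to a power of \<open>u\<close>, and it
  vanishes to order \<open>2 n\<close> at one of the two points above \<open>u = 0\<close>. So \<open>(\<alpha>, \<beta>)\<close> is a Pade
  approximation to the square root of \<open>F(1, u)\<close> subject to as many conditions as there are
  coefficients.
\<close>

lemma (in rational_quartic) torsion_gives_approximation:
  assumes "principal C (\<lambda>Y. int n * (of_bool (Y = inf (to_ac \<sigma>)) - of_bool (Y = inf (- to_ac \<sigma>))))"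
  shows "\<exists>\<alpha> \<beta>. (\<alpha> \<noteq> 0 \<or> \<beta> \<noteq> 0) \<and> degree \<alpha> \<le> n \<and> (\<beta> = 0 \<or> degree \<beta> + 2 \<le> n) \<and>
    (\<forall>t. poly t 0 = \<sigma> \<longrightarrow> [:0, 1:] ^ (2 * n) dvd t^2 - dehom_p C0 \<longrightarrow>
       [:0, 1:] ^ (2 * n) dvd \<alpha> + \<beta> * t)"
proof -
  obtain h where h: "h \<in> K" "h \<noteq> 0" "\<And>P. P \<in> pts \<Longrightarrow>
    vo P h = int n * (of_bool (P = inf (to_ac \<sigma>)) - of_bool (P = inf (- to_ac \<sigma>)))"
    using assms unfolding principal_def by blast
  have \<sigma>: "(to_ac \<sigma>)^2 = lc" by (rule lc_sigma[symmetric])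
  have pt: "inf (to_ac \<sigma>) \<in> rat_pts" by (rule rat_inf) simp
  have "inf (to_ac \<sigma>) \<noteq> inf (- to_ac \<sigma>)" using lead0(2) by simp
  then have vh: "vo (inf (to_ac \<sigma>)) h = int n"
    using h(3)[OF rat_pts_subset[OF pt]] by simp
  have "h \<in> RR (infdiv n)"
    unfolding RR_iff
  proof (intro conjI ballI h(1))
    fix P assume P: "P \<in> pts"
    then have "vo P h \<ge> - infdiv n P"
    proof (cases rule: ptsE)
      case (aff x y)
      then show ?thesis using h(3)[OF P] by simp
    next
      case (inf s)
      then show ?thesis using h(3)[OF P] by (simp add: of_bool_def)
    qed
    then show "vge P (- infdiv n P) h" by (simp add: vge_def)
  qed
  then obtain p q where pq: "h = c1.el p q" "degree p \<le> n" "q = 0 \<or> degree q + 2 \<le> n"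
    unfolding RR_infdiv by blast
  have "p \<noteq> 0 \<or> q \<noteq> 0" using h(2) pq(1) by simp
  then obtain \<phi> where phi: "base_linear \<phi>" "map_poly \<phi> p \<noteq> 0 \<or> map_poly \<phi> q \<noteq> 0"
    using base_linear_nonzero by blast
  define p0 q0 where "p0 = map_poly \<phi> p" and "q0 = map_poly \<phi> q"
  have nz: "p0 \<noteq> 0 \<or> q0 \<noteq> 0" unfolding p0_def q0_def by (rule phi(2))
  have deg: "degree p0 \<le> n" "q0 = 0 \<or> degree q0 + 2 \<le> n"
    using pq(2,3) degree_phi[OF phi(1), of p] degree_phi[OF phi(1), of q]
    by (auto simp: p0_def q0_def)
  have deg': "degree (mp p0) \<le> n" "mp q0 = 0 \<or> degree (mp q0) + 2 \<le> n"
    using deg by (simp_all add: degree_mp mp_eq_0)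
  define \<alpha> \<beta> where "\<alpha> = rev_poly n p0" and "\<beta> = rev_poly (n - 2) q0"
  have "vge (inf (to_ac \<sigma>)) (int n) (c1.el p q)" unfolding vge_def using vh pq(1) by simp
  then have "vge (inf (to_ac \<sigma>)) (int n) (c1.el (mp p0) (mp q0))"
    unfolding p0_def q0_def by (rule vge_descent[OF phi(1) pt])
  then have "vge (inf (to_ac \<sigma>)) (int (2 * n)) (c2.el (mp \<alpha>) (mp \<beta>))"
    unfolding vge_el_flip[OF \<sigma> deg'] \<alpha>_def \<beta>_def rev_poly_mp by simp
  then have van: "chart_point.vanishes (1 / gen_x) (gen_y C / gen_x^2) 0 (to_ac \<sigma>) (2 * n) (c2.el (mp \<alpha>) (mp \<beta>))"
    unfolding vge_vanishes_inf[OF \<sigma> K_el2] .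
  have "[:0, 1:] ^ (2 * n) dvd \<alpha> + \<beta> * t" if t: "poly t 0 = \<sigma>" "[:0, 1:] ^ (2 * n) dvd t^2 - dehom_p C0" for t
  proof -
    interpret chart_point "dehom_p C" "1 / gen_x" "gen_y C / gen_x^2" 0 "to_ac \<sigma>"
      using \<sigma> by (rule chart_inf)
    have l: "[:- 0, 1:] ^ m = mp ([:0, 1:] ^ m)" for m by (simp add: mp_power mp_linear)
    have "to_ac \<sigma> \<noteq> 0" using lead0(2) by simp
    moreover have "poly (mp t) 0 = to_ac \<sigma>" using poly_mp[of t 0] t(1) by simp
    moreover have "[:- 0, 1:] ^ (2 * n) dvd (mp t)^2 - dehom_p C"
      unfolding l dehom_geometric using t(2) by (metis dvd_def mp_diff mp_mult mp_power)
    ultimately have "[:- 0, 1:] ^ (2 * n) dvd mp \<alpha> + mp \<beta> * mp t"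
      using van vanishes_unramified by blast
    then obtain r where r: "mp \<alpha> + mp \<beta> * mp t = mp ([:0, 1:] ^ (2 * n)) * r"
      unfolding l by (auto simp: dvd_def)
    then have "mp (\<alpha> + \<beta> * t) = mp ([:0, 1:] ^ (2 * n)) * r" by (simp only: mp_add mp_mult)
    then obtain r' where "\<alpha> + \<beta> * t = [:0, 1:] ^ (2 * n) * r'" using mp_quotient by blast
    then show ?thesis by (rule dvdI)
  qed
  moreover have "\<alpha> \<noteq> 0 \<or> \<beta> \<noteq> 0"
    using nz deg rev_poly_eq_0[of p0 n] rev_poly_eq_0[of q0 "n - 2"] unfolding \<alpha>_def \<beta>_def by fastforce
  moreover have "\<beta> = 0 \<or> degree \<beta> + 2 \<le> n"
  proof (cases "q0 = 0")
    case False
    then show ?thesis using deg(2) degree_rev_poly[of "n - 2" q0] unfolding \<beta>_def by linarith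
  qed (simp add: \<beta>_def)
  ultimately show ?thesis using degree_rev_poly[of n p0] unfolding \<alpha>_def by blast
qed

lemma linear_power_dvd_cancel:
  fixes p q :: "'a::field poly"
  assumes "[:- a, 1:] ^ k dvd p * q" "poly q a \<noteq> 0"
  shows "[:- a, 1:] ^ k dvd p"
proof (cases "p = 0")
  case False
  then have "p * q \<noteq> 0" using assms(2) by auto
  then have "k \<le> order a (p * q)" using assms(1) by (simp add: order_divides)
  then have "k \<le> order a p" using \<open>p * q \<noteq> 0\<close> assms(2) by (simp add: order_mult order_0I)
  then show ?thesis by (simp add: order_divides)
qed simp

text \<open>
  The substitution \<open>u = (z^2 - 1)/4\<close> uniformizes the conic \<open>w^2 = 1 + 4 u\<close>. It turns \<open>\<alpha> + \<beta> w\<close>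
  into a polynomial of degree at most \<open>2 n\<close> in \<open>z\<close> divisible by \<open>(z - 1)^(2 n)\<close>, but lacking the
  term of degree \<open>2 n - 1\<close>, because the odd part comes from \<open>\<beta>\<close>.
\<close>

lemma no_approximation_conic:
  fixes \<alpha> \<beta> w :: "'a::field_char_0 poly"
  assumes n: "n > 0" and deg: "degree \<alpha> \<le> n" "\<beta> = 0 \<or> degree \<beta> + 2 \<le> n"
    and w: "poly w 0 = 1" "[:0, 1:] ^ (2 * n) dvd w^2 - [:1, 4:]"
    and approx: "[:0, 1:] ^ (2 * n) dvd \<alpha> + \<beta> * w"
  shows "\<alpha> = 0 \<and> \<beta> = 0"
proof -
  define s :: "'a poly" where "s = [:- (1 / 4), 0, 1 / 4:]"
  define A B W where "A = pcompose \<alpha> s" and "B = pcompose \<beta> s" and "W = pcompose w s"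
  let ?l = "[:- 1, 1:] :: 'a poly" and ?z = "[:0, 1:] :: 'a poly"
  have s: "s = ?l * [:1 / 4, 1 / 4:]" by (simp add: s_def)
  have pow: "pcompose (p ^ m) s = pcompose p s ^ m" for p m
    by (induction m) (simp_all add: pcompose_mult pcompose_1)
  have dvd: "?l ^ (2 * n) dvd pcompose p s" if p: "?z ^ (2 * n) dvd p" for p
  proof -
    obtain r where "p = ?z ^ (2 * n) * r" using p by (auto simp: dvd_def)
    then have "pcompose p s = s ^ (2 * n) * pcompose r s"
      by (simp add: pcompose_mult pow pcompose_pCons)
    also have "\<dots> = ?l ^ (2 * n) * ([:1 / 4, 1 / 4:] ^ (2 * n) * pcompose r s)"
      by (simp only: s power_mult_distrib mult.assoc)
    finally show ?thesis by (rule dvdI)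
  qed
  have "pcompose [:1, 4:] s = ?z * ?z" by (simp add: pcompose_pCons s_def)
  then have "pcompose (w^2 - [:1, 4:]) s = W * W - ?z * ?z"
    by (simp only: pcompose_diff pow W_def power2_eq_square pcompose_mult)
  also have "\<dots> = (W - ?z) * (W + ?z)" by (simp only: square_diff_square_factored mult.commute)
  finally have "pcompose (w^2 - [:1, 4:]) s = (W - ?z) * (W + ?z)" .
  then have "?l ^ (2 * n) dvd (W - ?z) * (W + ?z)" using dvd[OF w(2)] by simp
  moreover have "poly (W + ?z) 1 \<noteq> 0" using w(1) by (simp add: W_def poly_pcompose s_def)
  ultimately have W: "?l ^ (2 * n) dvd W - ?z" by (rule linear_power_dvd_cancel)
  have "?l ^ (2 * n) dvd A + B * W"
    using dvd[OF approx] by (simp only: A_def B_def W_def pcompose_add pcompose_mult)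
  then have "?l ^ (2 * n) dvd (A + B * W) - B * (W - ?z)"
    by (rule dvd_diff[OF _ dvd_mult[OF W]])
  then have h: "?l ^ (2 * n) dvd A + B * ?z" by (simp add: algebra_simps)
  have degA: "degree A \<le> 2 * n" using deg(1) by (simp add: A_def degree_pcompose s_def)
  have degB: "degree (B * ?z) < 2 * n - 1"
  proof (cases "\<beta> = 0")
    case False
    have "degree (B * ?z) \<le> degree B + 1" using degree_mult_le[of B ?z] by simp
    also have "degree B = 2 * degree \<beta>" by (simp add: B_def degree_pcompose s_def)
    finally show ?thesis using False deg(2) by linarith
  qed (use n in \<open>simp add: B_def\<close>)
  \<comment> \<open>\<open>s\<close> is even, so \<open>A\<close> has only even and \<open>B z\<close> only odd terms.\<close>
  have even: "pcompose (pcompose p s) [:0, - 1:] = pcompose p s" for p :: "'a poly"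
    by (simp add: s_def pcompose_pCons flip: pcompose_assoc)
  have sign: "coeff (pcompose p s) i = (- 1) ^ i * coeff (pcompose p s) i" for p i
    using coeff_pcompose_linear[of "pcompose p s" "- 1" i] unfolding even .
  have odd: "coeff (pcompose p s) i = 0" if "odd i" for p i using sign[of p i] that by simp
  have "A + B * ?z = 0"
  proof -
    obtain r where r: "A + B * ?z = ?l ^ (2 * n) * r" using h by (auto simp: dvd_def)
    have "degree r = 0"
    proof (cases "r = 0")
      case False
      then have "degree (?l ^ (2 * n) * r) = 2 * n + degree r"
        by (subst degree_mult_eq) (simp_all add: degree_power_eq)
      moreover have "degree (A + B * ?z) \<le> 2 * n" using degA degB by (intro degree_add_le) auto
      ultimately show ?thesis using r by simp
    qed simp
    then obtain c where c: "r = [:c:]" by (meson degree_eq_zeroE)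
    have "coeff (A + B * ?z) (2 * n - 1) = 0"
      using odd[of "2 * n - 1" \<alpha>] n degB unfolding A_def by (simp add: coeff_eq_0)
    moreover have "coeff (?l ^ (2 * n)) (2 * n - 1) = - of_nat (2 * n)"
      using n binomial_symmetric[of "2 * n - 1" "2 * n"] by (subst coeff_linear_poly_power) simp_all
    moreover have eq: "A + B * ?z = smult c (?l ^ (2 * n))" using r c by simp
    ultimately have "c * - of_nat (2 * n) = 0" by (metis coeff_smult)
    then have "c = 0" using n by simp
    then show ?thesis using eq by simp
  qed
  then have "coeff A i = - coeff (B * ?z) i" for i
    by (metis add_eq_0_iff2 coeff_minus)
  then have i: "coeff A i = - coeff (pCons 0 B) i" for i by simp
  have "coeff B i = 0" for i
  proof (cases "odd i")
    case False
    then show ?thesis using i[of "Suc i"] odd[of "Suc i" \<alpha>] by (simp add: A_def)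
  qed (simp add: B_def odd)
  then have "B = 0" by (simp add: poly_eq_iff)
  then have "A = 0" using \<open>A + B * ?z = 0\<close> by simp
  have "degree s > 0" by (simp add: s_def)
  then show ?thesis using \<open>A = 0\<close> \<open>B = 0\<close> pcompose_eq_0 unfolding A_def B_def by blast
qed

text \<open>
  The statement for the conic carries over to any square root over \<open>R[t]\<close> that specializes to it at
  \<open>t = 0\<close>: the values at \<open>t = 0\<close> of an approximating pair vanish, so both polynomials can be
  divided by \<open>t\<close> over and over.
\<close>

lemma no_approximation_specialize:
  fixes \<alpha> \<beta> w :: "'a::field_char_0 poly poly"
  assumes n: "n > 0"
    and w: "poly w 0 = 1" "[:0, 1:] ^ (2 * n) dvd map_poly (\<lambda>c. poly c 0) w ^ 2 - [:1, 4:]"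
    and deg: "degree \<alpha> \<le> n" "\<beta> = 0 \<or> degree \<beta> + 2 \<le> n"
    and approx: "[:0, 1:] ^ (2 * n) dvd \<alpha> + \<beta> * w"
  shows "coeff \<alpha> i = 0 \<and> coeff \<beta> i = 0"
  using deg approx
proof (induction "degree (coeff \<alpha> i) + degree (coeff \<beta> i)" arbitrary: \<alpha> \<beta> rule: less_induct)
  case less
  let ?ev = "map_poly (\<lambda>c. poly c (0::'a))"
  have ev_mult: "?ev (p * q) = ?ev p * ?ev q" for p q
    by (intro poly_eqI) (simp add: coeff_map_poly coeff_mult poly_sum)
  have ev_add: "?ev (p + q) = ?ev p + ?ev q" for p q
    by (intro poly_eqI) (simp add: coeff_map_poly)
  have ev_1: "?ev 1 = 1" by (intro poly_eqI) (simp add: coeff_map_poly coeff_1)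
  have ev_z: "?ev [:0, 1:] = [:0, 1:]" by (simp add: map_poly_pCons)
  have ev_pow: "?ev ([:0, 1:] ^ m) = [:0, 1:] ^ m" for m
    by (induction m) (simp_all only: power_0 power_Suc ev_1 ev_mult ev_z)
  have deg_ev: "degree (?ev p) \<le> degree p" for p
    by (intro degree_le) (simp add: coeff_map_poly coeff_eq_0)
  obtain r where r: "\<alpha> + \<beta> * w = [:0, 1:] ^ (2 * n) * r" using less.prems(3) by (auto simp: dvd_def)
  have "?ev \<alpha> = 0 \<and> ?ev \<beta> = 0"
  proof (rule no_approximation_conic[OF n])
    show "degree (?ev \<alpha>) \<le> n" using deg_ev[of \<alpha>] less.prems(1) by simp
    show "?ev \<beta> = 0 \<or> degree (?ev \<beta>) + 2 \<le> n" using deg_ev[of \<beta>] less.prems(2) by fastforce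
    show "poly (?ev w) 0 = 1" using w(1) by (simp add: poly_0_coeff_0 coeff_map_poly)
    show "[:0, 1:] ^ (2 * n) dvd (?ev w)^2 - [:1, 4:]" by (rule w(2))
    have "?ev \<alpha> + ?ev \<beta> * ?ev w = [:0, 1:] ^ (2 * n) * ?ev r"
      using arg_cong[OF r, of ?ev] by (simp add: ev_add ev_mult ev_pow)
    then show "[:0, 1:] ^ (2 * n) dvd ?ev \<alpha> + ?ev \<beta> * ?ev w" by (rule dvdI)
  qed
  moreover have div: "\<exists>p'. p = smult [:0, 1:] p'" if "?ev p = 0" for p :: "'a poly poly"
  proof -
    have "[:0, 1:] dvd coeff p j" for j
      using arg_cong[OF that, of "\<lambda>q. coeff q j"] by (simp add: coeff_map_poly dvd_iff_poly_eq_0)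
    then have "[:[:0, 1:]:] dvd p" by (simp add: const_poly_dvd_iff)
    then show ?thesis by (auto simp: dvd_def)
  qed
  ultimately obtain \<alpha>' \<beta>' where ab: "\<alpha> = smult [:0, 1:] \<alpha>'" "\<beta> = smult [:0, 1:] \<beta>'" by blast
  show ?case
  proof (cases "coeff \<alpha> i = 0 \<and> coeff \<beta> i = 0")
    case False
    have degs: "degree (coeff (smult [:0, 1:] p) i) = (if coeff p i = 0 then 0 else Suc (degree (coeff p i)))"
      for p :: "'a poly poly" by (simp add: degree_mult_eq)
    have "degree (coeff \<alpha>' i) + degree (coeff \<beta>' i) < degree (coeff \<alpha> i) + degree (coeff \<beta> i)"
      using False unfolding ab degs by auto
    moreover have "degree \<alpha>' \<le> n" "\<beta>' = 0 \<or> degree \<beta>' + 2 \<le> n" using less.prems(1,2) by (auto simp: ab)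
    moreover have "[:0, 1:] ^ (2 * n) dvd \<alpha>' + \<beta>' * w"
    proof -
      have "coeff (\<alpha> + \<beta> * w) j = [:0, 1:] * coeff (\<alpha>' + \<beta>' * w) j" for j
        by (simp add: ab flip: smult_add_right)
      then have "coeff (\<alpha>' + \<beta>' * w) j = 0" if "j < 2 * n" for j
        using less.prems(3) that monom_1_dvd_iff'[of "2 * n" "\<alpha> + \<beta> * w"]
        by (simp add: monom_altdef)
      then show ?thesis using monom_1_dvd_iff'[of "2 * n" "\<alpha>' + \<beta>' * w"] by (simp add: monom_altdef)
    qed
    ultimately have "coeff \<alpha>' i = 0 \<and> coeff \<beta>' i = 0" by (rule less.hyps)
    then show ?thesis by (simp add: ab)
  qed simp
qed

lemma clear_denominators:
  fixes p :: "'a::idom fract poly"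
  shows "\<exists>d p'. d \<noteq> 0 \<and> smult (to_fract d) p = map_poly to_fract p'"
proof (induction p)
  case 0
  show ?case by (intro exI[of _ 1] exI[of _ 0]) simp
next
  case (pCons a p)
  then obtain d p' where IH: "d \<noteq> 0" "smult (to_fract d) p = map_poly to_fract p'" by blast
  obtain r s where a: "a = Fract r s" "s \<noteq> 0" by (cases a)
  have "to_fract s * a = to_fract r" using a by (simp add: to_fract_def eq_fract)
  then have "to_fract (s * d) * a = to_fract (d * r)" by (simp add: mult_ac)
  then have "smult (to_fract (s * d)) (pCons a p) = pCons (to_fract (d * r)) (smult (to_fract s) (smult (to_fract d) p))"
    by simp
  also have "\<dots> = map_poly to_fract (pCons (d * r) (smult s p'))"
    unfolding IH(2) by (simp add: map_poly_pCons)
  finally show ?case using IH(1) a(2) by (intro exI[of _ "s * d"] exI[of _ "pCons (d * r) (smult s p')"]) simp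
qed

text \<open>
  Multiplying \<open>\<alpha>\<close> and \<open>\<beta>\<close> by a common denominator does not affect any of the conditions.
\<close>

lemma no_approximation_fract:
  fixes \<alpha> \<beta> :: "'a::field_char_0 poly fract poly" and w :: "'a poly poly"
  assumes n: "n > 0"
    and w: "poly w 0 = 1" "[:0, 1:] ^ (2 * n) dvd map_poly (\<lambda>c. poly c 0) w ^ 2 - [:1, 4:]"
    and deg: "degree \<alpha> \<le> n" "\<beta> = 0 \<or> degree \<beta> + 2 \<le> n"
    and approx: "[:0, 1:] ^ (2 * n) dvd \<alpha> + \<beta> * map_poly to_fract w"
  shows "\<alpha> = 0 \<and> \<beta> = 0"
proof -
  obtain d1 p1 where 1: "d1 \<noteq> 0" "smult (to_fract d1) \<alpha> = map_poly to_fract p1"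
    using clear_denominators by blast
  obtain d2 p2 where 2: "d2 \<noteq> 0" "smult (to_fract d2) \<beta> = map_poly to_fract p2"
    using clear_denominators by blast
  define p q where "p = smult d2 p1" and "q = smult d1 p2"
  have p: "map_poly to_fract p = smult (to_fract (d1 * d2)) \<alpha>"
    unfolding p_def fract_poly_smult 1(2)[symmetric] by (simp add: mult.commute)
  have q: "map_poly to_fract q = smult (to_fract (d1 * d2)) \<beta>"
    unfolding q_def fract_poly_smult 2(2)[symmetric] by simp
  have dg: "degree (map_poly to_fract r) = degree r" for r :: "'a poly poly"
    by (intro degree_map_poly) simp
  have nz: "to_fract (d1 * d2) \<noteq> 0" using 1(1) 2(1) by simp
  have "coeff p i = 0 \<and> coeff q i = 0" for i
  proof (rule no_approximation_specialize[OF n w])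
    show "degree p \<le> n" using deg(1) dg[of p] nz by (simp add: p)
    show "q = 0 \<or> degree q + 2 \<le> n"
      using deg(2) dg[of q] nz fract_poly_eq_0_iff[of q] by (auto simp: q simp del: fract_poly_eq_0_iff)
    have "map_poly to_fract (p + q * w) = smult (to_fract (d1 * d2)) (\<alpha> + \<beta> * map_poly to_fract w)"
      by (simp add: p q smult_add_right)
    moreover have "[:0, 1:] ^ (2 * n) dvd smult (to_fract (d1 * d2)) (\<alpha> + \<beta> * map_poly to_fract w)"
      using approx by (rule dvd_smult)
    ultimately have "monom 1 (2 * n) dvd map_poly to_fract (p + q * w)" by (simp only: monom_altdef smult_1_left)
    then have "monom 1 (2 * n) dvd p + q * w"
      unfolding monom_1_dvd_iff' by (simp only: coeff_map_poly[of to_fract, OF to_fract_0] to_fract_eq_0_iff)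
    then show "[:0, 1:] ^ (2 * n) dvd p + q * w" by (simp only: monom_altdef smult_1_left)
  qed
  then have "p = 0" "q = 0" by (simp_all add: poly_eq_iff)
  then show ?thesis using p q nz by simp
qed

section \<open>The curve\<close>

text \<open>
  Up to a constant, the discriminant of a quartic form: the determinant of the Bezout matrix of its
  two partial derivatives. At a multiple root the matrix annihilates the vector \<open>(x^2, x, 1)\<close>.
\<close>

definition quartic_disc :: "'a::comm_ring_1 \<Rightarrow> 'a \<Rightarrow> 'a \<Rightarrow> 'a \<Rightarrow> 'a \<Rightarrow> 'a" where
  "quartic_disc a b c d e =
    (let m = 8 * a * c - 3 * b^2; n = 12 * a * d - 2 * b * c; k = 16 * a * e - b * d;
         q = 9 * b * d - 4 * c^2; r = 12 * b * e - 2 * c * d; s = 8 * c * e - 3 * d^2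
     in m * ((k + q) * s - r^2) - n * (n * s - r * k) + k * (n * r - (k + q) * k))"

lemma quartic_disc_rev: "quartic_disc e d c b a = quartic_disc a b c d e"
  by (simp add: quartic_disc_def Let_def algebra_simps power2_eq_square)

lemma multiple_root_disc:
  fixes x :: "'a::comm_ring_1"
  assumes "a * x^4 + b * x^3 + c * x^2 + d * x + e = 0"
    and "4 * a * x^3 + 3 * b * x^2 + 2 * c * x + d = 0"
  shows "quartic_disc a b c d e = 0"
proof -
  define P Q where "P = 4 * a * x^3 + 3 * b * x^2 + 2 * c * x + d"
    and "Q = b * x^3 + 2 * c * x^2 + 3 * d * x + 4 * e"
  have "Q = 4 * (a * x^4 + b * x^3 + c * x^2 + d * x + e) - x * P"
    unfolding P_def Q_def by (simp add: algebra_simps power4_eq_xxxx power3_eq_cube power2_eq_square)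
  then have 0: "P = 0" "Q = 0" using assms by (simp_all add: P_def)
  define m n k q r s where "m = 8 * a * c - 3 * b^2" and "n = 12 * a * d - 2 * b * c"
    and "k = 16 * a * e - b * d" and "q = 9 * b * d - 4 * c^2" and "r = 12 * b * e - 2 * c * d"
    and "s = 8 * c * e - 3 * d^2"
  note defs = P_def Q_def m_def n_def k_def q_def r_def s_def
  have "m * x^2 + n * x + k = 4 * a * Q - b * P"
    unfolding defs by (simp add: algebra_simps power3_eq_cube power2_eq_square)
  then have 1: "m * x^2 + n * x + k = 0" using 0 by simp
  have "n * x^2 + (k + q) * x + r = (4 * a * x + 3 * b) * Q - (b * x + 2 * c) * P"
    unfolding defs by (simp add: algebra_simps power3_eq_cube power2_eq_square)
  then have 2: "n * x^2 + (k + q) * x + r = 0" using 0 by simp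
  have "k * x^2 + r * x + s = (4 * a * x^2 + 3 * b * x + 2 * c) * Q - (b * x^2 + 2 * c * x + 3 * d) * P"
    unfolding defs by (simp add: algebra_simps power3_eq_cube power2_eq_square)
  then have 3: "k * x^2 + r * x + s = 0" using 0 by simp
  have "quartic_disc a b c d e = m * ((k + q) * s - r^2) - n * (n * s - r * k) + k * (n * r - (k + q) * k)"
    by (simp only: quartic_disc_def Let_def m_def n_def k_def q_def r_def s_def)
  also have "\<dots> = (n * r - (k + q) * k) * (m * x^2 + n * x + k) - (m * r - n * k) * (n * x^2 + (k + q) * x + r)
      + (m * (k + q) - n * n) * (k * x^2 + r * x + s)"
    by (simp add: algebra_simps power2_eq_square)
  finally show ?thesis using 1 2 3 by simp
qed

lemma smooth_affine_disc:
  fixes a b c d e :: "'a::{alg_closed_field,field_char_0}"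
  assumes "quartic_disc a b c d e \<noteq> 0"
  shows "smooth_affine [:e, d, c, b, a:]"
  unfolding smooth_affine_def
proof (intro allI impI)
  fix x y assume y: "y^2 = poly [:e, d, c, b, a:] x"
  show "2 * y \<noteq> 0 \<or> poly (pderiv [:e, d, c, b, a:]) x \<noteq> 0"
  proof (rule ccontr)
    assume "\<not> (2 * y \<noteq> 0 \<or> poly (pderiv [:e, d, c, b, a:]) x \<noteq> 0)"
    then have "poly [:e, d, c, b, a:] x = 0" "poly (pderiv [:e, d, c, b, a:]) x = 0" using y by auto
    then have "a * x^4 + b * x^3 + c * x^2 + d * x + e = 0"
      "4 * a * x^3 + 3 * b * x^2 + 2 * c * x + d = 0"
      by (simp_all add: pderiv_pCons algebra_simps power4_eq_xxxx power3_eq_cube power2_eq_square)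
    then show False using multiple_root_disc assms by blast
  qed
qed

lemma smooth_curve_disc:
  fixes a b c d e :: "'a::{alg_closed_field,field_char_0}"
  assumes "quartic_disc a b c d e \<noteq> 0"
  shows "smooth_curve (Quartic a b c d e)"
  using smooth_affine_disc[OF assms] smooth_affine_disc[of e d c b a] assms
  by (simp add: smooth_curve_def quartic_disc_rev)

text \<open>All coefficients lie in \<open>\<rat>[t]\<close>, where they can be evaluated at \<open>t = 1\<close> and \<open>t = 0\<close>.\<close>

abbreviation T :: "rat poly" where "T \<equiv> [:0, 1:]"

definition "cA = T^8 * (1 + T^4)^2"
definition "cB = 4 * T^5 * (1 + 2 * T^4 + 2 * T^8 + T^12)"
definition "cC = - 2 * T^4 * (4 + 3 * T^2 + 9 * T^4 + 4 * T^6 + 9 * T^8 + 3 * T^10 + 4 * T^12)"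
definition "cD = 4 * T^3 * (1 - T^2 + T^4) * (1 + T^2 + T^4)^2"
definition "cE = T^4 * (1 + T^2 + T^4)^2"

lemma to_fract_power: "to_fract (p ^ n) = to_fract p ^ n"
  by (induction n) simp_all

lemma to_fract_of_nat: "to_fract (of_nat n) = of_nat n"
  by (induction n) simp_all

lemma to_fract_numeral: "to_fract (numeral n) = numeral n"
  using to_fract_of_nat[of "numeral n"] by simp

lemmas to_fract_hom = to_fract_power to_fract_numeral

lemma curve_H_eq: "curve_H = Quartic (to_fract cA) (to_fract cB) (to_fract cC) (to_fract cD) (to_fract cE)"
proof -
  have t: "tvar = to_fract T" by (simp add: tvar_def to_fract_def)
  show ?thesis
    unfolding curve_H_def Let_def t cA_def cB_def cC_def cD_def cE_def by (simp add: to_fract_hom)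
qed

lemma quartic_disc_hom:
  "quartic_disc (to_ac a) (to_ac b) (to_ac c) (to_ac d) (to_ac e) = to_ac (quartic_disc a b c d e)"
  by (simp add: quartic_disc_def Let_def)

lemma quartic_disc_to_fract:
  "quartic_disc (to_fract a) (to_fract b) (to_fract c) (to_fract d) (to_fract e) = to_fract (quartic_disc a b c d e)"
  by (simp add: quartic_disc_def Let_def to_fract_hom)

lemma quartic_disc_poly:
  fixes a b c d e :: "'a::comm_ring_1 poly"
  shows "quartic_disc (poly a x) (poly b x) (poly c x) (poly d x) (poly e x) = poly (quartic_disc a b c d e) x"
  by (simp add: quartic_disc_def Let_def)

text \<open>The value at \<open>t = 1\<close> is a nonzero integer.\<close>

lemma disc_H: "quartic_disc cA cB cC cD cE \<noteq> 0"
proof -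
  have "poly cA 1 = 4" "poly cB 1 = 24" "poly cC 1 = - 72" "poly cD 1 = 36" "poly cE 1 = 9"
    by (simp_all add: cA_def cB_def cC_def cD_def cE_def)
  then have "poly (quartic_disc cA cB cC cD cE) 1 = quartic_disc 4 24 (- 72) 36 9"
    by (simp flip: quartic_disc_poly)
  also have "\<dots> \<noteq> 0" by (simp add: quartic_disc_def)
  finally show ?thesis by auto
qed

lemma smooth_H: "smooth_curve (geometric curve_H)"
  unfolding curve_H_eq quartic.map
  by (rule smooth_curve_disc) (simp add: quartic_disc_hom quartic_disc_to_fract disc_H)

definition sH :: "rat poly" where "sH = T^4 * (1 + T^4)"

interpretation H: rational_quartic curve_H "to_fract sH"
proof
  show "smooth_curve (geometric curve_H)" by (rule smooth_H)
  have "cA = sH^2" by (simp add: cA_def sH_def power_mult_distrib flip: power_mult)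
  moreover have "coeff (dehom_q curve_H) 4 = to_fract cA" by (simp add: curve_H_eq numeral_eq_Suc)
  ultimately show "(to_fract sH)^2 = coeff (dehom_q curve_H) 4" by (metis to_fract_power)
  have "poly sH 1 \<noteq> 0" by (simp add: sH_def)
  then have "sH \<noteq> 0" by auto
  then show "to_fract sH \<noteq> 0" by simp
qed

text \<open>
  After the change of variable \<open>u = c u'\<close> with \<open>c = t^3 (1 + t^4)^2\<close>, the quartic becomes the square
  of \<open>sH\<close> times a polynomial over \<open>\<rat>[t]\<close> that reduces to \<open>1 + 4 u'\<close> at \<open>t = 0\<close>.
\<close>

definition "cU = T^3 * (1 + T^4)^2"

definition scaled_H :: "rat poly poly" where
  "scaled_H = [:1, 4 * (1 + 2 * T^4 + 2 * T^8 + T^12),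
     - 2 * T^2 * (4 + 3 * T^2 + 9 * T^4 + 4 * T^6 + 9 * T^8 + 3 * T^10 + 4 * T^12) * (1 + T^4)^2,
     4 * T^4 * (1 - T^2 + T^4) * (1 + T^2 + T^4)^2 * (1 + T^4)^4,
     T^8 * (1 + T^2 + T^4)^2 * (1 + T^4)^6:]"

lemma scaled_H: "pcompose [:cA, cB, cC, cD, cE:] [:0, cU:] = smult (sH^2) scaled_H"
proof -
  \<comment> \<open>Opaque names keep the powers of \<open>t\<close> and of \<open>1 + t^4\<close> from being expanded.\<close>
  define t A where "t = T" and "A = 1 + t^4"
  have "cA = sH^2" "cB * cU = sH^2 * (4 * (1 + 2 * T^4 + 2 * T^8 + T^12))"
    "cC * cU^2 = sH^2 * (- 2 * T^2 * (4 + 3 * T^2 + 9 * T^4 + 4 * T^6 + 9 * T^8 + 3 * T^10 + 4 * T^12) * (1 + T^4)^2)"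
    "cD * cU^3 = sH^2 * (4 * T^4 * (1 - T^2 + T^4) * (1 + T^2 + T^4)^2 * (1 + T^4)^4)"
    "cE * cU^4 = sH^2 * (T^8 * (1 + T^2 + T^4)^2 * (1 + T^4)^6)"
    unfolding cA_def cB_def cC_def cD_def cE_def cU_def sH_def t_def[symmetric] A_def[symmetric]
    by (simp_all add: power_mult_distrib algebra_simps flip: power_add power_mult)
  note c = this
  have "pcompose [:cA, cB, cC, cD, cE:] [:0, cU:] = [:cA, cB * cU, cC * cU^2, cD * cU^3, cE * cU^4:]"
    by (simp add: pcompose_pCons power2_eq_square power3_eq_cube power4_eq_xxxx mult_ac)
  then show ?thesis unfolding scaled_H_def by (simp only: c smult_pCons smult_0_right mult_1_right)
qed

lemma scaled_H_0: "map_poly (\<lambda>c. poly c 0) scaled_H = [:1, 4:]"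
  by (simp add: scaled_H_def map_poly_pCons)

text \<open>
  The substitution \<open>up\<close> is \<open>u = c u'\<close>. It turns a square root \<open>t\<close> of \<open>F(1, u)\<close> modulo \<open>u^(2n)\<close> into
  \<open>sH\<close> times a square root \<open>w\<close> of the scaled quartic over \<open>\<rat>[t]\<close>, to which the nonexistence of
  approximations applies.
\<close>

theorem H_not_torsion:
  assumes n: "n > 0"
  shows "\<not> principal (geometric curve_H) (\<lambda>Y. int n *
    (of_bool (Y = inf (to_ac (to_fract sH))) - of_bool (Y = inf (- to_ac (to_fract sH)))))"
proof
  assume "principal (geometric curve_H) (\<lambda>Y. int n *
    (of_bool (Y = inf (to_ac (to_fract sH))) - of_bool (Y = inf (- to_ac (to_fract sH)))))"
  from H.torsion_gives_approximation[OF this] obtain \<alpha> \<beta> where ab: "\<alpha> \<noteq> 0 \<or> \<beta> \<noteq> 0"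
    "degree \<alpha> \<le> n" "\<beta> = 0 \<or> degree \<beta> + 2 \<le> n"
    "\<And>t. poly t 0 = to_fract sH \<Longrightarrow> [:0, 1:] ^ (2 * n) dvd t^2 - dehom_p curve_H \<Longrightarrow>
       [:0, 1:] ^ (2 * n) dvd \<alpha> + \<beta> * t" by blast
  let ?F = "map_poly to_fract"
  let ?u = "[:0, 1:] :: rat poly fract poly"
  have "[:0, 1:] dvd 1^2 - scaled_H" "[:0, 1:] dvd [:[:1 / 2:]:] * (2 * 1) - (1 :: rat poly poly)"
    by (simp_all add: dvd_iff_poly_eq_0[of 0, simplified] scaled_H_def numeral_poly)
  from sqrt_mod_power[OF this, of "2 * n"]
  obtain w where w: "[:0, 1:] dvd w - 1" "[:0, 1:] ^ Suc (2 * n) dvd w^2 - scaled_H" by blast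
  have w1: "poly w 0 = 1" using w(1) dvd_iff_poly_eq_0[of 0 "w - 1"] by simp
  have w2: "[:0, 1:] ^ (2 * n) dvd w^2 - scaled_H" using w(2) by (rule power_le_dvd) simp
  define c where "c = to_fract cU"
  have "poly cU 1 \<noteq> 0" by (simp add: cU_def)
  then have "cU \<noteq> 0" by auto
  then have c: "c \<noteq> 0" by (simp add: c_def)
  have s0: "to_fract sH \<noteq> 0" by (rule H.lead0(2))
  define up where "up p = pcompose p [:0, c:]" for p
  define down where "down p = pcompose p [:0, 1 / c:]" for p
  have ud: "up (down p) = p" "down (up p) = p" for p
    using c by (simp_all add: up_def down_def flip: pcompose_assoc add: pcompose_pCons)
  have up_dvd: "?u ^ (2 * n) dvd up p \<longleftrightarrow> ?u ^ (2 * n) dvd p" for p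
    using c monom_1_dvd_iff'[of "2 * n" "up p"] monom_1_dvd_iff'[of "2 * n" p]
    by (simp add: monom_altdef up_def coeff_pcompose_linear)
  define t where "t = smult (to_fract sH) (down (?F w))"
  have up_hom: "up (p * q) = up p * up q" "up (p + q) = up p + up q" "up (p - q) = up p - up q"
    "up (smult k p) = smult k (up p)" for p q k
    by (simp_all add: up_def pcompose_mult pcompose_add pcompose_diff pcompose_smult)
  have up_t: "up t = smult (to_fract sH) (?F w)" by (simp add: t_def up_hom ud)
  have F: "dehom_p curve_H = ?F [:cA, cB, cC, cD, cE:]"
    by (simp add: curve_H_eq map_poly_pCons)
  have up_map: "up (?F p) = ?F (pcompose p [:0, cU:])" for p
    by (intro poly_eqI) (simp add: up_def coeff_pcompose_linear coeff_map_poly c_def to_fract_power)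
  have up_F: "up (dehom_p curve_H) = smult ((to_fract sH)^2) (?F scaled_H)"
    unfolding F up_map scaled_H fract_poly_smult to_fract_power ..
  have "up (t^2 - dehom_p curve_H) = smult ((to_fract sH)^2) (?F (w^2 - scaled_H))"
    by (simp add: power2_eq_square up_hom up_t up_F smult_diff_right)
  moreover have "?u ^ (2 * n) dvd ?F (w^2 - scaled_H)"
  proof -
    have "?F ([:0, 1:] ^ (2 * n)) = ?u ^ (2 * n)"
      using map_poly_monom[of to_fract "1 :: rat poly" "2 * n"] by (simp add: monom_altdef)
    then show ?thesis using fract_poly_dvd[OF w2] by simp
  qed
  ultimately have "?u ^ (2 * n) dvd t^2 - dehom_p curve_H"
    using up_dvd[of "t^2 - dehom_p curve_H"] by (simp only: dvd_smult)
  moreover have "poly t 0 = to_fract sH"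
    using w1 by (simp add: t_def down_def poly_pcompose poly_0_coeff_0 coeff_map_poly)
  ultimately have "?u ^ (2 * n) dvd up (\<alpha> + \<beta> * t)" unfolding up_dvd by (intro ab(4))
  then have "?u ^ (2 * n) dvd up \<alpha> + smult (to_fract sH) (up \<beta>) * ?F w"
    by (simp add: up_hom up_t)
  moreover have "degree (up \<alpha>) \<le> n" "smult (to_fract sH) (up \<beta>) = 0 \<or> degree (smult (to_fract sH) (up \<beta>)) + 2 \<le> n"
    using ab(2,3) c s0 by (auto simp: up_def degree_pcompose)
  moreover have "[:0, 1:] ^ (2 * n) dvd map_poly (\<lambda>c. poly c 0) w ^ 2 - [:1, 4:]"
  proof -
    let ?ev = "map_poly (\<lambda>c. poly c (0::rat))"
    have "?ev (w * w) = ?ev w * ?ev w" "?ev (w * w - scaled_H) = ?ev (w * w) - ?ev scaled_H"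
      by (intro poly_eqI, simp add: coeff_map_poly coeff_mult poly_sum)+
    then have ev: "?ev (w^2 - scaled_H) = ?ev w ^ 2 - [:1, 4:]"
      by (simp only: power2_eq_square scaled_H_0)
    have "monom 1 (2 * n) dvd w^2 - scaled_H" using w2 by (simp add: monom_altdef)
    then have "monom 1 (2 * n) dvd ?ev (w^2 - scaled_H)"
      unfolding monom_1_dvd_iff' by (simp add: coeff_map_poly)
    then show ?thesis unfolding ev by (simp add: monom_altdef)
  qed
  ultimately have "up \<alpha> = 0 \<and> smult (to_fract sH) (up \<beta>) = 0"
    using no_approximation_fract[OF n w1] by blast
  then have "up \<alpha> = 0" "up \<beta> = 0" using s0 by simp_all
  then have "\<alpha> = 0" "\<beta> = 0" using ud(2)[of \<alpha>] ud(2)[of \<beta>] by (simp_all add: down_def)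
  then show False using ab(1) by blast
qed

theorem theorem3p3:
  shows "elliptic_curve curve_H \<and>
    (\<forall>Z \<in> rational_points curve_H. group_rank (point_group curve_H Z) \<ge> 1)"
proof (intro conjI ballI)
  have "inf (to_ac (to_fract sH)) \<in> rational_points curve_H" by (rule H.rat_inf) simp
  then show "elliptic_curve curve_H"
    unfolding elliptic_curve_def using smooth_H H.irreducible H.genus_one by blast
  show "group_rank (point_group curve_H Z) \<ge> 1" if "Z \<in> rational_points curve_H" for Z
    using H_not_torsion that by (rule H.rank_ge_1)
qed

end
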